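(* Let $M,M'\subseteq\mathbb{C}^{n+1}$ be real analytic hypersurfaces through $0$, given near $0$ in normal coordinates by $w=Q(z,\bar z,\bar w)$ and $w'=Q'(z',\bar z',\bar w')$ respectively, with complexifications $\mathcal{M}$ and $\mathcal{M}'$. Assume that $M$ is of class $\mathcal{C}$ at $0$, and let $\mathcal{H}=(f,g,\tilde f,\tilde g)$ be a holomorphic Segre preserving map (HSPM) sending $(\mathcal{M},0)$ into $(\mathcal{M}',0)$. Then one of the following two possibilities must hold: (1) $\mathcal{H}$ is transversally null, and $Q'\big(f(z,w),\tilde f(\chi,\tau),0\big)\equiv 0$; that is, $\mathcal{H}$ maps a neighborhood of $0$ in $\mathbb{C}^{2n+2}$ into $\mathcal{M}'$. (2) $\mathcal{H}$ is Segre transversal to $\mathcal{M}'$ at $0$ and totally Segre nondegenerate at $0$, and $\mathcal{H}$ is a biholomorphism near some $p\in\mathcal{M}$ (in the domain of definition of $\mathcal{H}$). Furthermore, $M'$ is of class $\mathcal{C}$ at $0$.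
   Context: Here $n\ge 1$, and everything is local near $0$. Coordinates on $\mathbb{C}^{n+1}\times\mathbb{C}^{n+1}$ are $(Z,\zeta)$ with $Z=(z,w)\in\mathbb{C}^n\times\mathbb{C}$, $\zeta=(\chi,\tau)\in\mathbb{C}^n\times\mathbb{C}$ (primed for the target). Normal coordinates: the real analytic hypersurface $M\subseteq\mathbb{C}^{n+1}$ is given near $0\in M$ by $w=Q(z,\bar z,\bar w)$, where $Q(z,\chi,\tau)$ is holomorphic near $0$ in $\mathbb{C}^n\times\mathbb{C}^n\times\mathbb{C}$ and $Q(0,\chi,\tau)\equiv Q(z,0,\tau)\equiv\tau$. Since $M$ is a real hypersurface, $Q(z,\chi,\overline{Q}(\chi,z,w))\equiv w$, where $\overline{\varphi}(x):=\overline{\varphi(\bar x)}$. Similarly for $M'$ and $Q'$. Complexification: $\mathcal{M}$ is the holomorphic hypersurface $\{(z,w,\chi,\tau): w=Q(z,\chi,\tau)\}$ in $\mathbb{C}^{2n+2}$ near $0$; similarly $\mathcal{M}'$ with $Q'$. HSPM: a holomorphic Segre preserving map sending $(\mathcal{M},0)$ into $(\mathcal{M}',0)$ is a holomorphic map, defined near $0$ in $\mathbb{C}^{2n+2}$, of the form $\mathcal{H}(z,w,\chi,\tau)=\big(H(z,w),\widetilde H(\chi,\tau)\big)=\big(f(z,w),g(z,w),\tilde f(\chi,\tau),\tilde g(\chi,\tau)\big)$ with $\mathcal{H}(0)=0$ and $\mathcal{H}$ mapping $\mathcal{M}$ (near $0$) into $\mathcal{M}'$; here $f,\tilde f$ are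 $\mathbb{C}^n$-valued and $g,\tilde g$ are $\mathbb{C}$-valued holomorphic functions. ($\widetilde H$ need not be related to $\overline H$.) Transversally null: $g(z,w)\equiv 0$ and $\tilde g(\chi,\tau)\equiv 0$. Segre transversal to $\mathcal{M}'$ at $0$: $g_w(0)=\tilde g_\tau(0)\ne 0$ (the equality $g_w(0)=\tilde g_\tau(0)$ always holds in normal coordinates). Totally Segre nondegenerate at $0$: $\det\big(f_z(z,0)\big)\not\equiv 0$ and $\det\big(\tilde f_\chi(\chi,0)\big)\not\equiv 0$. Generic rank of a holomorphic map $\varphi(Z)$: the largest integer $r$ such that some $r\times r$ minor of the Jacobian matrix $\partial\varphi/\partial Z$ is not identically $0$. Class $\mathcal{C}$ at $0$: there is an integer $K$ such that the map $\chi\mapsto\big(Q_{z^\alpha}(0,\chi,0)\big)_{|\alpha|\le K}$ has generic rank $n$. The same definition applies to $M'$ with $Q'$. *)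

theory Defs
  imports "HOL-Analysis.Analysis"
begin

section \<open>Holomorphic maps of several complex variables\<close>

class complex_normed_space = real_normed_vector +
  fixes cscale :: "complex \<Rightarrow> 'a \<Rightarrow> 'a"
  assumes cscale_add_right: "cscale a (x + y) = cscale a x + cscale a y"
    and cscale_add_left: "cscale (a + b) x = cscale a x + cscale b x"
    and cscale_cscale: "cscale a (cscale b x) = cscale (a * b) x"
    and cscale_of_real: "cscale (complex_of_real r) x = r *\<^sub>R x"
    and norm_cscale: "norm (cscale a x) = cmod a * norm x"

instantiation complex :: complex_normed_space
begin

definition cscale_complex_def: "cscale a (x :: complex) = a * x"

instance
  by standard (auto simp: cscale_complex_def algebra_simps norm_mult scaleR_conv_of_real)

end

instantiation vec :: (complex_normed_space, finite) complex_normed_space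
begin

definition cscale_vec_def: "cscale a (x :: 'a ^ 'b) = (\<chi> i. cscale a (x $ i))"

instance
proof
  fix a b :: complex and r :: real and x y :: "'a ^ 'b"
  show "cscale a (x + y) = cscale a x + cscale a y"
    by (simp add: cscale_vec_def vec_eq_iff cscale_add_right)
  show "cscale (a + b) x = cscale a x + cscale b x"
    by (simp add: cscale_vec_def vec_eq_iff cscale_add_left)
  show "cscale a (cscale b x) = cscale (a * b) x"
    by (simp add: cscale_vec_def vec_eq_iff cscale_cscale)
  show "cscale (complex_of_real r) x = r *\<^sub>R x"
    by (simp add: cscale_vec_def vec_eq_iff cscale_of_real)
  show "norm (cscale a x) = cmod a * norm x"
    by (simp add: cscale_vec_def norm_vec_def norm_cscale L2_set_right_distrib)
qed

end

instantiation prod :: (complex_normed_space, complex_normed_space) complex_normed_space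
begin

definition cscale_prod_def: "cscale a (x :: 'a \<times> 'b) = (cscale a (fst x), cscale a (snd x))"

instance
proof
  fix a b :: complex and r :: real and x y :: "'a \<times> 'b"
  show "cscale a (x + y) = cscale a x + cscale a y"
    by (simp add: cscale_prod_def cscale_add_right)
  show "cscale (a + b) x = cscale a x + cscale b x"
    by (simp add: cscale_prod_def cscale_add_left)
  show "cscale a (cscale b x) = cscale (a * b) x"
    by (simp add: cscale_prod_def cscale_cscale)
  show "cscale (complex_of_real r) x = r *\<^sub>R x"
    by (simp add: cscale_prod_def cscale_of_real prod_eq_iff)
  show "norm (cscale a x) = cmod a * norm x"
  proof -
    have "norm (cscale a x) = sqrt ((cmod a)\<^sup>2 * ((norm (fst x))\<^sup>2 + (norm (snd x))\<^sup>2))"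
      by (simp add: cscale_prod_def norm_prod_def norm_cscale power_mult_distrib distrib_left)
    then show ?thesis
      by (simp add: real_sqrt_mult norm_prod_def)
  qed
qed

end

text \<open>Complex differentiability at every point; only used for open \<open>S\<close>.\<close>

definition holomorphic_map_on ::
    "('a::complex_normed_space \<Rightarrow> 'b::complex_normed_space) \<Rightarrow> 'a set \<Rightarrow> bool" where
  "holomorphic_map_on F S \<longleftrightarrow>
     (\<forall>x\<in>S. \<exists>D. (F has_derivative D) (at x) \<and> (\<forall>c v. D (cscale c v) = cscale c (D v)))"

definition biholomorphic_near ::
    "('a::complex_normed_space \<Rightarrow> 'b::complex_normed_space) \<Rightarrow> 'a \<Rightarrow> 'a set \<Rightarrow> bool" where
  "biholomorphic_near F p U \<longleftrightarrow>
     (\<exists>W W'. open W \<and> p \<in> W \<and> W \<subseteq> U \<and> open W' \<and> bij_betw F W W' \<and>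
        holomorphic_map_on F W \<and> holomorphic_map_on (inv_into W F) W')"

definition cpartial :: "'n \<Rightarrow> (complex ^ 'n::finite \<Rightarrow> complex) \<Rightarrow> complex ^ 'n \<Rightarrow> complex" where
  "cpartial j h z = deriv (\<lambda>t. h (z + axis j t)) 0"

text \<open>The derivative \<open>h\<^bsub>z^\<alpha>\<^esub>\<close> for a multi-index \<open>\<alpha>\<close>. The partial derivatives are taken in the
  order of an arbitrary enumeration of the coordinates; on holomorphic functions they commute.\<close>

definition multi_deriv ::
    "('n \<Rightarrow> nat) \<Rightarrow> (complex ^ 'n::finite \<Rightarrow> complex) \<Rightarrow> complex ^ 'n \<Rightarrow> complex" where
  "multi_deriv \<alpha> h =
     fold (\<lambda>j. cpartial j ^^ \<alpha> j) (SOME js. distinct js \<and> set js = UNIV) h"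

definition cjacobian :: "(complex ^ 'n \<Rightarrow> complex ^ 'm) \<Rightarrow> complex ^ 'n::finite \<Rightarrow> complex ^ 'n ^ 'm::finite" where
  "cjacobian F z = (\<chi> i j. cpartial j (\<lambda>x. F x $ i) z)"

text \<open>The \<open>r \<times> r\<close> minor, by the Leibniz formula, of the Jacobian matrix at \<open>z\<close> of the map
  \<open>z \<mapsto> (\<phi> z i)\<^sub>i\<close>, with rows \<open>a 0, \<dots>, a (r - 1)\<close> and columns \<open>b 0, \<dots>, b (r - 1)\<close>.\<close>

definition jacobian_minor ::
    "(complex ^ 'n::finite \<Rightarrow> 'i \<Rightarrow> complex) \<Rightarrow> nat \<Rightarrow> (nat \<Rightarrow> 'i) \<Rightarrow> (nat \<Rightarrow> 'n) \<Rightarrow> complex ^ 'n \<Rightarrow> complex" where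
  "jacobian_minor \<phi> r a b z =
     (\<Sum>p | p permutes {..<r}. of_int (sign p) * (\<Prod>k<r. cpartial (b (p k)) (\<lambda>x. \<phi> x (a k)) z))"

text \<open>Generic rank near \<open>0\<close> of a map whose components are indexed by the finite set \<open>I\<close>; here and
  below, \<open>\<equiv>\<close> between (germs of) functions is rendered as equality on a neighbourhood of \<open>0\<close>.\<close>

definition generic_rank :: "'i set \<Rightarrow> (complex ^ 'n::finite \<Rightarrow> 'i \<Rightarrow> complex) \<Rightarrow> nat" where
  "generic_rank I \<phi> =
     Max {r. \<exists>a b. inj_on a {..<r} \<and> a ` {..<r} \<subseteq> I \<and> inj_on b {..<r} \<and>
                \<not> (\<forall>\<^sub>F z in nhds 0. jacobian_minor \<phi> r a b z = 0)}"

section \<open>Real analytic hypersurfaces and normal coordinates\<close>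

definition real_analytic_at :: "('a::euclidean_space \<Rightarrow> real) \<Rightarrow> 'a \<Rightarrow> bool" where
  "real_analytic_at \<rho> p \<longleftrightarrow>
     (\<exists>e>0. \<exists>c. \<forall>x\<in>ball p e.
        ((\<lambda>\<alpha>. c \<alpha> * (\<Prod>b\<in>Basis. ((x - p) \<bullet> b) ^ \<alpha> b)) has_sum \<rho> x)
          {\<alpha> :: 'a \<Rightarrow> nat. \<forall>b. b \<notin> Basis \<longrightarrow> \<alpha> b = 0})"

definition real_analytic_hypersurface_at :: "'a::euclidean_space set \<Rightarrow> 'a \<Rightarrow> bool" where
  "real_analytic_hypersurface_at M p \<longleftrightarrow>
     p \<in> M \<and>
     (\<exists>U \<rho>. open U \<and> p \<in> U \<and> (\<forall>x\<in>U. real_analytic_at \<rho> x) \<and>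
        (\<exists>D. (\<rho> has_derivative D) (at p) \<and> D \<noteq> (\<lambda>_. 0)) \<and>
        M \<inter> U = {x \<in> U. \<rho> x = 0})"

definition cnj_vec :: "complex ^ 'n \<Rightarrow> complex ^ 'n::finite" where
  "cnj_vec z = (\<chi> i. cnj (z $ i))"

definition conj_fun ::
    "((complex ^ 'n) \<times> (complex ^ 'n) \<times> complex \<Rightarrow> complex) \<Rightarrow>
     (complex ^ 'n::finite) \<times> (complex ^ 'n) \<times> complex \<Rightarrow> complex" where
  "conj_fun Q = (\<lambda>(x, y, t). cnj (Q (cnj_vec x, cnj_vec y, cnj t)))"

text \<open>\<open>V\<close> is the domain of \<open>Q(z, \<chi>, \<tau>)\<close>.  The last-but-one conjunct is the identity
  \<open>Q(z, \<chi>, conj_fun Q (\<chi>, z, w)) \<equiv> w\<close>, which holds because \<open>M\<close> is a real hypersurface.\<close>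

definition normal_coordinates ::
    "((complex ^ 'n) \<times> complex) set \<Rightarrow> ((complex ^ 'n) \<times> (complex ^ 'n) \<times> complex) set \<Rightarrow>
     ((complex ^ 'n::finite) \<times> (complex ^ 'n) \<times> complex \<Rightarrow> complex) \<Rightarrow> bool" where
  "normal_coordinates M V Q \<longleftrightarrow>
     open V \<and> 0 \<in> V \<and> holomorphic_map_on Q V \<and>
     (\<forall>\<^sub>F (chi, \<tau>) in nhds 0. Q (0, chi, \<tau>) = \<tau>) \<and>
     (\<forall>\<^sub>F (z, \<tau>) in nhds 0. Q (z, 0, \<tau>) = \<tau>) \<and>
     (\<forall>\<^sub>F (z, chi, w) in nhds 0. Q (z, chi, conj_fun Q (chi, z, w)) = w) \<and>
     (\<forall>\<^sub>F (z, w) in nhds 0. (z, w) \<in> M \<longleftrightarrow> w = Q (z, cnj_vec z, cnj w))"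

definition complexification ::
    "((complex ^ 'n) \<times> (complex ^ 'n) \<times> complex) set \<Rightarrow>
     ((complex ^ 'n::finite) \<times> (complex ^ 'n) \<times> complex \<Rightarrow> complex) \<Rightarrow>
     (((complex ^ 'n) \<times> complex) \<times> ((complex ^ 'n) \<times> complex)) set" where
  "complexification V Q = {((z, w), (chi, \<tau>)). (z, chi, \<tau>) \<in> V \<and> w = Q (z, chi, \<tau>)}"

definition class_C :: "((complex ^ 'n::finite) \<times> (complex ^ 'n) \<times> complex \<Rightarrow> complex) \<Rightarrow> bool" where
  "class_C Q \<longleftrightarrow>
     (\<exists>K::nat. generic_rank {\<alpha> :: 'n \<Rightarrow> nat. (\<Sum>i\<in>UNIV. \<alpha> i) \<le> K}
        (\<lambda>chi \<alpha>. multi_deriv \<alpha> (\<lambda>z. Q (z, chi, 0)) 0) = CARD('n))"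

section \<open>Holomorphic Segre preserving maps\<close>

definition segre_map ::
    "((complex ^ 'n) \<times> complex \<Rightarrow> complex ^ 'n) \<Rightarrow> ((complex ^ 'n) \<times> complex \<Rightarrow> complex) \<Rightarrow>
     ((complex ^ 'n) \<times> complex \<Rightarrow> complex ^ 'n) \<Rightarrow> ((complex ^ 'n) \<times> complex \<Rightarrow> complex) \<Rightarrow>
     ((complex ^ 'n::finite) \<times> complex) \<times> ((complex ^ 'n) \<times> complex) \<Rightarrow>
     ((complex ^ 'n) \<times> complex) \<times> ((complex ^ 'n) \<times> complex)" where
  "segre_map f g ft gt = (\<lambda>(Z, \<zeta>). ((f Z, g Z), (ft \<zeta>, gt \<zeta>)))"

text \<open>\<open>U\<close> is the domain of definition of the map, \<open>X\<close> and \<open>X'\<close> the complexified hypersurfaces.\<close>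

definition HSPM ::
    "(((complex ^ 'n) \<times> complex) \<times> ((complex ^ 'n) \<times> complex)) set \<Rightarrow>
     ((complex ^ 'n) \<times> complex \<Rightarrow> complex ^ 'n) \<Rightarrow> ((complex ^ 'n) \<times> complex \<Rightarrow> complex) \<Rightarrow>
     ((complex ^ 'n) \<times> complex \<Rightarrow> complex ^ 'n) \<Rightarrow> ((complex ^ 'n) \<times> complex \<Rightarrow> complex) \<Rightarrow>
     (((complex ^ 'n) \<times> complex) \<times> ((complex ^ 'n) \<times> complex)) set \<Rightarrow>
     (((complex ^ 'n::finite) \<times> complex) \<times> ((complex ^ 'n) \<times> complex)) set \<Rightarrow> bool" where
  "HSPM U f g ft gt X X' \<longleftrightarrow>
     open U \<and> 0 \<in> U \<and> holomorphic_map_on (segre_map f g ft gt) U \<and>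
     segre_map f g ft gt 0 = 0 \<and>
     (\<forall>\<^sub>F p in nhds 0. p \<in> X \<longrightarrow> segre_map f g ft gt p \<in> X')"

definition transversally_null ::
    "((complex ^ 'n::finite) \<times> complex \<Rightarrow> complex) \<Rightarrow> ((complex ^ 'n) \<times> complex \<Rightarrow> complex) \<Rightarrow> bool" where
  "transversally_null g gt \<longleftrightarrow> (\<forall>\<^sub>F Z in nhds 0. g Z = 0) \<and> (\<forall>\<^sub>F \<zeta> in nhds 0. gt \<zeta> = 0)"

definition segre_transversal ::
    "((complex ^ 'n::finite) \<times> complex \<Rightarrow> complex) \<Rightarrow> ((complex ^ 'n) \<times> complex \<Rightarrow> complex) \<Rightarrow> bool" where
  "segre_transversal g gt \<longleftrightarrow>
     deriv (\<lambda>w. g (0, w)) 0 = deriv (\<lambda>\<tau>. gt (0, \<tau>)) 0 \<and> deriv (\<lambda>w. g (0, w)) 0 \<noteq> 0"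

definition totally_segre_nondegenerate ::
    "((complex ^ 'n::finite) \<times> complex \<Rightarrow> complex ^ 'n) \<Rightarrow>
     ((complex ^ 'n) \<times> complex \<Rightarrow> complex ^ 'n) \<Rightarrow> bool" where
  "totally_segre_nondegenerate f ft \<longleftrightarrow>
     \<not> (\<forall>\<^sub>F z in nhds 0. det (cjacobian (\<lambda>z. f (z, 0)) z) = 0) \<and>
     \<not> (\<forall>\<^sub>F chi in nhds 0. det (cjacobian (\<lambda>chi. ft (chi, 0)) chi) = 0)"

end

theory Submission
  imports Defs "HOL-Complex_Analysis.Cauchy_Integral_Formula"
begin

text \<open>
  Write \<open>q(z,\<chi>) = Q(z,\<chi>,0)\<close>.  Class \<open>\<C>\<close> says that the family \<open>q(\<cdot>,\<chi>)\<close> separates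
  parameters infinitesimally: arbitrarily close to \<open>0\<close> there is a \<open>\<chi>\<close> at which
  \<open>D\<^sub>\<chi> q(z,\<chi>) u = 0\<close> for all \<open>z\<close> forces \<open>u = 0\<close> (\<open>class_C_iff_nondegenerate\<close>).  In this
  form the condition is easy to transport by the chain rule, and multi-indices disappear.

  A Segre preserving map satisfies \<open>g(z,q(z,\<chi>)) = k(f(z,q(z,\<chi>)),\<chi>)\<close> with
  \<open>k(z',\<chi>) = Q'(z',ft(\<chi>,0),0)\<close>.  The heart of the proof is the dichotomy
  \<open>extend_off_the_graph\<close>: if \<open>q\<close> separates parameters, then so does \<open>k\<close>, or else the identity
  \<open>g(z,w) = k(f(z,w),\<chi>)\<close> holds for independent \<open>z\<close>, \<open>w\<close>, \<open>\<chi>\<close>.  Indeed, along a direction \<open>u\<close>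
  that \<open>k\<close> does not see, differentiating the identity moves only \<open>w = q(z,\<chi>)\<close>, and \<open>w\<close> does
  move; so all \<open>w\<close>-derivatives of the difference vanish on the graph of \<open>q\<close>.  In the second
  case \<open>\<chi> = 0\<close> gives \<open>g = 0\<close>.  Hence if \<open>g\<close> is not identically \<open>0\<close>, then \<open>k\<close> separates
  parameters, which makes \<open>M'\<close> of class \<open>\<C>\<close> and \<open>ft(\<cdot>,0)\<close> generically immersive
  (\<open>nondegenerate_reparametrized\<close>).  Generic immersivity in turn makes the map fill out the
  Segre varieties of \<open>M'\<close>, so that \<open>g = 0\<close> if and only if \<open>gt = 0\<close>
  (\<open>g_vanishes_if_gt_vanishes\<close>).  If both vanish, the dichotomy is applied with the full
  parameter \<open>(\<chi>,\<tau>)\<close>: since \<open>ft\<close> maps \<open>n + 1\<close> variables to \<open>n\<close>, the first alternative is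
  impossible, and the second one is \<open>Q'(f,ft,0) = 0\<close> (\<open>null_case\<close>).

  For transversality let \<open>\<Phi> = g - Q'(f,ft,gt)\<close> and let \<open>h\<close> be the derivative of \<open>\<Phi>\<close> in the direction
  \<open>w\<close> along \<open>\<M>\<close>, the factor by which the map scales the conormal of \<open>\<M>\<close>.  It restricts to
  \<open>gt\<^sub>\<tau>(\<chi>,0)\<close> on \<open>z = 0\<close>, \<open>\<tau> = 0\<close> and to \<open>g\<^sub>w(z,0)\<close> on \<open>\<chi> = 0\<close>, \<open>\<tau> = 0\<close>.  Cramer's rule gives
  \<open>h(z,\<chi>) a(z,\<chi>) = h(0,\<chi>) a(0,\<chi>) b(z,\<chi>)\<close> with \<open>a(0,\<chi>)\<close> not identically \<open>0\<close>
  (\<open>slope_times_cofactor\<close>).  Comparing orders of vanishing in \<open>\<chi>\<close>, a zero of \<open>h\<close> at the origin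
  propagates to all \<open>z\<close> (\<open>zero_of_product_propagates\<close>), that is, \<open>g\<^sub>w(z,0) = 0\<close> for all \<open>z\<close>.
  This is excluded by \<open>gt_tau_not_zero\<close> with the roles of \<open>g\<close> and \<open>gt\<close> exchanged: the corresponding
  factor would vanish identically, and the corresponding \<open>k\<close> could not separate parameters.

  Finally the derivative of \<open>(f,g)\<close> at \<open>(z,0)\<close> is block triangular with blocks \<open>f\<^sub>z(z,0)\<close> and \<open>g\<^sub>w(z,0)\<close>, so it is invertible for generic \<open>z\<close>; the same holds for
  \<open>(ft,gt)\<close>, and the inverse function theorem applies at a suitable point of \<open>\<M>\<close>
  (\<open>biholomorphic_near_graph_point\<close>).

  The first sections develop the few facts on holomorphic functions of several variables that this
  uses, by restriction to complex lines: Cauchy estimates, holomorphy of directional derivatives,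
  and identity theorems.
\<close>

section \<open>Complex differentiability in several variables\<close>

abbreviation der :: "('a::real_normed_vector \<Rightarrow> 'b::real_normed_vector) \<Rightarrow> 'a \<Rightarrow> 'a \<Rightarrow> 'b" where
  "der F x \<equiv> frechet_derivative F (at x)"

text \<open>Pointwise complex differentiability, and its germ version \<open>hol_at\<close> below.  All statements are local, so
  holomorphy is treated as a property of germs; compositions then need no bookkeeping of domains.\<close>

definition cdiff :: "('a::complex_normed_space \<Rightarrow> 'b::complex_normed_space) \<Rightarrow> 'a \<Rightarrow> bool" where
  "cdiff F x \<longleftrightarrow> (\<exists>D. (F has_derivative D) (at x) \<and> (\<forall>c v. D (cscale c v) = cscale c (D v)))"

definition hol_at :: "('a::complex_normed_space \<Rightarrow> 'b::complex_normed_space) \<Rightarrow> 'a \<Rightarrow> bool" where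
  "hol_at F x \<longleftrightarrow> (\<forall>\<^sub>F y in nhds x. cdiff F y)"

lemma der_eqI: "(F has_derivative D) (at x) \<Longrightarrow> der F x = D"
  using frechet_derivative_at by metis

lemma cdiff_has_derivative: "cdiff F x \<Longrightarrow> (F has_derivative der F x) (at x)"
  unfolding cdiff_def using der_eqI by metis

lemma der_cscale: "cdiff F x \<Longrightarrow> der F x (cscale c v) = cscale c (der F x v)"
  unfolding cdiff_def using der_eqI by metis

lemma cdiff_isCont: "cdiff F x \<Longrightarrow> isCont F x"
  using cdiff_has_derivative has_derivative_continuous by blast

lemma der_linear: "cdiff F x \<Longrightarrow> linear (der F x)"
  using cdiff_has_derivative has_derivative_linear by blast

lemma cdiffI:
  "(F has_derivative D) (at x) \<Longrightarrow> (\<And>c v. D (cscale c v) = cscale c (D v)) \<Longrightarrow> cdiff F x"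
  unfolding cdiff_def by blast

lemma cscale_zero_right [simp]: "cscale c (0::'a::complex_normed_space) = 0"
  using norm_cscale[of c "0::'a"] by simp

lemma cscale_zero_left [simp]: "cscale 0 (x::'a::complex_normed_space) = 0"
  using norm_cscale[of 0 x] by simp

lemma cscale_one [simp]: "cscale 1 (x::'a::complex_normed_space) = x"
  using cscale_of_real[of 1 x] by simp

lemma cscale_diff_right: "cscale c (x - y) = cscale c x - cscale c (y::'a::complex_normed_space)"
  using cscale_add_right[of c "x - y" y] by (simp add: algebra_simps)

lemma cscale_minus_right: "cscale c (- x) = - cscale c (x::'a::complex_normed_space)"
  using cscale_diff_right[of c 0 x] by simp

lemma cscale_Pair [simp]: "cscale c (x, y) = (cscale c x, cscale c y)"
  by (simp add: cscale_prod_def)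

lemma fst_cscale [simp]: "fst (cscale c p) = cscale c (fst p)"
  by (simp add: cscale_prod_def)

lemma snd_cscale [simp]: "snd (cscale c p) = cscale c (snd p)"
  by (simp add: cscale_prod_def)

lemma cscale_complex [simp]: "cscale c (z::complex) = c * z"
  by (simp add: cscale_complex_def)

lemma cscale_nth [simp]: "cscale c x $ i = cscale c (x $ i)"
  by (simp add: cscale_vec_def)

lemma bounded_linear_cscale_left: "bounded_linear (\<lambda>t. cscale t (v::'a::complex_normed_space))"
proof (rule bounded_linear_intro[where K = "norm v"])
  fix r t
  have "cscale (r *\<^sub>R t) v = cscale (of_real r) (cscale t v)"
    by (simp add: cscale_cscale scaleR_conv_of_real)
  then show "cscale (r *\<^sub>R t) v = r *\<^sub>R cscale t v"
    by (simp add: cscale_of_real)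
qed (simp_all add: cscale_add_left norm_cscale)

lemma cdiff_const: "cdiff (\<lambda>x. c) x"
  by (rule cdiffI[OF has_derivative_const]) simp

lemma cdiff_ident: "cdiff (\<lambda>x. x) x"
  by (rule cdiffI[OF has_derivative_ident]) simp

lemma
  assumes "cdiff F x" "cdiff G (F x)"
  shows cdiff_compose: "cdiff (\<lambda>y. G (F y)) x" and der_compose: "der (\<lambda>y. G (F y)) x v = der G (F x) (der F x v)"
proof -
  have *: "((\<lambda>y. G (F y)) has_derivative (\<lambda>v. der G (F x) (der F x v))) (at x)"
    using has_derivative_compose[OF assms[THEN cdiff_has_derivative]] .
  show "cdiff (\<lambda>y. G (F y)) x"
    by (rule cdiffI[OF *]) (simp add: der_cscale assms)
  show "der (\<lambda>y. G (F y)) x v = der G (F x) (der F x v)"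
    using der_eqI[OF *] by simp
qed

lemma
  assumes "cdiff F x" "cdiff G x"
  shows cdiff_Pair: "cdiff (\<lambda>y. (F y, G y)) x" and der_Pair: "der (\<lambda>y. (F y, G y)) x v = (der F x v, der G x v)"
proof -
  have *: "((\<lambda>y. (F y, G y)) has_derivative (\<lambda>v. (der F x v, der G x v))) (at x)"
    using has_derivative_Pair[OF assms[THEN cdiff_has_derivative]] .
  show "cdiff (\<lambda>y. (F y, G y)) x"
    by (rule cdiffI[OF *]) (simp add: der_cscale assms)
  show "der (\<lambda>y. (F y, G y)) x v = (der F x v, der G x v)"
    using der_eqI[OF *] by simp
qed

lemma cdiff_fst:
  assumes "cdiff F x"
  shows "cdiff (\<lambda>y. fst (F y)) x"
  by (rule cdiffI[OF has_derivative_fst[OF cdiff_has_derivative[OF assms]]]) (simp add: der_cscale assms)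

lemma cdiff_snd:
  assumes "cdiff F x"
  shows "cdiff (\<lambda>y. snd (F y)) x"
  by (rule cdiffI[OF has_derivative_snd[OF cdiff_has_derivative[OF assms]]]) (simp add: der_cscale assms)

lemma
  assumes "cdiff F x"
  shows cdiff_nth: "cdiff (\<lambda>y. F y $ i) x" and der_nth: "der (\<lambda>y. F y $ i) x v = der F x v $ i"
proof -
  have *: "((\<lambda>y. F y $ i) has_derivative (\<lambda>v. der F x v $ i)) (at x)"
    using bounded_linear.has_derivative[OF bounded_linear_vec_nth cdiff_has_derivative[OF assms]] .
  show "cdiff (\<lambda>y. F y $ i) x"
    by (rule cdiffI[OF *]) (simp add: der_cscale assms)
  show "der (\<lambda>y. F y $ i) x v = der F x v $ i"
    using der_eqI[OF *] by simp
qed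

lemma cdiff_vec:
  fixes F :: "'a::complex_normed_space \<Rightarrow> complex ^ 'n::finite"
  assumes "\<And>i. cdiff (\<lambda>y. F y $ i) x"
  shows "cdiff F x"
proof (rule cdiffI)
  show "(F has_derivative (\<lambda>v. \<chi> i. der (\<lambda>y. F y $ i) x v)) (at x)"
    using cdiff_has_derivative[OF assms]
    by (subst has_derivative_componentwise_within)
      (auto simp: Basis_vec_def inner_axis intro!: has_derivative_inner_left)
  show "(\<chi> i. der (\<lambda>y. F y $ i) x (cscale c v)) = cscale c (\<chi> i. der (\<lambda>y. F y $ i) x v)" for c v
    by (simp add: vec_eq_iff der_cscale[OF assms])
qed

lemma
  assumes "cdiff F x" "cdiff G x"
  shows cdiff_add: "cdiff (\<lambda>y. F y + G y) x" and der_add: "der (\<lambda>y. F y + G y) x v = der F x v + der G x v"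
proof -
  have *: "((\<lambda>y. F y + G y) has_derivative (\<lambda>v. der F x v + der G x v)) (at x)"
    using has_derivative_add[OF assms[THEN cdiff_has_derivative]] .
  show "cdiff (\<lambda>y. F y + G y) x"
    by (rule cdiffI[OF *]) (simp add: der_cscale assms cscale_add_right)
  show "der (\<lambda>y. F y + G y) x v = der F x v + der G x v"
    using der_eqI[OF *] by simp
qed

lemma
  assumes "cdiff F x" "cdiff G x"
  shows cdiff_diff: "cdiff (\<lambda>y. F y - G y) x" and der_diff: "der (\<lambda>y. F y - G y) x v = der F x v - der G x v"
proof -
  have *: "((\<lambda>y. F y - G y) has_derivative (\<lambda>v. der F x v - der G x v)) (at x)"
    using has_derivative_diff[OF assms[THEN cdiff_has_derivative]] .
  show "cdiff (\<lambda>y. F y - G y) x"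
    by (rule cdiffI[OF *]) (simp add: der_cscale assms cscale_diff_right)
  show "der (\<lambda>y. F y - G y) x v = der F x v - der G x v"
    using der_eqI[OF *] by simp
qed

lemma
  fixes F G :: "'a::complex_normed_space \<Rightarrow> complex"
  assumes "cdiff F x" "cdiff G x"
  shows cdiff_mult: "cdiff (\<lambda>y. F y * G y) x"
    and der_mult: "der (\<lambda>y. F y * G y) x v = F x * der G x v + der F x v * G x"
proof -
  have *: "((\<lambda>y. F y * G y) has_derivative (\<lambda>v. F x * der G x v + der F x v * G x)) (at x)"
    using has_derivative_mult[OF assms[THEN cdiff_has_derivative]] .
  show "cdiff (\<lambda>y. F y * G y) x"
    by (rule cdiffI[OF *]) (simp add: der_cscale assms algebra_simps)
  show "der (\<lambda>y. F y * G y) x v = F x * der G x v + der F x v * G x"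
    using der_eqI[OF *] by simp
qed

lemma der_const [simp]: "der (\<lambda>x. c) x v = 0"
  using der_eqI[OF has_derivative_const] by metis

lemma der_ident [simp]: "der (\<lambda>x. x) x v = v"
  using der_eqI[OF has_derivative_ident] by metis

lemma
  assumes "\<forall>\<^sub>F y in nhds x. F y = G y" "cdiff F x"
  shows cdiff_cong: "cdiff G x" and der_cong: "der F x = der G x"
proof -
  have "(G has_derivative der F x) (at x)"
    by (rule has_derivative_transform_eventually[OF cdiff_has_derivative[OF assms(2)]])
      (use assms(1) in \<open>auto simp: eventually_nhds eventually_at_filter intro: eventually_mono\<close>)
  then show "cdiff G x" "der F x = der G x"
    using der_cscale[OF assms(2)] cdiffI der_eqI by metis+
qed

lemma hol_at_imp_cdiff: "hol_at F x \<Longrightarrow> cdiff F x"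
  unfolding hol_at_def using eventually_nhds_x_imp_x by blast

lemma hol_at_isCont: "hol_at F x \<Longrightarrow> isCont F x"
  using hol_at_imp_cdiff cdiff_isCont by blast

lemma hol_at_eventually: "hol_at F x \<Longrightarrow> \<forall>\<^sub>F y in nhds x. hol_at F y"
  unfolding hol_at_def by (simp add: eventually_eventually)

named_theorems hol

lemma hol_at_const [hol]: "hol_at (\<lambda>x. c) x"
  unfolding hol_at_def by (rule always_eventually) (simp add: cdiff_const)

lemma hol_at_ident [hol]: "hol_at (\<lambda>x. x) x"
  unfolding hol_at_def by (rule always_eventually) (simp add: cdiff_ident)

lemma filterlim_isCont: "isCont F x \<Longrightarrow> filterlim F (nhds (F x)) (nhds x)"
  unfolding continuous_at tendsto_at_iff_tendsto_nhds .

lemma hol_at_compose: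
  assumes "hol_at G (F x)" "hol_at F x"
  shows "hol_at (\<lambda>y. G (F y)) x"
  using eventually_compose_filterlim[OF assms(1)[unfolded hol_at_def] filterlim_isCont[OF hol_at_isCont[OF assms(2)]]]
    assms(2) unfolding hol_at_def
  by eventually_elim (rule cdiff_compose)

lemma hol_at_Pair [hol]: "hol_at F x \<Longrightarrow> hol_at G x \<Longrightarrow> hol_at (\<lambda>y. (F y, G y)) x"
  unfolding hol_at_def by (auto elim: eventually_elim2 intro: cdiff_Pair)

lemma hol_at_fst [hol]: "hol_at F x \<Longrightarrow> hol_at (\<lambda>y. fst (F y)) x"
  unfolding hol_at_def by (auto elim: eventually_mono intro: cdiff_fst)

lemma hol_at_snd [hol]: "hol_at F x \<Longrightarrow> hol_at (\<lambda>y. snd (F y)) x"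
  unfolding hol_at_def by (auto elim: eventually_mono intro: cdiff_snd)

lemma hol_at_nth [hol]: "hol_at F x \<Longrightarrow> hol_at (\<lambda>y. F y $ i) x"
  unfolding hol_at_def by (auto elim: eventually_mono intro: cdiff_nth)

lemma hol_at_vec:
  fixes F :: "'a::complex_normed_space \<Rightarrow> complex ^ 'n::finite"
  shows "(\<And>i. hol_at (\<lambda>y. F y $ i) x) \<Longrightarrow> hol_at F x"
  unfolding hol_at_def
  by (drule eventually_all_finite[where P = "\<lambda>y i. cdiff (\<lambda>y. F y $ i) y"])
    (erule eventually_mono, rule cdiff_vec, blast)

lemma hol_at_add [hol]: "hol_at F x \<Longrightarrow> hol_at G x \<Longrightarrow> hol_at (\<lambda>y. F y + G y) x"
  unfolding hol_at_def by (auto elim: eventually_elim2 intro: cdiff_add)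

lemma hol_at_diff [hol]: "hol_at F x \<Longrightarrow> hol_at G x \<Longrightarrow> hol_at (\<lambda>y. F y - G y) x"
  unfolding hol_at_def by (auto elim: eventually_elim2 intro: cdiff_diff)

lemma hol_at_mult [hol]:
  fixes F G :: "'a::complex_normed_space \<Rightarrow> complex"
  shows "hol_at F x \<Longrightarrow> hol_at G x \<Longrightarrow> hol_at (\<lambda>y. F y * G y) x"
  unfolding hol_at_def by (auto elim: eventually_elim2 intro: cdiff_mult)

lemma hol_at_sum [hol]:
  "(\<And>i. i \<in> A \<Longrightarrow> hol_at (F i) x) \<Longrightarrow> hol_at (\<lambda>y. \<Sum>i\<in>A. F i y) x"
  by (induction A rule: infinite_finite_induct) (simp_all add: hol)

lemma hol_at_prod [hol]:
  fixes F :: "'i \<Rightarrow> 'a::complex_normed_space \<Rightarrow> complex"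
  shows "(\<And>i. i \<in> A \<Longrightarrow> hol_at (F i) x) \<Longrightarrow> hol_at (\<lambda>y. \<Prod>i\<in>A. F i y) x"
  by (induction A rule: infinite_finite_induct) (simp_all add: hol)

lemma hol_at_det [hol]:
  fixes A :: "'a::complex_normed_space \<Rightarrow> complex ^ 'n ^ 'n::finite"
  shows "(\<And>i j. hol_at (\<lambda>y. A y $ i $ j) x) \<Longrightarrow> hol_at (\<lambda>y. det (A y)) x"
  unfolding det_def by (intro hol_at_sum hol_at_mult hol_at_const hol_at_prod)

lemma hol_at_cong: "\<forall>\<^sub>F y in nhds x. F y = G y \<Longrightarrow> hol_at F x \<Longrightarrow> hol_at G x"
  unfolding hol_at_def
  by (drule eventually_eventually[THEN iffD2], erule (1) eventually_elim2) (rule cdiff_cong)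

lemma eventually_nhds_ball:
  "(\<forall>\<^sub>F y in nhds (x::'a::metric_space). P y) \<longleftrightarrow> (\<exists>r>0. \<forall>y\<in>ball x r. P y)"
  by (auto simp: eventually_nhds_metric dist_commute)

lemma has_field_derivative_along_line:
  fixes h :: "'a::complex_normed_space \<Rightarrow> complex"
  assumes "cdiff h (x + cscale t v)"
  shows "((\<lambda>t. h (x + cscale t v)) has_field_derivative der h (x + cscale t v) v) (at t)"
proof -
  have 1: "((\<lambda>t. x + cscale t v) has_derivative (\<lambda>s. cscale s v)) (at t)"
    by (auto intro!: derivative_eq_intros bounded_linear.has_derivative[OF bounded_linear_cscale_left])
  have "((\<lambda>t. h (x + cscale t v)) has_derivative (\<lambda>s. der h (x + cscale t v) (cscale s v))) (at t)"
    using has_derivative_compose[OF 1 cdiff_has_derivative[OF assms]] .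
  then show ?thesis
    unfolding has_field_derivative_def
    by (simp add: der_cscale[OF assms] mult.commute[of "der h (x + cscale t v) v"] mult_commute_abs)
qed

text \<open>The one-variable Cauchy inequality on the complex line through \<open>x\<close> in direction \<open>v\<close>.  The disc of
  half the maximal radius is used to stay inside the open ball, at the price of the factor \<open>2\<close>.\<close>

lemma Cauchy_estimate_der:
  fixes h :: "'a::complex_normed_space \<Rightarrow> complex"
  assumes "r > 0" "\<And>y. y \<in> ball x r \<Longrightarrow> cdiff h y" "\<And>y. y \<in> ball x r \<Longrightarrow> norm (h y) \<le> M"
  shows "norm (der h x v) \<le> 2 * M / r * norm v"
proof (cases "v = 0")
  case True
  then show ?thesis
    using linear_0[OF der_linear[OF assms(2)[of x]]] assms(1) by simp
next
  case False
  define s where "s = r / (2 * norm v)"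
  have s: "s > 0" using False assms(1) by (simp add: s_def)
  have in_ball: "x + cscale t v \<in> ball x r" if "t \<in> cball 0 s" for t
  proof -
    have "norm (cscale t v) \<le> s * norm v"
      using that by (simp add: norm_cscale mult_right_mono)
    also have "\<dots> < r" using False assms(1) by (simp add: s_def)
    finally show ?thesis by (simp add: dist_norm)
  qed
  have deriv: "((\<lambda>t. h (x + cscale t v)) has_field_derivative der h (x + cscale t v) v) (at t)"
    if "t \<in> cball 0 s" for t
    using has_field_derivative_along_line assms(2) in_ball[OF that] by blast
  have "norm ((deriv ^^ 1) (\<lambda>t. h (x + cscale t v)) 0) \<le> fact 1 * M / s ^ 1"
  proof (rule Cauchy_inequality)
    show "(\<lambda>t. h (x + cscale t v)) holomorphic_on ball 0 s"
      using deriv holomorphic_on_open by (metis ball_subset_cball open_ball subsetD)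
    show "continuous_on (cball 0 s) (\<lambda>t. h (x + cscale t v))"
      using deriv by (meson DERIV_isCont continuous_at_imp_continuous_on)
    show "norm (h (x + cscale t v)) \<le> M" if "norm (0 - t) = s" for t
      using assms(3) in_ball[of t] that by simp
  qed (rule s)
  moreover have "deriv (\<lambda>t. h (x + cscale t v)) 0 = der h x v"
    using DERIV_imp_deriv[OF deriv[of 0]] s by simp
  ultimately show ?thesis
    by (simp add: s_def field_simps)
qed

section \<open>Germs at the origin\<close>

lemma der_bounded_linear: "bounded_linear L \<Longrightarrow> der L x = L"
  by (intro der_eqI bounded_linear_imp_has_derivative)

lemma eventually_hol_compose:
  "hol_at F x \<Longrightarrow> \<forall>\<^sub>F y in nhds (F x). P y \<Longrightarrow> \<forall>\<^sub>F y in nhds x. P (F y)"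
  using eventually_compose_filterlim[OF _ filterlim_isCont[OF hol_at_isCont]] by blast

lemma eventually_nhds_0_prodE:
  fixes P :: "'a::real_normed_vector \<times> 'b::real_normed_vector \<Rightarrow> bool"
  assumes "\<forall>\<^sub>F p in nhds 0. P p"
  obtains r where "r > 0" "\<And>x y. norm x < r \<Longrightarrow> norm y < r \<Longrightarrow> P (x, y)"
proof -
  obtain r where r: "r > 0" "\<forall>p\<in>ball 0 r. P p"
    using assms unfolding eventually_nhds_ball by blast
  show thesis
  proof (rule that[of "r / 2"])
    fix x :: 'a and y :: 'b assume "norm x < r / 2" "norm y < r / 2"
    then have "norm (x, y) < r"
      using norm_Pair_le[of x y] by simp
    then show "P (x, y)" using r(2) by simp
  qed (use r(1) in simp)
qed

lemma der_0: "cdiff F x \<Longrightarrow> der F x 0 = 0"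
  using linear_0[OF der_linear] .

lemma der_plus: "cdiff F x \<Longrightarrow> der F x (u + v) = der F x u + der F x v"
  using linear_add[OF der_linear] .

lemma eventually_hol_compose_0:
  "hol_at F 0 \<Longrightarrow> F 0 = 0 \<Longrightarrow> \<forall>\<^sub>F y in nhds 0. P y \<Longrightarrow> \<forall>\<^sub>F x in nhds 0. P (F x)"
  using eventually_hol_compose[of F 0 P] by simp

lemma hol_at_compose_0: "hol_at G 0 \<Longrightarrow> hol_at F 0 \<Longrightarrow> F 0 = 0 \<Longrightarrow> hol_at (\<lambda>y. G (F y)) 0"
  using hol_at_compose[of G F 0] by simp

lemma eventually_fst: "\<forall>\<^sub>F x in nhds 0. R x \<Longrightarrow> \<forall>\<^sub>F p :: 'x::complex_normed_space \<times> 'y::complex_normed_space in nhds 0. R (fst p)"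
  by (rule eventually_hol_compose_0[OF hol_at_fst[OF hol_at_ident] fst_zero])

lemma eventually_snd: "\<forall>\<^sub>F x in nhds 0. R x \<Longrightarrow> \<forall>\<^sub>F p :: 'x::complex_normed_space \<times> 'y::complex_normed_space in nhds 0. R (snd p)"
  by (rule eventually_hol_compose_0[OF hol_at_snd[OF hol_at_ident] snd_zero])

lemma eventually_slice_first:
  "\<forall>\<^sub>F p in nhds 0. R p \<Longrightarrow>
    \<forall>\<^sub>F y in nhds 0. R (0 :: 'x::complex_normed_space, y :: 'y::complex_normed_space)"
  by (erule eventually_hol_compose_0[where F = "\<lambda>y. (0, y)", rotated 2]) (intro hol, simp add: zero_prod_def)

lemma eventually_slice_second:
  "\<forall>\<^sub>F p in nhds 0. R p \<Longrightarrow>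
    \<forall>\<^sub>F x in nhds 0. R (x :: 'x::complex_normed_space, 0 :: 'y::complex_normed_space)"
  by (erule eventually_hol_compose_0[where F = "\<lambda>x. (x, 0)", rotated 2]) (intro hol, simp add: zero_prod_def)

lemma eventually_slice_third:
  "\<forall>\<^sub>F p in nhds 0. R p \<Longrightarrow> \<forall>\<^sub>F p in nhds 0.
    R (fst p :: 'x::complex_normed_space, snd p :: 'y::complex_normed_space, 0 :: 'z::complex_normed_space)"
  by (erule eventually_hol_compose_0[where F = "\<lambda>p. (fst p, snd p, 0)", rotated 2]) (intro hol, simp add: zero_prod_def)

lemma hol_at_slice_second:
  "hol_at F 0 \<Longrightarrow> hol_at (\<lambda>x. F (x :: 'x::complex_normed_space, 0 :: 'y::complex_normed_space)) 0"
  by (erule hol_at_compose_0[where F = "\<lambda>x. (x, 0)"]) (intro hol, simp add: zero_prod_def)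

lemma hol_at_slice_third:
  "hol_at F 0 \<Longrightarrow>
    hol_at (\<lambda>p. F (fst p :: 'x::complex_normed_space, snd p :: 'y::complex_normed_space, 0 :: 'z::complex_normed_space)) 0"
  by (erule hol_at_compose_0[where F = "\<lambda>p. (fst p, snd p, 0)"]) (intro hol, simp add: zero_prod_def)

lemma hol_at_of_fst: "hol_at F 0 \<Longrightarrow> hol_at (\<lambda>p. F (fst p)) 0"
  by (rule hol_at_compose_0[OF _ hol_at_fst[OF hol_at_ident] fst_zero])

lemma hol_at_of_snd: "hol_at F 0 \<Longrightarrow> hol_at (\<lambda>p. F (snd p)) 0"
  by (rule hol_at_compose_0[OF _ hol_at_snd[OF hol_at_ident] snd_zero])

lemma der_slice_first:
  assumes "cdiff F (x, y)"
  shows "cdiff (\<lambda>y. F (x, y)) y" and "der (\<lambda>y. F (x, y)) y v = der F (x, y) (0, v)"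
proof -
  have c: "cdiff (\<lambda>y. (x, y)) y" by (intro cdiff_Pair cdiff_const cdiff_ident)
  show "cdiff (\<lambda>y. F (x, y)) y" "der (\<lambda>y. F (x, y)) y v = der F (x, y) (0, v)"
    using cdiff_compose[OF c assms] der_compose[OF c assms, of v] by (simp_all add: der_Pair[OF cdiff_const cdiff_ident])
qed

lemma der_slice_second:
  assumes "cdiff F (x, y)"
  shows "cdiff (\<lambda>x. F (x, y)) x" and "der (\<lambda>x. F (x, y)) x v = der F (x, y) (v, 0)"
proof -
  have c: "cdiff (\<lambda>x. (x, y)) x" by (intro cdiff_Pair cdiff_const cdiff_ident)
  show "cdiff (\<lambda>x. F (x, y)) x" "der (\<lambda>x. F (x, y)) x v = der F (x, y) (v, 0)"
    using cdiff_compose[OF c assms] der_compose[OF c assms, of v] by (simp_all add: der_Pair[OF cdiff_ident cdiff_const])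
qed

lemma der_of_fst:
  assumes "cdiff F (fst p)"
  shows "cdiff (\<lambda>p. F (fst p)) p" and "der (\<lambda>p. F (fst p)) p v = der F (fst p) (fst v)"
  using cdiff_compose[OF cdiff_fst[OF cdiff_ident] assms] der_compose[OF cdiff_fst[OF cdiff_ident] assms, of v]
  by (simp_all add: der_bounded_linear bounded_linear_fst)

lemma der_of_snd:
  assumes "cdiff F (snd p)"
  shows "cdiff (\<lambda>p. F (snd p)) p" and "der (\<lambda>p. F (snd p)) p v = der F (snd p) (snd v)"
  using cdiff_compose[OF cdiff_snd[OF cdiff_ident] assms] der_compose[OF cdiff_snd[OF cdiff_ident] assms, of v]
  by (simp_all add: der_bounded_linear bounded_linear_snd)

text \<open>The chain rule in the only shape in which it meets a family \<open>q\<close> whose parameter is replaced by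
  \<open>\<phi>\<close> of a new parameter: the first argument is frozen, since it plays the role of a point of the
  variety on which the parameter is varied.\<close>

lemma der_reparametrized:
  assumes \<phi>: "cdiff \<phi> y" and q: "cdiff q (z, \<phi> y)"
  shows "der (\<lambda>p. q (fst p, \<phi> (snd p))) (z, y) (0, v) = der q (z, \<phi> y) (0, der \<phi> y v)"
proof -
  have \<phi>': "cdiff \<phi> (snd (z, y))" using \<phi> by simp
  have c: "cdiff (\<lambda>p. (fst p, \<phi> (snd p))) (z, y)" by (intro cdiff_Pair cdiff_fst cdiff_ident der_of_snd \<phi>')
  have q': "cdiff q ((\<lambda>p. (fst p, \<phi> (snd p))) (z, y))" using q by simp
  show ?thesis
    using der_compose[OF c q', of "(0, v)"]
    by (simp add: der_Pair[OF cdiff_fst[OF cdiff_ident] der_of_snd(1)[OF \<phi>']] der_of_snd(2)[OF \<phi>']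
        der_bounded_linear bounded_linear_fst)
qed

lemma norm_Pair_zero_left [simp]: "norm (0, y) = norm y"
  by (simp add: norm_Pair)

lemma norm_Pair_zero_right [simp]: "norm (x, 0) = norm x"
  by (simp add: norm_Pair)

section \<open>Directional derivatives are holomorphic\<close>

text \<open>Cauchy estimates used twice: once to see that \<open>h\<close> is Lipschitz near \<open>x0\<close>, and then for the
  holomorphic function \<open>h(\<cdot> + (y - x)) - h\<close>, which is of size \<open>norm (y - x)\<close>.\<close>

lemma der_bound_by_Lipschitz:
  fixes h :: "'a::complex_normed_space \<Rightarrow> complex"
  assumes "hol_at h x0"
  obtains r C where "r > 0" "C \<ge> 0" "\<And>x. x \<in> ball x0 r \<Longrightarrow> cdiff h x"
    "\<And>x y v. x \<in> ball x0 r \<Longrightarrow> y \<in> ball x0 r \<Longrightarrow>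
       norm (der h y v - der h x v) \<le> C * norm (y - x) * norm v"
proof -
  have "\<forall>\<^sub>F y in nhds x0. norm (h y) < norm (h x0) + 1"
    using order_tendstoD(2)[OF tendsto_norm[OF filterlim_isCont[OF hol_at_isCont[OF assms]]]] by simp
  with assms have "\<forall>\<^sub>F y in nhds x0. cdiff h y \<and> norm (h y) < norm (h x0) + 1"
    unfolding hol_at_def by eventually_elim simp
  then obtain s where s: "s > 0" "\<And>y. y \<in> ball x0 s \<Longrightarrow> cdiff h y"
      "\<And>y. y \<in> ball x0 s \<Longrightarrow> norm (h y) < norm (h x0) + 1"
    unfolding eventually_nhds_ball by blast
  define M where "M = norm (h x0) + 1"
  define R where "R = s / 4"
  have R: "R > 0" "s = 4 * R" using s(1) by (auto simp: R_def)
  have M: "M > 0" unfolding M_def by (simp add: add_nonneg_pos)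
  have bound: "norm (der h x v) \<le> 2 * M / R * norm v" if "x \<in> ball x0 (3 * R)" for x v
  proof (rule Cauchy_estimate_der[OF R(1)])
    fix y assume "y \<in> ball x R"
    then have "y \<in> ball x0 s"
      using that dist_triangle[of x0 y x] by (simp add: R(2))
    then show "cdiff h y" "norm (h y) \<le> M"
      using s(2,3) less_imp_le unfolding M_def by blast+
  qed
  have lip: "norm (h x - h y) \<le> 2 * M / R * norm (x - y)"
    if "x \<in> ball x0 (3 * R)" "y \<in> ball x0 (3 * R)" for x y
  proof (rule differentiable_bound[OF convex_ball _ _ that])
    fix z assume z: "z \<in> ball x0 (3 * R)"
    then have "z \<in> ball x0 s" using R by auto
    then show "(h has_derivative der h z) (at z within ball x0 (3 * R))"
      using cdiff_has_derivative[OF s(2)] has_derivative_at_withinI by blast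
    show "onorm (der h z) \<le> 2 * M / R"
      by (rule onorm_bound) (use M R bound[OF z] in simp_all)
  qed
  show thesis
  proof (rule that)
    show "R > 0" "4 * M / R / R \<ge> 0" using R M by simp_all
    show "cdiff h x" if "x \<in> ball x0 R" for x
      using that s(2)[of x] R by simp
    fix x y v assume x: "x \<in> ball x0 R" and y: "y \<in> ball x0 R"
    define k where "k = (\<lambda>z. h ((y - x) + z) - h z)"
    have in_ball: "(y - x) + z \<in> ball x0 (3 * R)" "z \<in> ball x0 (3 * R)" if z: "z \<in> ball x R" for z
    proof -
      have "norm ((y - x) + z - x0) \<le> norm (y - x0) + norm (z - x)"
        using norm_triangle_ineq[of "y - x0" "z - x"] by (simp add: algebra_simps)
      moreover have "norm (z - x0) \<le> norm (x - x0) + norm (z - x)"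
        using norm_triangle_ineq[of "x - x0" "z - x"] by (simp add: algebra_simps)
      moreover have "norm (z - x) < R" "norm (x - x0) < R" "norm (y - x0) < R"
        using x y z by (simp_all add: dist_norm norm_minus_commute)
      ultimately show "(y - x) + z \<in> ball x0 (3 * R)" "z \<in> ball x0 (3 * R)"
        using R(1) by (simp_all add: dist_norm norm_minus_commute[of x0])
    qed
    have sub: "ball x0 (3 * R) \<subseteq> ball x0 s" using R by auto
    have cdk: "cdiff k z" "der k z w = der h ((y - x) + z) w - der h z w" if z: "z \<in> ball x R" for z w
    proof -
      have 1: "cdiff h ((y - x) + z)" "cdiff h z" using s(2) in_ball[OF z] sub by auto
      have 2: "cdiff (\<lambda>z. (y - x) + z) z" by (intro cdiff_add cdiff_const cdiff_ident)
      have 3: "der (\<lambda>z. (y - x) + z) z w = w"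
        by (subst der_add) (simp_all add: cdiff_const cdiff_ident)
      have 4: "cdiff (\<lambda>z. h ((y - x) + z)) z" using cdiff_compose[OF 2 1(1)] .
      show "cdiff k z" unfolding k_def by (rule cdiff_diff[OF 4 1(2)])
      show "der k z w = der h ((y - x) + z) w - der h z w"
        unfolding k_def by (simp add: der_diff[OF 4 1(2)] der_compose[OF 2 1(1)] 3)
    qed
    have "norm (der k x v) \<le> 2 * (2 * M / R * norm (y - x)) / R * norm v"
    proof (rule Cauchy_estimate_der[OF R(1) cdk(1)])
      fix z assume "z \<in> ball x R"
      from lip[OF in_ball[OF this]] show "norm (k z) \<le> 2 * M / R * norm (y - x)"
        by (simp add: k_def)
    qed
    then show "norm (der h y v - der h x v) \<le> 4 * M / R / R * norm (y - x) * norm v"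
      using cdk(2)[of x v] R(1) by (simp add: mult_ac)
  qed
qed

text \<open>The difference quotients \<open>k n\<close> of \<open>h\<close> in direction \<open>v\<close> are holomorphic and converge uniformly to the
  directional derivative.  By Cauchy estimates their derivatives are uniformly Cauchy, so the limit
  is differentiable and its derivative \<open>g x\<close> is the limit of the derivatives of the \<open>k n\<close>, which are
  themselves difference quotients of \<open>der h\<close>.  Complex linearity and the symmetry of second
  derivatives are both read off from this limit.\<close>

lemma difference_quotients_of_der:
  fixes h :: "'a::complex_normed_space \<Rightarrow> complex"
  assumes "hol_at h x0"
  obtains r e g where "r > 0" "\<And>n. e n \<noteq> 0" "e \<longlonglongrightarrow> (0::real)"
    "\<And>x. x \<in> ball x0 r \<Longrightarrow> ((\<lambda>y. der h y v) has_derivative g x) (at x)"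
    "\<And>x u. x \<in> ball x0 r \<Longrightarrow>
        (\<lambda>n. (der h (x + e n *\<^sub>R v) u - der h x u) /\<^sub>R e n) \<longlonglongrightarrow> g x u"
    "\<And>x. x \<in> ball x0 r \<Longrightarrow> cdiff h x"
proof -
  obtain R C where R: "R > 0" and C: "C \<ge> 0" and cd: "\<And>x. x \<in> ball x0 R \<Longrightarrow> cdiff h x"
    and Lip: "\<And>x y v. x \<in> ball x0 R \<Longrightarrow> y \<in> ball x0 R \<Longrightarrow>
       norm (der h y v - der h x v) \<le> C * norm (y - x) * norm v"
    using der_bound_by_Lipschitz[OF assms] by blast
  \<comment> \<open>The step sizes are so small that a shift by them leads from the ball of radius R / 2 into that of radius R.\<close>
  define \<delta> where "\<delta> = R / 2 / (norm v + 1)"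
  have nv: "norm v + 1 > 0" by (simp add: add_nonneg_pos)
  have \<delta>: "\<delta> > 0" using R nv by (simp add: \<delta>_def)
  define e where "e n = \<delta> * inverse (real (Suc n))" for n
  have e0: "e n > 0" for n using \<delta> by (simp add: e_def)
  have elim: "e \<longlonglongrightarrow> 0"
    using tendsto_mult_right_zero[OF LIMSEQ_inverse_real_of_nat, of \<delta>] by (simp add: e_def[abs_def])
  have ev: "norm (s *\<^sub>R v) < R / 2" if "0 \<le> s" "s \<le> e n" for n s
  proof -
    have "inverse (real (Suc n)) \<le> 1" by (simp add: field_simps)
    then have "e n \<le> \<delta>" using \<delta> unfolding e_def by (simp add: mult_left_le)
    then have "s * norm v \<le> \<delta> * norm v" using that by (simp add: mult_right_mono)
    also have "\<dots> < \<delta> * (norm v + 1)" using \<delta> by simp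
    also have "\<dots> = R / 2" using nv unfolding \<delta>_def by (metis nonzero_eq_divide_eq less_irrefl)
    finally show ?thesis using that by simp
  qed
  have shift: "s *\<^sub>R v + x \<in> ball x0 R" if "x \<in> ball x0 (R/2)" "0 \<le> s" "s \<le> e n" for n s x
  proof -
    have "norm (s *\<^sub>R v + x - x0) \<le> norm (s *\<^sub>R v) + norm (x - x0)"
      using norm_triangle_ineq[of "s *\<^sub>R v" "x - x0"] by (simp add: algebra_simps)
    then show ?thesis using ev[OF that(2,3)] that(1) by (simp add: dist_norm norm_minus_commute)
  qed
  have small: "x \<in> ball x0 R" if "x \<in> ball x0 (R/2)" for x using that R by simp
  define k where "k n = (\<lambda>x. complex_of_real (inverse (e n)) * (h (e n *\<^sub>R v + x) - h x))" for n
  have kd: "cdiff (k n) x" "der (k n) x u = (der h (e n *\<^sub>R v + x) u - der h x u) /\<^sub>R e n"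
    if x: "x \<in> ball x0 (R/2)" for n x u
  proof -
    have 1: "cdiff h (e n *\<^sub>R v + x)" "cdiff h x"
      using cd shift[OF x, of "e n" n] small[OF x] e0[of n] by auto
    have 2: "cdiff (\<lambda>z. e n *\<^sub>R v + z) x" by (intro cdiff_add cdiff_const cdiff_ident)
    have 3: "der (\<lambda>z. e n *\<^sub>R v + z) x u = u"
      by (subst der_add) (simp_all add: cdiff_const cdiff_ident)
    have 4: "cdiff (\<lambda>z. h (e n *\<^sub>R v + z)) x" using cdiff_compose[OF 2 1(1)] .
    note 5 = cdiff_diff[OF 4 1(2)]
    show "cdiff (k n) x" unfolding k_def by (intro cdiff_mult cdiff_const 5)
    show "der (k n) x u = (der h (e n *\<^sub>R v + x) u - der h x u) /\<^sub>R e n"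
      unfolding k_def
      by (simp add: der_mult[OF cdiff_const 5] der_diff[OF 4 1(2)] der_compose[OF 2 1(1)] 3
          scaleR_conv_of_real)
  qed
  have approx: "norm (k n x - der h x v) \<le> C * e n * norm v * norm v" if x: "x \<in> ball x0 (R/2)" for n x
  proof -
    define p where "p s = h (s *\<^sub>R v + x) - s *\<^sub>R der h x v" for s
    have "norm (p (e n) - p 0) \<le> (C * e n * norm v * norm v) * norm (e n - 0)"
    proof (rule differentiable_bound[where S = "{0..e n}"
          and f' = "\<lambda>s t. t *\<^sub>R (der h (s *\<^sub>R v + x) v - der h x v)"])
      fix s assume s: "s \<in> {0..e n}"
      have c: "cdiff h (s *\<^sub>R v + x)" using cd shift[OF x, of s n] s by simp
      have "((\<lambda>s. h (s *\<^sub>R v + x)) has_derivative (\<lambda>t. der h (s *\<^sub>R v + x) (t *\<^sub>R v))) (at s)"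
        by (rule has_derivative_compose[of "\<lambda>s. s *\<^sub>R v + x" "\<lambda>t. t *\<^sub>R v" s UNIV h,
              OF _ cdiff_has_derivative[OF c]])
          (auto intro!: derivative_eq_intros)
      then have "(p has_derivative (\<lambda>t. der h (s *\<^sub>R v + x) (t *\<^sub>R v) - t *\<^sub>R der h x v)) (at s)"
        unfolding p_def by (auto intro!: derivative_eq_intros)
      then show "(p has_derivative (\<lambda>t. t *\<^sub>R (der h (s *\<^sub>R v + x) v - der h x v))) (at s within {0..e n})"
        using linear_scale[OF der_linear[OF c]]
        by (simp add: has_derivative_at_withinI scaleR_diff_right)
      have "norm (der h (s *\<^sub>R v + x) v - der h x v) \<le> C * norm (s *\<^sub>R v + x - x) * norm v"
        using s by (intro Lip small[OF x] shift[OF x, of s n]) auto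
      also have "\<dots> \<le> C * e n * norm v * norm v"
        using s C by (auto intro!: mult_right_mono mult_left_mono simp: mult.assoc)
      finally show "onorm (\<lambda>t. t *\<^sub>R (der h (s *\<^sub>R v + x) v - der h x v)) \<le> C * e n * norm v * norm v"
        using C e0[of n] by (intro onorm_bound) (auto simp: mult.commute intro!: mult_left_mono)
    qed (use e0[of n] in auto)
    moreover have "k n x - der h x v = (p (e n) - p 0) /\<^sub>R e n"
      using e0[of n] by (simp add: k_def p_def scaleR_conv_of_real field_simps)
    ultimately show ?thesis
      using e0[of n] by (simp add: divide_simps mult_ac)
  qed
  define K where "K = 8 * C * norm v * norm v / R"
  have K: "K \<ge> 0" using C R by (simp add: K_def)
  have unif: "norm (der (k n) x u - der (k m) x u) \<le> K * (e n + e m) * norm u"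
    if x: "x \<in> ball x0 (R/4)" for n m x u
  proof -
    have sub: "y \<in> ball x0 (R/2)" if "y \<in> ball x (R/4)" for y
      using that x dist_triangle[of x0 y x] by simp
    have xx: "x \<in> ball x (R/4)" using R by simp
    have "norm (der (\<lambda>y. k n y - k m y) x u) \<le> 2 * (C * (e n + e m) * norm v * norm v) / (R/4) * norm u"
    proof (rule Cauchy_estimate_der)
      fix y assume "y \<in> ball x (R/4)"
      note y = sub[OF this]
      show "cdiff (\<lambda>y. k n y - k m y) y" by (intro cdiff_diff kd y)
      have "norm (k n y - k m y) \<le> norm (k n y - der h y v) + norm (k m y - der h y v)"
        using norm_triangle_ineq4[of "k n y - der h y v" "k m y - der h y v"] by simp
      then show "norm (k n y - k m y) \<le> C * (e n + e m) * norm v * norm v"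
        using approx[OF y, of n] approx[OF y, of m] by (simp add: algebra_simps)
    qed (use R in simp)
    then show ?thesis
      by (simp add: der_diff[OF kd(1) kd(1), OF sub[OF xx] sub[OF xx]] K_def mult_ac)
  qed
  define g where "g x u = lim (\<lambda>n. der (k n) x u)" for x u
  have conv: "(\<lambda>n. der (k n) x u) \<longlonglongrightarrow> g x u" if x: "x \<in> ball x0 (R/4)" for x u
  proof -
    have "Cauchy (\<lambda>n. der (k n) x u)"
    proof (rule CauchyI)
      fix \<epsilon> :: real assume \<epsilon>: "\<epsilon> > 0"
      have "(\<lambda>n. K * (e n + 0) * norm u) \<longlonglongrightarrow> K * (0 + 0) * norm u"
        by (intro tendsto_intros elim)
      then have "\<forall>\<^sub>F n in sequentially. K * (e n + 0) * norm u < \<epsilon> / 2"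
        using order_tendstoD(2)[where a = "\<epsilon>/2"] \<epsilon> by fastforce
      then obtain N where N: "\<And>n. n \<ge> N \<Longrightarrow> K * e n * norm u < \<epsilon> / 2"
        unfolding eventually_sequentially by auto
      have "norm (der (k m) x u - der (k n) x u) < \<epsilon>" if "m \<ge> N" "n \<ge> N" for m n
        using unif[OF x, of m u n] N[OF that(1)] N[OF that(2)] by (simp add: algebra_simps)
      then show "\<exists>M. \<forall>m\<ge>M. \<forall>n\<ge>M. norm (der (k m) x u - der (k n) x u) < \<epsilon>" by blast
    qed
    then show ?thesis unfolding g_def by (simp add: Cauchy_convergent_iff convergent_LIMSEQ_iff)
  qed
  have dist_lim: "norm (der (k n) x u - g x u) \<le> K * e n * norm u" if x: "x \<in> ball x0 (R/4)" for n x u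
  proof (rule tendsto_le[OF sequentially_bot])
    show "(\<lambda>m. norm (der (k n) x u - der (k m) x u)) \<longlonglongrightarrow> norm (der (k n) x u - g x u)"
      by (intro tendsto_intros conv x)
    show "(\<lambda>m. K * (e n + e m) * norm u) \<longlonglongrightarrow> K * e n * norm u"
      using tendsto_mult_right[OF tendsto_mult_left[OF tendsto_add[OF tendsto_const elim]], of K "e n" "norm u"]
      by simp
    show "\<forall>\<^sub>F m in sequentially. norm (der (k n) x u - der (k m) x u) \<le> K * (e n + e m) * norm u"
      using unif[OF x] by simp
  qed
  have k_lim: "(\<lambda>n. k n x) \<longlonglongrightarrow> der h x v" if x: "x \<in> ball x0 (R/4)" for x
  proof -
    have "(\<lambda>n. C * e n * norm v * norm v) \<longlonglongrightarrow> C * 0 * norm v * norm v"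
      by (intro tendsto_intros elim)
    then have "(\<lambda>n. C * e n * norm v * norm v) \<longlonglongrightarrow> 0" by simp
    then have "(\<lambda>n. k n x - der h x v) \<longlonglongrightarrow> 0"
      by (rule Lim_null_comparison[rotated]) (use approx[of x] x R in simp)
    then show ?thesis by (simp add: LIM_zero_iff)
  qed
  have "\<exists>l. \<forall>x\<in>ball x0 (R/4). (\<lambda>n. k n x) \<longlonglongrightarrow> l x \<and> (l has_derivative g x) (at x within ball x0 (R/4))"
  proof (rule has_derivative_sequence[OF convex_ball])
    fix n x assume "x \<in> ball x0 (R/4)"
    then show "(k n has_derivative der (k n) x) (at x within ball x0 (R/4))"
      using R by (intro has_derivative_at_withinI[OF cdiff_has_derivative[OF kd(1)]]) simp
  next
    fix \<epsilon> :: real assume \<epsilon>: "\<epsilon> > 0"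
    have "(\<lambda>n. K * e n) \<longlonglongrightarrow> K * 0" by (intro tendsto_intros elim)
    then have "\<forall>\<^sub>F n in sequentially. K * e n < \<epsilon>"
      using order_tendstoD(2)[where a = \<epsilon>] \<epsilon> by fastforce
    then show "\<forall>\<^sub>F n in sequentially. \<forall>x\<in>ball x0 (R/4). \<forall>u. norm (der (k n) x u - g x u) \<le> \<epsilon> * norm u"
    proof eventually_elim
      case (elim n)
      show ?case
      proof (intro ballI allI)
        fix x u assume "x \<in> ball x0 (R/4)"
        from dist_lim[OF this, of n u] show "norm (der (k n) x u - g x u) \<le> \<epsilon> * norm u"
          using mult_right_mono[OF less_imp_le[OF elim] norm_ge_zero[of u]] by linarith
      qed
    qed
  next
    show "x0 \<in> ball x0 (R/4)" using R by simp
    then show "(\<lambda>n. k n x0) \<longlonglongrightarrow> der h x0 v" by (rule k_lim)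
  qed
  then obtain l where l: "\<And>x. x \<in> ball x0 (R/4) \<Longrightarrow> (\<lambda>n. k n x) \<longlonglongrightarrow> l x"
      "\<And>x. x \<in> ball x0 (R/4) \<Longrightarrow> (l has_derivative g x) (at x within ball x0 (R/4))"
    by blast
  have l_eq: "l x = der h x v" if x: "x \<in> ball x0 (R/4)" for x
    by (rule LIMSEQ_unique[OF l(1)[OF x] k_lim[OF x]])
  show thesis
  proof (rule that)
    show "R/4 > 0" using R by simp
    show "e n \<noteq> 0" for n using e0[of n] by simp
    show "e \<longlonglongrightarrow> 0" by (rule elim)
    fix x assume x: "x \<in> ball x0 (R/4)"
    show "cdiff h x" using cd x R by simp
    have "(l has_derivative g x) (at x)"
      using l(2)[OF x] at_within_open[OF x open_ball] by simp
    then show "((\<lambda>y. der h y v) has_derivative g x) (at x)"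
      by (rule has_derivative_transform_within_open[OF _ open_ball x]) (rule l_eq)
    show "(\<lambda>n. (der h (x + e n *\<^sub>R v) u - der h x u) /\<^sub>R e n) \<longlonglongrightarrow> g x u" for u
      using conv[OF x, of u] kd(2)[of x _ u] x R by (simp add: add.commute)
  qed
qed

lemma hol_at_der [hol]:
  fixes h :: "'a::complex_normed_space \<Rightarrow> complex"
  assumes "hol_at h x"
  shows "hol_at (\<lambda>y. der h y v) x"
proof -
  obtain r e g where *: "r > 0" "\<And>n. e n \<noteq> 0" "e \<longlonglongrightarrow> (0::real)"
    "\<And>y. y \<in> ball x r \<Longrightarrow> ((\<lambda>y. der h y v) has_derivative g y) (at y)"
    "\<And>y u. y \<in> ball x r \<Longrightarrow>
        (\<lambda>n. (der h (y + e n *\<^sub>R v) u - der h y u) /\<^sub>R e n) \<longlonglongrightarrow> g y u"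
    "\<And>x'. x' \<in> ball x r \<Longrightarrow> cdiff h x'"
    by (rule difference_quotients_of_der[OF assms]) (rule that)
  have "cdiff (\<lambda>y. der h y v) y" if y: "y \<in> ball x r" for y
  proof (rule cdiffI[OF *(4)[OF y]])
    fix c w
    have "(\<lambda>n. y + e n *\<^sub>R v) \<longlonglongrightarrow> y + 0 *\<^sub>R v"
      by (intro tendsto_intros *(3))
    then have "\<forall>\<^sub>F n in sequentially. y + e n *\<^sub>R v \<in> ball x r"
      using topological_tendstoD[OF _ open_ball, of _ y] y by simp
    then have "\<forall>\<^sub>F n in sequentially.
        c * ((der h (y + e n *\<^sub>R v) w - der h y w) /\<^sub>R e n) =
          (der h (y + e n *\<^sub>R v) (cscale c w) - der h y (cscale c w)) /\<^sub>R e n"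
      by eventually_elim (use *(2) in \<open>simp add: der_cscale[OF *(6)[OF y]] der_cscale[OF *(6)] algebra_simps\<close>)
    moreover have "(\<lambda>n. c * ((der h (y + e n *\<^sub>R v) w - der h y w) /\<^sub>R e n)) \<longlonglongrightarrow> c * g y w"
      by (intro tendsto_intros *(5) y)
    ultimately have "(\<lambda>n. (der h (y + e n *\<^sub>R v) (cscale c w) - der h y (cscale c w)) /\<^sub>R e n)
        \<longlonglongrightarrow> c * g y w"
      by (rule Lim_transform_eventually[rotated])
    from LIMSEQ_unique[OF *(5)[OF y] this] show "g y (cscale c w) = cscale c (g y w)" by simp
  qed
  then show ?thesis
    unfolding hol_at_def eventually_nhds_ball using *(1) by blast
qed

lemma der_commute:
  fixes h :: "'a::complex_normed_space \<Rightarrow> complex"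
  assumes "hol_at h x"
  shows "der (\<lambda>y. der h y v) x u = der (\<lambda>y. der h y u) x v"
proof -
  obtain r e g where *: "r > 0" "\<And>n. e n \<noteq> 0" "e \<longlonglongrightarrow> (0::real)"
    "\<And>y. y \<in> ball x r \<Longrightarrow> ((\<lambda>y. der h y v) has_derivative g y) (at y)"
    "\<And>y u. y \<in> ball x r \<Longrightarrow>
        (\<lambda>n. (der h (y + e n *\<^sub>R v) u - der h y u) /\<^sub>R e n) \<longlonglongrightarrow> g y u"
    by (rule difference_quotients_of_der[OF assms]) (rule that)
  have x: "x \<in> ball x r" using *(1) by simp
  have D: "((\<lambda>y. der h y u) has_derivative der (\<lambda>y. der h y u) x) (at x)"
    using cdiff_has_derivative hol_at_imp_cdiff hol_at_der assms by blast
  have "((\<lambda>s. der h (x + s *\<^sub>R v) u) has_derivative (\<lambda>s. der (\<lambda>y. der h y u) x (s *\<^sub>R v))) (at 0)"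
  proof (rule has_derivative_compose[of "\<lambda>s. x + s *\<^sub>R v" "\<lambda>s. s *\<^sub>R v" 0 UNIV "\<lambda>y. der h y u"])
    show "((\<lambda>y. der h y u) has_derivative der (\<lambda>y. der h y u) x) (at (x + 0 *\<^sub>R v))"
      using D by simp
  qed (auto intro!: derivative_eq_intros)
  moreover have "der (\<lambda>y. der h y u) x (s *\<^sub>R v) = s *\<^sub>R der (\<lambda>y. der h y u) x v" for s
    using linear_scale[OF has_derivative_linear[OF D]] .
  ultimately have "((\<lambda>s. der h (x + s *\<^sub>R v) u) has_derivative (\<lambda>s. s *\<^sub>R der (\<lambda>y. der h y u) x v)) (at 0)"
    by simp
  then have "((\<lambda>s. norm (der h (x + s *\<^sub>R v) u - der h x u - s *\<^sub>R der (\<lambda>y. der h y u) x v) / norm s) \<longlongrightarrow> 0) (at 0)"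
    unfolding has_derivative_at by simp
  moreover have "norm (der h (x + s *\<^sub>R v) u - der h x u - s *\<^sub>R der (\<lambda>y. der h y u) x v) / norm s
      = norm ((der h (x + s *\<^sub>R v) u - der h x u) /\<^sub>R s - der (\<lambda>y. der h y u) x v)" if "s \<noteq> 0" for s
  proof -
    have "(der h (x + s *\<^sub>R v) u - der h x u) /\<^sub>R s - der (\<lambda>y. der h y u) x v
      = (der h (x + s *\<^sub>R v) u - der h x u - s *\<^sub>R der (\<lambda>y. der h y u) x v) /\<^sub>R s"
      using that by (simp add: scaleR_diff_right)
    then show ?thesis by (simp add: divide_inverse mult.commute)
  qed
  ultimately have "((\<lambda>s. norm ((der h (x + s *\<^sub>R v) u - der h x u) /\<^sub>R s - der (\<lambda>y. der h y u) x v)) \<longlongrightarrow> 0) (at 0)"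
    by (elim Lim_transform_eventually) (auto simp: eventually_at_filter)
  then have "((\<lambda>s. (der h (x + s *\<^sub>R v) u - der h x u) /\<^sub>R s) \<longlongrightarrow> der (\<lambda>y. der h y u) x v) (at 0)"
    by (rule LIM_zero_cancel[OF tendsto_norm_zero_cancel])
  moreover have "filterlim e (at 0) sequentially"
    using *(2,3) by (simp add: filterlim_at)
  ultimately have "(\<lambda>n. (der h (x + e n *\<^sub>R v) u - der h x u) /\<^sub>R e n) \<longlonglongrightarrow> der (\<lambda>y. der h y u) x v"
    using filterlim_compose by blast
  then have "g x u = der (\<lambda>y. der h y u) x v"
    by (rule LIMSEQ_unique[OF *(5)[OF x]])
  then show ?thesis using der_eqI[OF *(4)[OF x]] by simp
qed

section \<open>Identity theorems\<close>

text \<open>The \<open>n\<close>-th derivative in the fixed direction \<open>v\<close>, which is the \<open>n\<close>-th derivative of the restriction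
  to a complex line (\<open>higher_deriv_line\<close>).\<close>

definition iterated_der ::
    "nat \<Rightarrow> 'a \<Rightarrow> ('a::complex_normed_space \<Rightarrow> complex) \<Rightarrow> 'a \<Rightarrow> complex" where
  "iterated_der n v h = ((\<lambda>h x. der h x v) ^^ n) h"

lemma iterated_der_0 [simp]: "iterated_der 0 v h = h"
  by (simp add: iterated_der_def)

lemma iterated_der_Suc: "iterated_der (Suc n) v h = (\<lambda>x. der (iterated_der n v h) x v)"
  by (simp add: iterated_der_def)

lemma hol_at_iterated_der [hol]: "hol_at h x \<Longrightarrow> hol_at (iterated_der n v h) x"
proof (induction n)
  case (Suc n)
  then have "hol_at (iterated_der n v h) x" by simp
  then show ?case unfolding iterated_der_Suc by (rule hol_at_der)
qed simp

lemma filterlim_line: "filterlim (\<lambda>t. x + cscale t v) (nhds (x + cscale t0 v)) (nhds t0)"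
  using bounded_linear.isCont[OF bounded_linear_cscale_left]
  by (intro filterlim_isCont continuous_intros) (auto intro!: bounded_linear.isCont[OF bounded_linear_cscale_left])

lemma eventually_line:
  assumes "\<forall>\<^sub>F y in nhds x. P y"
  shows "\<forall>\<^sub>F t in nhds 0. P (x + cscale t v)"
  using eventually_compose_filterlim[OF _ filterlim_line[of x v 0]] assms by simp

lemma higher_deriv_line:
  fixes h :: "'a::complex_normed_space \<Rightarrow> complex"
  assumes "hol_at h (x + cscale t v)"
  shows "(deriv ^^ n) (\<lambda>t. h (x + cscale t v)) t = iterated_der n v h (x + cscale t v)"
  using assms
proof (induction n arbitrary: t)
  case (Suc n)
  have "\<forall>\<^sub>F s in nhds t. hol_at h (x + cscale s v)"
    using eventually_compose_filterlim[OF hol_at_eventually[OF Suc.prems] filterlim_line] .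
  then have "\<forall>\<^sub>F s in nhds t. (deriv ^^ n) (\<lambda>t. h (x + cscale t v)) s = iterated_der n v h (x + cscale s v)"
    by eventually_elim (rule Suc.IH)
  then have "(deriv ^^ Suc n) (\<lambda>t. h (x + cscale t v)) t = deriv (\<lambda>s. iterated_der n v h (x + cscale s v)) t"
    by (simp add: deriv_cong_ev)
  also have "\<dots> = der (iterated_der n v h) (x + cscale t v) v"
    by (intro DERIV_imp_deriv has_field_derivative_along_line hol_at_imp_cdiff hol_at_iterated_der Suc.prems)
  finally show ?case by (simp add: iterated_der_Suc)
qed simp

lemma der_iterated_der_commute:
  fixes h :: "'a::complex_normed_space \<Rightarrow> complex"
  assumes "hol_at h x"
  shows "der (iterated_der n v h) x u = iterated_der n v (\<lambda>y. der h y u) x"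
  using assms
proof (induction n arbitrary: x)
  case (Suc n)
  have "\<forall>\<^sub>F y in nhds x. der (iterated_der n v h) y u = iterated_der n v (\<lambda>y. der h y u) y"
    using hol_at_eventually[OF Suc.prems] by eventually_elim (rule Suc.IH)
  then have *: "der (\<lambda>y. der (iterated_der n v h) y u) x = der (iterated_der n v (\<lambda>y. der h y u)) x"
    by (rule der_cong) (intro hol_at_imp_cdiff hol_at_der hol_at_iterated_der Suc.prems)
  show ?case
    unfolding iterated_der_Suc *[symmetric]
    by (intro der_commute hol_at_iterated_der Suc.prems)
qed simp

lemma iterated_der_eq_0:
  fixes h :: "'a::complex_normed_space \<Rightarrow> complex"
  assumes "hol_at h x" "\<forall>\<^sub>F t in nhds 0. h (x + cscale t v) = 0"
  shows "iterated_der n v h x = 0"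
proof -
  have "iterated_der n v h x = (deriv ^^ n) (\<lambda>t. h (x + cscale t v)) 0"
    using higher_deriv_line[of h x 0 v n] assms(1) by simp
  also have "\<dots> = (deriv ^^ n) (\<lambda>t. 0) 0"
    by (rule higher_deriv_cong_ev) (use assms(2) in simp_all)
  finally show ?thesis by simp
qed

definition hol_on where "hol_on h S \<longleftrightarrow> (\<forall>x\<in>S. hol_at h x)"

lemma hol_onD: "hol_on h S \<Longrightarrow> x \<in> S \<Longrightarrow> hol_at h x"
  unfolding hol_on_def by blast

lemma line_domain:
  fixes S :: "'a::complex_normed_space set"
  assumes "open S" "convex S"
  shows "open {t. x + cscale t v \<in> S}" "convex {t. x + cscale t v \<in> S}"
proof -
  have "continuous_on UNIV (\<lambda>t. x + cscale t v)"
    by (intro continuous_intros linear_continuous_on bounded_linear_cscale_left)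
  from open_vimage[OF assms(1) this] show "open {t. x + cscale t v \<in> S}"
    by (simp add: vimage_def)
  show "convex {t. x + cscale t v \<in> S}"
  proof (rule convexI)
    fix s t :: complex and a b :: real
    assume *: "s \<in> {t. x + cscale t v \<in> S}" "t \<in> {t. x + cscale t v \<in> S}" "0 \<le> a" "0 \<le> b" "a + b = 1"
    interpret bl: bounded_linear "\<lambda>t. cscale t v" by (rule bounded_linear_cscale_left)
    have "x + cscale (a *\<^sub>R s + b *\<^sub>R t) v = (a + b) *\<^sub>R x + cscale (a *\<^sub>R s + b *\<^sub>R t) v"
      using *(5) by simp
    also have "\<dots> = a *\<^sub>R (x + cscale s v) + b *\<^sub>R (x + cscale t v)"
      by (simp add: bl.add bl.scaleR algebra_simps)
    finally have "x + cscale (a *\<^sub>R s + b *\<^sub>R t) v = a *\<^sub>R (x + cscale s v) + b *\<^sub>R (x + cscale t v)" .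
    then show "a *\<^sub>R s + b *\<^sub>R t \<in> {t. x + cscale t v \<in> S}"
      using convexD[OF assms(2)] * by simp
  qed
qed

lemma iterated_der_0_imp_zero_on_line:
  fixes h :: "'a::complex_normed_space \<Rightarrow> complex"
  assumes "open S" "convex S" "hol_on h S" "x \<in> S" "x + cscale t v \<in> S"
    "\<And>n. iterated_der n v h x = 0"
  shows "h (x + cscale t v) = 0"
proof (rule holomorphic_fun_eq_0_on_connected[where f = "\<lambda>t. h (x + cscale t v)"])
  show "(\<lambda>t. h (x + cscale t v)) holomorphic_on {t. x + cscale t v \<in> S}"
    using has_field_derivative_along_line[OF hol_at_imp_cdiff[OF hol_onD[OF assms(3)]]]
    by (subst holomorphic_on_open[OF line_domain(1)[OF assms(1,2)]]) blast
  show "connected {t. x + cscale t v \<in> S}"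
    by (rule convex_connected[OF line_domain(2)[OF assms(1,2)]])
  show "(deriv ^^ n) (\<lambda>t. h (x + cscale t v)) 0 = 0" for n
    using higher_deriv_line[of h x 0 v n] hol_onD[OF assms(3,4)] assms(6) by simp
qed (use assms line_domain(1)[OF assms(1,2)] in auto)

text \<open>Any point of the convex set is joined to a point of \<open>T\<close> by a complex line, on which the one-variable
  identity theorem applies.\<close>

lemma identity_theorem:
  fixes h :: "'a::complex_normed_space \<Rightarrow> complex"
  assumes "open S" "convex S" "hol_on h S" "open T" "T \<noteq> {}" "T \<subseteq> S" "\<And>x. x \<in> T \<Longrightarrow> h x = 0" "y \<in> S"
  shows "h y = 0"
proof -
  obtain x where x: "x \<in> T" using assms(5) by blast
  have "h (x + cscale 1 (y - x)) = 0"
  proof (rule iterated_der_0_imp_zero_on_line[OF assms(1-3)])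
    have "\<forall>\<^sub>F z in nhds x. h z = 0"
      using assms(4,7) x eventually_nhds by blast
    then show "iterated_der n (y - x) h x = 0" for n
      using x assms(3,6) by (intro iterated_der_eq_0 eventually_line) (auto intro: hol_onD)
  qed (use x assms in auto)
  then show ?thesis by simp
qed

lemma identity_theorem_eventually:
  fixes h :: "'a::complex_normed_space \<Rightarrow> complex"
  assumes "hol_on h (ball x r)" "\<forall>\<^sub>F y in nhds x. h y = 0" "y \<in> ball x r"
  shows "h y = 0"
proof -
  obtain T where T: "open T" "x \<in> T" "\<And>y. y \<in> T \<Longrightarrow> h y = 0"
    using assms(2) unfolding eventually_nhds by blast
  have "x \<in> ball x r" using assms(3) by (auto intro: le_less_trans[OF zero_le_dist])
  then show ?thesis
    by (intro identity_theorem[OF open_ball convex_ball assms(1) open_Int[OF T(1) open_ball] _ Int_lower2 _ assms(3)])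
      (use T(2,3) in blast)+
qed

lemma isCont_open_nonzero:
  fixes h :: "'a::t2_space \<Rightarrow> 'b::{zero,t1_space}"
  assumes "isCont h x" "h x \<noteq> 0" "open S" "x \<in> S"
  obtains T where "open T" "x \<in> T" "T \<subseteq> S" "\<And>y. y \<in> T \<Longrightarrow> h y \<noteq> 0"
proof -
  have "\<forall>\<^sub>F y in nhds x. h y \<in> - {0} \<and> y \<in> S"
    using topological_tendstoD[OF filterlim_isCont[OF assms(1)], of "- {0}"] assms(2) open_Compl[of "{0::'b}"]
      eventually_nhds_in_open[OF assms(3,4)]
    by (auto elim: eventually_elim2)
  then show thesis
    unfolding eventually_nhds using that by (metis ComplD insertI1 subsetI)
qed

lemma hol_mult_eq_0:
  fixes h k :: "'a::complex_normed_space \<Rightarrow> complex"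
  assumes "open S" "convex S" "hol_on h S" "hol_on k S" "\<And>x. x \<in> S \<Longrightarrow> h x * k x = 0"
    and "x \<in> S" "h x \<noteq> 0" "y \<in> S"
  shows "k y = 0"
proof -
  obtain T where T: "open T" "x \<in> T" "T \<subseteq> S" "\<And>y. y \<in> T \<Longrightarrow> h y \<noteq> 0"
    by (rule isCont_open_nonzero[OF hol_at_isCont[OF hol_onD[OF assms(3,6)]] assms(7,1,6)]) (rule that)
  show ?thesis
    by (rule identity_theorem[OF assms(1,2,4) T(1) _ T(3)]) (use T assms in auto)
qed

lemma hol_at_ball:
  assumes "hol_at h x"
  obtains r where "r > 0" "hol_on h (ball x r)"
  using hol_at_eventually[OF assms] unfolding eventually_nhds_ball hol_on_def by blast

lemma eventually_mult_eq_0: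
  fixes h k :: "'a::complex_normed_space \<Rightarrow> complex"
  assumes "hol_at h x" "hol_at k x" "\<forall>\<^sub>F y in nhds x. h y * k y = 0"
  shows "(\<forall>\<^sub>F y in nhds x. h y = 0) \<or> (\<forall>\<^sub>F y in nhds x. k y = 0)"
proof -
  have "\<forall>\<^sub>F y in nhds x. hol_at h y \<and> hol_at k y \<and> h y * k y = 0"
    using assms(1,2)[THEN hol_at_eventually] assms(3) by eventually_elim blast
  then obtain r where r: "r > 0" "hol_on h (ball x r)" "hol_on k (ball x r)"
      "\<And>y. y \<in> ball x r \<Longrightarrow> h y * k y = 0"
    unfolding eventually_nhds_ball hol_on_def by blast
  show ?thesis
    unfolding eventually_nhds_ball using hol_mult_eq_0[OF open_ball convex_ball r(2-4)] r(1) by blast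
qed

lemma eventually_zero_if_zero_on_open:
  fixes h :: "'a::complex_normed_space \<Rightarrow> complex"
  assumes "r > 0" "hol_on h (ball x r)" "open T" "T \<noteq> {}" "T \<subseteq> ball x r" "\<And>y. y \<in> T \<Longrightarrow> h y = 0"
  shows "\<forall>\<^sub>F y in nhds x. h y = 0"
  unfolding eventually_nhds_ball
  using identity_theorem[OF open_ball convex_ball assms(2-6)] assms(1) by blast

section \<open>Vanishing propagates along a factor\<close>

text \<open>Restrict to a complex line in the \<open>y\<close>-direction on which \<open>a(0,\<cdot>)\<close> has a finite order \<open>d\<close> at \<open>0\<close>.  For
  \<open>z\<close> near \<open>0\<close> the order of \<open>a(z,\<cdot>)\<close> is at most \<open>d\<close>, because the \<open>d\<close>-th derivative depends
  continuously on \<open>z\<close>.  The right-hand side has order at least \<open>d + 1\<close>, because \<open>h(0,0) = 0\<close>.  So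
  \<open>h(z,\<cdot>)\<close> must contribute a zero.\<close>

lemma zero_of_product_propagates:
  fixes h a b :: "'x::complex_normed_space \<times> 'y::complex_normed_space \<Rightarrow> complex"
  assumes "hol_at h 0" "hol_at a 0" "hol_at b 0"
    and eq: "\<forall>\<^sub>F p in nhds 0. h p * a p = h (0, snd p) * a (0, snd p) * b p"
    and nz: "\<not> (\<forall>\<^sub>F y in nhds 0. a (0, y) = 0)"
    and h0: "h (0, 0) = 0"
  shows "\<forall>\<^sub>F z in nhds 0. h (z, 0) = 0"
proof -
  have "\<forall>\<^sub>F p in nhds 0. hol_at h p \<and> hol_at a p \<and> hol_at b p \<and>
      h p * a p = h (0, snd p) * a (0, snd p) * b p"
    using assms(1-3)[THEN hol_at_eventually] eq by eventually_elim blast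
  then obtain R where R: "R > 0" and holR: "hol_on h (ball 0 R)" "hol_on a (ball 0 R)" "hol_on b (ball 0 R)"
    and eqR: "\<And>p. p \<in> ball 0 R \<Longrightarrow> h p * a p = h (0, snd p) * a (0, snd p) * b p"
    unfolding eventually_nhds_ball hol_on_def by blast
  obtain y where y: "y \<in> ball 0 R" "a (0, y) \<noteq> 0"
    using nz R unfolding eventually_nhds_ball by blast
  have y': "(0 :: 'x, y) \<in> ball 0 R" using y by simp
  have "\<exists>d. iterated_der d (0, y) a (0, 0) \<noteq> 0"
  proof (rule ccontr)
    assume "\<not> ?thesis"
    then have "a ((0, 0) + cscale 1 (0, y)) = 0"
      using R y' by (intro iterated_der_0_imp_zero_on_line[OF open_ball convex_ball holR(2)]) (auto simp: zero_prod_def[symmetric])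
    with y(2) show False by simp
  qed
  define d where "d = (LEAST d. iterated_der d (0, y) a (0, 0) \<noteq> 0)"
  have d: "iterated_der d (0, y) a (0, 0) \<noteq> 0"
    unfolding d_def by (rule LeastI_ex) fact
  have d_least: "iterated_der i (0, y) a (0, 0) = 0" if "i < d" for i
    using not_less_Least that unfolding d_def by blast
  have "hol_at (iterated_der d (0, y) a) (0, 0)"
    using assms(2) by (intro hol_at_iterated_der) (simp add: zero_prod_def)
  then have "hol_at (\<lambda>z. iterated_der d (0, y) a (z, 0)) 0"
    by (rule hol_at_compose[where F = "\<lambda>z. (z, 0)"]) (intro hol)
  then obtain T where T: "open T" "0 \<in> T" "T \<subseteq> ball 0 R"
      "\<And>z. z \<in> T \<Longrightarrow> iterated_der d (0, y) a (z, 0) \<noteq> 0"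
    by (rule isCont_open_nonzero[where h = "\<lambda>z. iterated_der d (0, y) a (z, 0)" and x = 0 and S = "ball 0 R",
          OF hol_at_isCont])
      (use d R that in auto)
  have "h (z, 0) = 0" if z: "z \<in> T" for z
  proof -
    define A where "A = {t. (z, 0) + cscale t (0, y) \<in> ball 0 R} \<inter> {t. (0, 0) + cscale t (0, y) \<in> ball 0 R}"
    have A: "open A" "0 \<in> A"
      unfolding A_def by (intro open_Int line_domain(1) open_ball convex_ball)
        (use z T(3) R in auto)
    have holA: "(\<lambda>t. k ((x, 0) + cscale t (0, y))) holomorphic_on A"
      if k: "hol_on k (ball 0 R)" and x: "x = z \<or> x = 0" for k :: "'x \<times> 'y \<Rightarrow> complex" and x
    proof (subst holomorphic_on_open[OF A(1)], intro ballI)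
      fix t assume "t \<in> A"
      then have "(x, 0) + cscale t (0, y) \<in> ball 0 R" using x by (auto simp: A_def)
      from has_field_derivative_along_line[OF hol_at_imp_cdiff[OF hol_onD[OF k this]]]
      show "\<exists>f'. ((\<lambda>t. k ((x, 0) + cscale t (0, y))) has_field_derivative f') (at t)" by blast
    qed
    define f where "f t = h ((z, 0) + cscale t (0, y))" for t
    define g where "g t = a ((z, 0) + cscale t (0, y))" for t
    define \<eta> where "\<eta> t = h ((0, 0) + cscale t (0, y)) * b ((z, 0) + cscale t (0, y))" for t
    define \<alpha> where "\<alpha> t = a ((0, 0) + cscale t (0, y))" for t
    have holo: "f holomorphic_on A" "g holomorphic_on A" "\<eta> holomorphic_on A" "\<alpha> holomorphic_on A"
      unfolding f_def g_def \<eta>_def \<alpha>_def using holA holR by (auto intro!: holomorphic_intros)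
    have gd: "(deriv ^^ i) g 0 = iterated_der i (0, y) a (z, 0)"
      and \<alpha>d: "(deriv ^^ i) \<alpha> 0 = iterated_der i (0, y) a (0, 0)" for i
      unfolding g_def \<alpha>_def
      using higher_deriv_line[of a "(z, 0)" 0 "(0, y)" i] higher_deriv_line[of a "(0, 0)" 0 "(0, y)" i]
        hol_onD[OF holR(2)] z T(3) R by auto
    \<comment> \<open>Leibniz rule for the right-hand side: only the term with all derivatives on \<alpha> survives for j = d, and \<eta> vanishes at 0.\<close>
    have prod: "(deriv ^^ j) (\<lambda>t. f t * g t) 0 = 0" if "j \<le> d" for j
    proof -
      have "\<forall>\<^sub>F t in nhds 0. f t * g t = \<alpha> t * \<eta> t"
        using eventually_nhds_in_open[OF A]
      proof eventually_elim
        case (elim t)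
        then show ?case
          using eqR[of "(z, 0) + cscale t (0, y)"] by (simp add: A_def f_def g_def \<alpha>_def \<eta>_def mult_ac)
      qed
      then have "(deriv ^^ j) (\<lambda>t. f t * g t) 0 = (deriv ^^ j) (\<lambda>t. \<alpha> t * \<eta> t) 0"
        by (rule higher_deriv_cong_ev) simp
      also have "\<dots> = (\<Sum>i = 0..j. of_nat (j choose i) * (deriv ^^ i) \<alpha> 0 * (deriv ^^ (j - i)) \<eta> 0)"
        by (rule higher_deriv_mult[OF holo(4,3) A])
      also have "\<dots> = 0"
      proof (rule sum.neutral, rule ballI)
        fix i assume i: "i \<in> {0..j}"
        show "of_nat (j choose i) * (deriv ^^ i) \<alpha> 0 * (deriv ^^ (j - i)) \<eta> 0 = 0"
        proof (cases "i < d")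
          case True
          then show ?thesis by (simp add: \<alpha>d d_least)
        next
          case False
          then have "j - i = 0" using i that by simp
          then show ?thesis by (simp add: \<eta>_def h0)
        qed
      qed
      finally show ?thesis .
    qed
    \<comment> \<open>Leibniz rule for the left-hand side.\<close>
    have step: "f 0 * (deriv ^^ j) g 0 = 0" if "j \<le> d" "\<And>i. i < j \<Longrightarrow> (deriv ^^ i) g 0 = 0" for j
    proof -
      have "0 = (\<Sum>i = 0..j. of_nat (j choose i) * (deriv ^^ i) f 0 * (deriv ^^ (j - i)) g 0)"
        using prod[OF that(1)] higher_deriv_mult[OF holo(1,2) A, of j] by simp
      also have "\<dots> = (\<Sum>i\<in>{0}. of_nat (j choose i) * (deriv ^^ i) f 0 * (deriv ^^ (j - i)) g 0)"
        using that(2) by (intro sum.mono_neutral_right) auto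
      finally show ?thesis by simp
    qed
    have "f 0 = 0"
    proof (rule ccontr)
      assume f0: "f 0 \<noteq> 0"
      have "j \<le> d \<Longrightarrow> (deriv ^^ j) g 0 = 0" for j
      proof (induction j rule: less_induct)
        case (less j)
        then show ?case using step[of j] f0 by simp
      qed
      then show False using gd[of d] T(4)[OF z] by simp
    qed
    then show ?thesis by (simp add: f_def)
  qed
  then show ?thesis
    unfolding eventually_nhds using T(1,2) by blast
qed

section \<open>Families that separate parameters infinitesimally\<close>

text \<open>The map from parameters to functions that sends \<open>y\<close> to \<open>q(\<cdot>,y)\<close>, restricted to the ball of radius \<open>r\<close>, is
  infinitesimally injective at \<open>y\<close>.\<close>

definition param_immersive ::
    "('a::complex_normed_space \<times> 'e::complex_normed_space \<Rightarrow> complex) \<Rightarrow> real \<Rightarrow> 'e \<Rightarrow> bool" where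
  "param_immersive q r y \<longleftrightarrow> (\<forall>u. (\<forall>z. norm z < r \<longrightarrow> der q (z, y) (0, u) = 0) \<longrightarrow> u = 0)"

text \<open>A germ condition: the same radius bounds \<open>y\<close> and the ball of \<open>z\<close>, and enlarging it weakens the
  requirement, so only small \<open>r\<close> matter.\<close>

definition nondegenerate ::
    "('a::complex_normed_space \<times> 'e::complex_normed_space \<Rightarrow> complex) \<Rightarrow> bool" where
  "nondegenerate q \<longleftrightarrow> (\<forall>r>0. \<exists>y. norm y < r \<and> param_immersive q r y)"

lemma param_immersive_mono: "param_immersive q r y \<Longrightarrow> r \<le> s \<Longrightarrow> param_immersive q s y"
  unfolding param_immersive_def by (meson less_le_trans)

text \<open>Otherwise there are unit vectors annihilated at parameters tending to \<open>y0\<close>; by compactness of the unit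
  sphere a subsequence converges, and its limit is annihilated at \<open>y0\<close>.\<close>

lemma eventually_param_immersive:
  fixes q :: "'a::complex_normed_space \<times> 'e::{complex_normed_space,euclidean_space} \<Rightarrow> complex"
  assumes imm: "param_immersive q r y0" and hol_q: "\<And>z. norm z < r \<Longrightarrow> hol_at q (z, y0)"
  shows "\<forall>\<^sub>F y in nhds y0. param_immersive q r y"
proof (rule ccontr)
  assume "\<not> ?thesis"
  then have "\<forall>n. \<exists>y. dist y0 y < inverse (real (Suc n)) \<and> \<not> param_immersive q r y"
    unfolding eventually_nhds_ball by (metis inverse_Suc mem_ball)
  then obtain y where y: "\<And>n. dist y0 (y n) < inverse (real (Suc n))" "\<And>n. \<not> param_immersive q r (y n)"
    by metis
  have ylim: "y \<longlonglongrightarrow> y0"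
  proof (rule tendsto_dist_iff[THEN iffD2], rule tendsto_sandwich[OF _ _ tendsto_const LIMSEQ_inverse_real_of_nat])
    show "\<forall>\<^sub>F n in sequentially. dist (y n) y0 \<le> inverse (real (Suc n))"
      using y(1) by (simp add: dist_commute less_imp_le)
  qed simp
  obtain u where u: "\<And>n. u n \<noteq> 0" "\<And>n z. norm z < r \<Longrightarrow> der q (z, y n) (0, u n) = 0"
    using y(2) unfolding param_immersive_def by metis
  define v where "v n = u n /\<^sub>R norm (u n)" for n
  have "\<And>n. v n \<in> sphere 0 1" using u(1) by (simp add: v_def)
  then obtain v' \<sigma> where v': "v' \<in> sphere 0 1" "strict_mono \<sigma>" "(v \<circ> \<sigma>) \<longlonglongrightarrow> v'"
    using compact_sphere[of "0::'e" 1] unfolding compact_def by blast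
  have "der q (z, y0) (0, v') = 0" if z: "norm z < r" for z
  proof -
    define L where "L y' v = (\<Sum>b\<in>Basis. (v \<bullet> b) *\<^sub>R der q (z, y') (0, b))" for y' v
    have expand: "der q (z, y') (0, v) = L y' v" if "cdiff q (z, y')" for y' v
    proof -
      have lin: "linear (\<lambda>v. der q (z, y') (0, v))"
        using linear_compose[OF bounded_linear.linear[OF bounded_linear_Pair[OF bounded_linear_zero bounded_linear_ident]]
            der_linear[OF that]] by (simp add: o_def)
      have "der q (z, y') (0, \<Sum>b\<in>Basis. (v \<bullet> b) *\<^sub>R b) = L y' v"
        unfolding L_def by (simp only: linear_sum[OF lin] linear_scale[OF lin])
      then show ?thesis by (simp add: euclidean_representation)
    qed
    have lim_ys: "(\<lambda>n. (z, y (\<sigma> n))) \<longlonglongrightarrow> (z, y0)"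
      using LIMSEQ_subseq_LIMSEQ[OF ylim v'(2)] by (intro tendsto_intros) (simp add: o_def)
    have "(\<lambda>n. L (y (\<sigma> n)) (v (\<sigma> n))) \<longlonglongrightarrow> L y0 v'"
      unfolding L_def
    proof (intro tendsto_intros)
      show "(\<lambda>n. v (\<sigma> n)) \<longlonglongrightarrow> v'" using v'(3) by (simp add: o_def)
      show "(\<lambda>n. der q (z, y (\<sigma> n)) (0, b)) \<longlonglongrightarrow> der q (z, y0) (0, b)" for b
        using isCont_tendsto_compose[OF hol_at_isCont[OF hol_at_der[OF hol_q[OF z]]] lim_ys] .
    qed
    moreover have "\<forall>\<^sub>F n in sequentially. hol_at q (z, y (\<sigma> n))"
      using eventually_compose_filterlim[OF hol_at_eventually[OF hol_q[OF z]] lim_ys] .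
    then have "\<forall>\<^sub>F n in sequentially. L (y (\<sigma> n)) (v (\<sigma> n)) = 0"
    proof eventually_elim
      case (elim n)
      note cd = hol_at_imp_cdiff[OF elim]
      have "der q (z, y (\<sigma> n)) (0, v (\<sigma> n)) = der q (z, y (\<sigma> n)) ((0, u (\<sigma> n)) /\<^sub>R norm (u (\<sigma> n)))"
        by (simp add: v_def)
      also have "\<dots> = 0"
        by (simp only: linear_scale[OF der_linear[OF cd]] u(2)[OF z] scaleR_zero_right)
      finally show ?case using expand[OF cd] by simp
    qed
    ultimately have "L y0 v' = 0"
      by (intro LIMSEQ_unique[OF _ tendsto_eventually])
    then show ?thesis using expand[OF hol_at_imp_cdiff[OF hol_q[OF z]]] by simp
  qed
  then have "v' = 0" using imm unfolding param_immersive_def by blast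
  then show False using v'(1) by simp
qed

text \<open>Let \<open>F(z,w,y) = g(z,w) - k(f(z,w),y)\<close>, which vanishes on the graph \<open>w = q(z,y)\<close>.  By degeneracy of \<open>k\<close> every
  \<open>y\<close> has a vector \<open>u \<noteq> 0\<close> with \<open>D\<^sub>y F u = 0\<close> for all \<open>z\<close>, \<open>w\<close>.  Differentiating
  \<open>F(z,q(z,y),y) = 0\<close> along \<open>u\<close> leaves \<open>D\<^sub>y q(z,y) u \<cdot> \<partial>\<^sub>w F(z,q(z,y),y) = 0\<close>.  For \<open>y\<close> in the open
  set where \<open>q\<close> is immersive in the parameter the first factor is not identically \<open>0\<close> in \<open>z\<close>, so
  the second one is.  The argument repeats for every \<open>\<partial>\<^sub>w\<^sup>n F\<close>, and Taylor expansion in \<open>w\<close> shows that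
  \<open>F\<close> vanishes on an open set, hence near \<open>0\<close>.\<close>

lemma extend_off_the_graph:
  fixes q :: "'a::complex_normed_space \<times> 'e::{complex_normed_space,euclidean_space} \<Rightarrow> complex"
    and k :: "'b::complex_normed_space \<times> 'e \<Rightarrow> complex"
    and f :: "'a \<times> complex \<Rightarrow> 'b" and g :: "'a \<times> complex \<Rightarrow> complex"
  assumes hq: "hol_at q 0" "q 0 = 0" and hk: "hol_at k 0" and hf: "hol_at f 0" "f 0 = 0"
    and hg: "hol_at g 0"
    and eq: "\<forall>\<^sub>F p in nhds 0. g (fst p, q p) = k (f (fst p, q p), snd p)"
    and nd: "nondegenerate q" and dg: "\<not> nondegenerate k"
  shows "\<forall>\<^sub>F p in nhds 0. g (fst p, fst (snd p)) = k (f (fst p, fst (snd p)), snd (snd p))"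
proof -
  obtain \<rho> where \<rho>: "\<rho> > 0" and "\<And>y. norm y < \<rho> \<Longrightarrow> \<not> param_immersive k \<rho> y"
    using dg unfolding nondegenerate_def by blast
  then have kernel: "\<And>y. norm y < \<rho> \<Longrightarrow> \<exists>u. u \<noteq> 0 \<and> (\<forall>z. norm z < \<rho> \<longrightarrow> der k (z, y) (0, u) = 0)"
    unfolding param_immersive_def by metis
  define W where "W p = (fst p, fst (snd p))" for p :: "'a \<times> complex \<times> 'e"
  define K where "K p = (f (W p), snd (snd p))" for p
  define F where "F p = g (W p) - k (K p)" for p
  have W: "hol_at W p" "W 0 = 0" for p
    unfolding W_def by (intro hol) (simp add: zero_prod_def[symmetric])
  have fW: "hol_at (\<lambda>p. f (W p)) 0"
    by (rule hol_at_compose[where F = W]) (simp_all add: W hf)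
  then have K: "hol_at K 0" "K 0 = 0"
    unfolding K_def by (intro hol) (simp_all add: W hf zero_prod_def[symmetric])
  have kK: "hol_at (\<lambda>p. k (K p)) 0" by (rule hol_at_compose[where F = K]) (simp_all add: K hk)
  have gW: "hol_at (\<lambda>p. g (W p)) 0" by (rule hol_at_compose[where F = W]) (simp_all add: W hg)
  have hF: "hol_at F 0" unfolding F_def by (intro hol gW kK)
  have "\<forall>\<^sub>F p in nhds 0. hol_at F p \<and> hol_at f (W p) \<and> hol_at g (W p) \<and> hol_at k (K p) \<and>
      norm (K p) < \<rho>"
    using hol_at_eventually[OF hF]
      eventually_hol_compose[OF W(1), of "hol_at f" 0, unfolded W(2), OF hol_at_eventually[OF hf(1)]]
      eventually_hol_compose[OF W(1), of "hol_at g" 0, unfolded W(2), OF hol_at_eventually[OF hg]]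
      eventually_hol_compose[OF K(1), of "hol_at k", unfolded K(2), OF hol_at_eventually[OF hk]]
      eventually_hol_compose[OF K(1), of "\<lambda>y. y \<in> ball 0 \<rho>", unfolded K(2),
        OF eventually_nhds_in_open[OF open_ball centre_in_ball[THEN iffD2, OF \<rho>]]]
    by eventually_elim simp
  then obtain R where R: "R > 0" "\<And>p. norm p < R \<Longrightarrow> hol_at F p"
      "\<And>p. norm p < R \<Longrightarrow> hol_at f (W p)" "\<And>p. norm p < R \<Longrightarrow> hol_at g (W p)"
      "\<And>p. norm p < R \<Longrightarrow> hol_at k (K p)" "\<And>p. norm p < R \<Longrightarrow> norm (K p) < \<rho>"
    unfolding eventually_nhds_ball by (auto simp: mem_ball_0)
  define \<Theta> where "\<Theta> p = (fst p, q p, snd p)" for p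
  have \<Theta>: "hol_at \<Theta> 0" "\<Theta> 0 = 0" unfolding \<Theta>_def by (intro hol hq) (simp add: hq zero_prod_def[symmetric])
  have "\<forall>\<^sub>F p in nhds 0. hol_at q p \<and> norm (\<Theta> p) < R \<and> F (\<Theta> p) = 0"
    using hol_at_eventually[OF hq(1)] eq
      eventually_hol_compose[OF \<Theta>(1), of "\<lambda>y. y \<in> ball 0 R", unfolded \<Theta>(2),
        OF eventually_nhds_in_open[OF open_ball centre_in_ball[THEN iffD2, OF R(1)]]]
    by eventually_elim (simp add: F_def K_def W_def \<Theta>_def)
  then obtain r where r: "r > 0" "\<And>z y. norm z < r \<Longrightarrow> norm y < r \<Longrightarrow>
      hol_at q (z, y) \<and> norm (\<Theta> (z, y)) < R \<and> F (\<Theta> (z, y)) = 0"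
    by (rule eventually_nhds_0_prodE) (rule that)
  obtain y0 where y0: "norm y0 < r" "param_immersive q r y0"
    using nd r(1) unfolding nondegenerate_def by blast
  have "\<forall>\<^sub>F y in nhds y0. param_immersive q r y \<and> y \<in> ball 0 r"
    using eventually_param_immersive[OF y0(2)] eventually_nhds_in_open[OF open_ball, of y0 0 r] r(2) y0(1)
    by (auto elim: eventually_elim2)
  then obtain Y where Y: "open Y" "y0 \<in> Y" "\<And>y. y \<in> Y \<Longrightarrow> param_immersive q r y"
      "\<And>y. y \<in> Y \<Longrightarrow> norm y < r"
    unfolding eventually_nhds by auto
  \<comment> \<open>The direction of the variable w.\<close>
  define e where "e = (0 :: 'a, 1 :: complex, 0 :: 'e)"
  \<comment> \<open>The w-derivatives of F inherit insensitivity to u, since they commute with the derivative along u.\<close>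
  have vertical: "der (iterated_der n e F) p (0, 0, u) = 0"
    if p: "norm p < R" and u: "\<forall>z. norm z < \<rho> \<longrightarrow> der k (z, snd (snd p)) (0, u) = 0" for n p u
  proof -
    have F0: "der F p' (0, 0, u) = 0" if p': "norm p' < R" "snd (snd p') = snd (snd p)" for p'
    proof -
      have dW: "der W p' v = (fst v, fst (snd v))" for v
        unfolding W_def by (subst der_bounded_linear) (intro bounded_linear_intros, simp)
      note c = R(3-5)[OF p'(1), THEN hol_at_imp_cdiff] hol_at_imp_cdiff[OF W(1)]
      have cfW: "cdiff (\<lambda>p. f (W p)) p'" by (rule cdiff_compose[OF c(4,1)])
      have ss: "cdiff (\<lambda>p. snd (snd p)) p'" by (intro cdiff_snd cdiff_ident)
      have cK: "cdiff K p'" unfolding K_def by (rule cdiff_Pair[OF cfW ss])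
      have "der K p' (0, 0, u) = (der f (W p') (0, 0), u)"
        unfolding K_def by (simp add: der_Pair[OF cfW ss] der_compose[OF c(4,1)] dW
            der_bounded_linear[OF bounded_linear_compose[OF bounded_linear_snd bounded_linear_snd]])
      also have "der f (W p') (0, 0) = 0"
        using der_0[OF c(1)] by (simp add: zero_prod_def[symmetric])
      finally have dK: "der K p' (0, 0, u) = (0, u)" .
      have "der F p' (0, 0, u) = der g (W p') (0, 0) - der k (K p') (0, u)"
        unfolding F_def
        by (simp add: der_diff[OF cdiff_compose[OF c(4,2)] cdiff_compose[OF cK c(3)]]
            der_compose[OF c(4,2)] der_compose[OF cK c(3)] dW dK)
      moreover have "der g (W p') (0, 0) = 0"
        using der_0[OF c(2)] by (simp add: zero_prod_def[symmetric])
      moreover have "der k (K p') (0, u) = 0"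
      proof -
        have "norm (f (W p')) < \<rho>"
          using R(6)[OF p'(1)] norm_fst_le[of "f (W p')" "snd (snd p')"] by (simp add: K_def)
        then show ?thesis using u p'(2) by (simp add: K_def)
      qed
      ultimately show ?thesis by simp
    qed
    have "\<forall>\<^sub>F x in nhds p. x \<in> ball 0 R"
      using eventually_nhds_in_open[OF open_ball, of p 0 R] p by simp
    from eventually_line[OF this, of e]
    have "\<forall>\<^sub>F t in nhds 0. der F (p + cscale t e) (0, 0, u) = 0"
      by eventually_elim (intro F0, simp_all add: e_def)
    then show ?thesis
      unfolding der_iterated_der_commute[OF R(2)[OF p]]
      by (rule iterated_der_eq_0[OF hol_at_der[OF R(2)[OF p]]])
  qed
  \<comment> \<open>Induction on the order of the w-derivative, on the graph over Y.\<close>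
  have zero: "iterated_der n e F (\<Theta> (z, y)) = 0" if "norm z < r" "y \<in> Y" for n z y
    using that
  proof (induction n arbitrary: z y)
    case 0
    then show ?case using r(2) Y(4) by simp
  next
    case (Suc n)
    define G where "G = iterated_der n e F"
    have hG: "hol_at G p" "hol_at (iterated_der (Suc n) e F) p" if "norm p < R" for p
      unfolding G_def using R(2)[OF that] by (auto intro: hol)
    obtain u where u: "u \<noteq> 0" "\<forall>z. norm z < \<rho> \<longrightarrow> der k (z, y) (0, u) = 0"
    proof -
      have "norm (K (\<Theta> (z, y))) < \<rho>" using R(6) r(2) Suc.prems Y(4) by blast
      then have "norm y < \<rho>"
        using norm_snd_le[of y "f (W (\<Theta> (z, y)))"] by (simp add: K_def \<Theta>_def)
      then show thesis using kernel that by blast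
    qed
    obtain z1 where z1: "norm z1 < r" "der q (z1, y) (0, u) \<noteq> 0"
      using Y(3)[OF Suc.prems(2)] u(1) unfolding param_immersive_def by blast
    have prod: "der q (x, y) (0, u) * iterated_der (Suc n) e F (\<Theta> (x, y)) = 0" if x: "norm x < r" for x
    proof -
      note in_R = r(2)[OF x Y(4)[OF Suc.prems(2)]]
      have cG: "cdiff G (\<Theta> (x, y))" and cq: "cdiff q (x, y)"
        using hG(1) in_R hol_at_imp_cdiff by blast+
      have c\<Theta>: "cdiff \<Theta> (x, y)"
        unfolding \<Theta>_def by (intro cdiff_Pair cdiff_fst cdiff_snd cdiff_ident cq)
      have d\<Theta>: "der \<Theta> (x, y) (0, u) = cscale (der q (x, y) (0, u)) e + (0, 0, u)"
        unfolding \<Theta>_def e_def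
        by (simp add: der_Pair[OF cdiff_fst[OF cdiff_ident] cdiff_Pair[OF cq cdiff_snd[OF cdiff_ident]]]
            der_Pair[OF cq cdiff_snd[OF cdiff_ident]] der_bounded_linear bounded_linear_fst bounded_linear_snd)
      have "\<forall>\<^sub>F p in nhds (x, y). p \<in> ball 0 r \<times> Y"
        using eventually_nhds_in_open[OF open_Times[OF open_ball Y(1)], of "(x, y)" 0 r] x Suc.prems by simp
      then have "\<forall>\<^sub>F p in nhds (x, y). 0 = G (\<Theta> p)"
        by eventually_elim (use Suc.IH in \<open>auto simp: G_def\<close>)
      from fun_cong[OF der_cong[OF this cdiff_const], of "(0, u)"] have "0 = der (\<lambda>p. G (\<Theta> p)) (x, y) (0, u)"
        by simp
      also have "\<dots> = der G (\<Theta> (x, y)) (cscale (der q (x, y) (0, u)) e + (0, 0, u))"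
        by (simp add: der_compose[OF c\<Theta> cG] d\<Theta>)
      also have "\<dots> = der q (x, y) (0, u) * der G (\<Theta> (x, y)) e"
        using vertical[of "\<Theta> (x, y)" u n] in_R u(2)
        by (simp add: der_plus[OF cG] der_cscale[OF cG] G_def[symmetric]) (simp add: \<Theta>_def)
      finally show ?thesis by (simp add: iterated_der_Suc G_def)
    qed
    show ?case
    proof (rule hol_mult_eq_0[OF open_ball[of 0 r] convex_ball, where h = "\<lambda>x. der q (x, y) (0, u)"
          and k = "\<lambda>x. iterated_der (Suc n) e F (\<Theta> (x, y))" and x = z1])
      note in_R = r(2)[OF _ Y(4)[OF Suc.prems(2)]]
      have slice: "hol_at (\<lambda>x. (x, y)) x" for x :: 'a by (intro hol)
      show "hol_on (\<lambda>x. der q (x, y) (0, u)) (ball 0 r)"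
        unfolding hol_on_def
        by (intro ballI hol_at_compose[where F = "\<lambda>x. (x, y)" and G = "\<lambda>p. der q p (0, u)"] slice hol_at_der)
          (use in_R in simp)
      have "hol_at (\<lambda>x. \<Theta> (x, y)) x" if "norm x < r" for x
        unfolding \<Theta>_def using in_R[OF that]
        by (simp, intro hol hol_at_compose[where F = "\<lambda>x. (x, y)" and G = q] slice) simp
      then show "hol_on (\<lambda>x. iterated_der (Suc n) e F (\<Theta> (x, y))) (ball 0 r)"
        unfolding hol_on_def using in_R
        by (intro ballI hol_at_compose[where F = "\<lambda>x. \<Theta> (x, y)" and G = "iterated_der (Suc n) e F"] hG) auto
    qed (use z1 prod Suc.prems in auto)
  qed
  have "F p = 0" if p: "norm p < R" "norm (fst p) < r" "snd (snd p) \<in> Y" for p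
  proof -
    define P where "P = \<Theta> (fst p, snd (snd p))"
    have "p = P + cscale (fst (snd p) - fst (snd P)) e"
      by (simp add: P_def \<Theta>_def e_def prod_eq_iff)
    moreover have "F (P + cscale (fst (snd p) - fst (snd P)) e) = 0"
    proof (rule iterated_der_0_imp_zero_on_line[OF open_ball[of 0 R] convex_ball])
      show "hol_on F (ball 0 R)" using R(2) by (simp add: hol_on_def)
      show "P \<in> ball 0 R" using r(2)[OF p(2) Y(4)[OF p(3)]] by (simp add: P_def)
      show "P + cscale (fst (snd p) - fst (snd P)) e \<in> ball 0 R"
        using p(1) calculation by simp
      show "iterated_der n e F P = 0" for n
        unfolding P_def by (rule zero[OF p(2,3)])
    qed
    ultimately show ?thesis by simp
  qed
  then have vanish: "F p = 0" if "p \<in> ball 0 R \<inter> (ball 0 r \<times> UNIV \<times> Y)" for p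
    using that by auto
  define T where "T = ball 0 R \<inter> (ball (0 :: 'a) r \<times> (UNIV :: complex set) \<times> Y)"
  have "\<forall>\<^sub>F p in nhds 0. F p = 0"
  proof (rule eventually_zero_if_zero_on_open[OF R(1)])
    show "hol_on F (ball 0 R)" using R(2) by (simp add: hol_on_def)
    show "open T" "T \<subseteq> ball 0 R"
      unfolding T_def by (intro open_Int open_ball open_Times open_UNIV Y(1)) blast
    have "\<Theta> (0, y0) \<in> T"
      using r(2)[of 0 y0] r(1) y0(1) Y(2) by (simp add: \<Theta>_def T_def)
    then show "T \<noteq> {}" by blast
    show "F p = 0" if "p \<in> T" for p using that unfolding T_def by (rule vanish)
  qed
  then show ?thesis
    by eventually_elim (simp add: F_def K_def W_def)
qed

text \<open>The map \<open>(x,y) \<mapsto> (x,\<psi>(x,y))\<close> has an invertible derivative at some point \<open>(0,y)\<close> close to the origin, so its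
  image contains a nonempty open set, on which \<open>G\<close> vanishes.\<close>

lemma zero_if_zero_on_open_family:
  fixes \<psi> :: "'x::{complex_normed_space,euclidean_space} \<times> 'y::{complex_normed_space,euclidean_space} \<Rightarrow> 'y"
    and G :: "'x \<times> 'y \<Rightarrow> complex"
  assumes h\<psi>: "hol_at \<psi> 0" "\<psi> 0 = 0" and hG: "hol_at G 0"
    and eq: "\<forall>\<^sub>F p in nhds 0. G (fst p, \<psi> p) = 0"
    and imm: "\<exists>\<^sub>F y in nhds 0. \<forall>u. der \<psi> (0, y) (0, u) = 0 \<longrightarrow> u = 0"
  shows "\<forall>\<^sub>F p in nhds 0. G p = 0"
proof -
  obtain R where R: "R > 0" "hol_on G (ball 0 R)" using hol_at_ball[OF hG] .
  define \<Theta> where "\<Theta> p = (fst p, \<psi> p)" for p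
  have \<Theta>: "hol_at \<Theta> 0" "\<Theta> 0 = 0" unfolding \<Theta>_def by (intro hol h\<psi>) (simp add: h\<psi> zero_prod_def[symmetric])
  have "\<forall>\<^sub>F p in nhds 0. hol_at \<psi> p \<and> \<Theta> p \<in> ball 0 R \<and> G (\<Theta> p) = 0"
    using hol_at_eventually[OF h\<psi>(1)] eq
      eventually_hol_compose[OF \<Theta>(1), of "\<lambda>y. y \<in> ball 0 R", unfolded \<Theta>(2),
        OF eventually_nhds_in_open[OF open_ball centre_in_ball[THEN iffD2, OF R(1)]]]
    by eventually_elim (simp add: \<Theta>_def)
  then obtain r where r: "r > 0" "\<And>p. p \<in> ball 0 r \<Longrightarrow> hol_at \<psi> p \<and> \<Theta> p \<in> ball 0 R \<and> G (\<Theta> p) = 0"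
    unfolding eventually_nhds_ball by blast
  have "\<exists>y\<in>ball 0 r. \<forall>u. der \<psi> (0, y) (0, u) = 0 \<longrightarrow> u = 0"
    using imm r(1) unfolding frequently_def eventually_nhds_ball by blast
  then obtain y where y: "norm y < r" "\<And>u. der \<psi> (0, y) (0, u) = 0 \<Longrightarrow> u = 0" by auto
  have y': "(0, y) \<in> ball (0 :: 'x \<times> 'y) r" using y(1) by simp
  have c\<psi>: "cdiff \<psi> p" if "p \<in> ball 0 r" for p using r(2)[OF that] hol_at_imp_cdiff by blast
  have c\<Theta>: "cdiff \<Theta> p" if "p \<in> ball 0 r" for p
    unfolding \<Theta>_def by (intro cdiff_Pair cdiff_fst cdiff_ident c\<psi> that)
  have d\<Theta>: "der \<Theta> (0, y) v = (fst v, der \<psi> (0, y) v)" for v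
    unfolding \<Theta>_def
    by (simp add: der_Pair[OF cdiff_fst[OF cdiff_ident] c\<psi>[OF y']] der_bounded_linear bounded_linear_fst)
  have "inj (der \<Theta> (0, y))"
  proof (rule linear_injective_0[OF der_linear[OF c\<Theta>[OF y']], THEN iffD2], intro allI impI)
    fix v assume "der \<Theta> (0, y) v = 0"
    then have "fst v = 0" "der \<psi> (0, y) v = 0" by (simp_all add: d\<Theta> zero_prod_def)
    then show "v = 0" using y(2)[of "snd v"] by (cases v) (simp add: zero_prod_def)
  qed
  then obtain L where L: "linear L" "\<And>v. der \<Theta> (0, y) (L v) = v"
    using linear_injective_isomorphism[OF der_linear[OF c\<Theta>[OF y']]] by blast
  have "\<Theta> (0, y) \<in> interior (\<Theta> ` ball 0 r)"
  proof (rule sussmann_open_mapping[OF open_ball _ y' cdiff_has_derivative[OF c\<Theta>[OF y']]])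
    show "continuous_on (ball 0 r) \<Theta>"
      using c\<Theta> cdiff_isCont by (intro continuous_at_imp_continuous_on) blast
    show "bounded_linear L" using L(1) linear_conv_bounded_linear by blast
    show "der \<Theta> (0, y) \<circ> L = id" using L(2) by auto
  qed (use y' in auto)
  then show ?thesis
    using r(2) y'
    by (intro eventually_zero_if_zero_on_open[OF R, of "interior (\<Theta> ` ball 0 r) \<inter> ball 0 R"])
      (use interior_subset[of "\<Theta> ` ball 0 r"] in auto)
qed

section \<open>Class \<open>\<C>\<close> as infinitesimal separation\<close>

lemma cscale_axis: "x + axis j t = x + cscale t (axis j 1 :: complex ^ 'n)"
  by (simp add: vec_eq_iff axis_def)

lemma cpartial_eq_der: "cdiff h z \<Longrightarrow> cpartial j h z = der h z (axis j 1)"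
  unfolding cpartial_def cscale_axis
  using DERIV_imp_deriv[OF has_field_derivative_along_line[of h z 0 "axis j 1"]] by simp

lemma fold_funpow_invariant:
  assumes "\<And>j a b. P a b \<Longrightarrow> P (f j a) (g j b)" "P a b"
  shows "P (fold (\<lambda>j. f j ^^ \<alpha> j) js a) (fold (\<lambda>j. g j ^^ \<alpha> j) js b)"
  using assms(2)
proof (induction js arbitrary: a b)
  case (Cons j js)
  have "P ((f j ^^ m) a) ((g j ^^ m) b)" for m
    by (induction m) (use Cons.prems assms(1) in auto)
  then show ?case using Cons.IH by simp
qed simp

text \<open>Partial derivatives in the first group of variables, as operators on functions of both groups.  They are the
  two-variable counterparts of \<open>cpartial\<close> and \<open>multi_deriv\<close> and commute with derivatives in the
  second group.\<close>

definition partial_fst ::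
    "'n::finite \<Rightarrow> ((complex ^ 'n) \<times> 'e::complex_normed_space \<Rightarrow> complex) \<Rightarrow> (complex ^ 'n) \<times> 'e \<Rightarrow> complex" where
  "partial_fst j G = (\<lambda>p. der G p (axis j 1, 0))"

definition multi_partial_fst ::
    "('n \<Rightarrow> nat) \<Rightarrow> ((complex ^ 'n::finite) \<times> 'e::complex_normed_space \<Rightarrow> complex) \<Rightarrow> (complex ^ 'n) \<times> 'e \<Rightarrow> complex" where
  "multi_partial_fst \<alpha> G = fold (\<lambda>j. partial_fst j ^^ \<alpha> j) (SOME js. distinct js \<and> set js = UNIV) G"

lemma multi_deriv_slice:
  fixes G :: "(complex ^ 'n::finite) \<times> 'e::complex_normed_space \<Rightarrow> complex"
  assumes "open S" "hol_on G S" "(z, y) \<in> S"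
  shows "multi_deriv \<alpha> (\<lambda>z. G (z, y)) z = multi_partial_fst \<alpha> G (z, y)"
    and "hol_at (multi_partial_fst \<alpha> G) (z, y)"
proof -
  define P where "P h H \<longleftrightarrow> hol_on H S \<and> (\<forall>z. (z, y) \<in> S \<longrightarrow> h z = H (z, y))"
    for h :: "complex ^ 'n \<Rightarrow> complex" and H
  have "P (cpartial j h) (partial_fst j H)" if "P h H" for j h H
    unfolding P_def
  proof (intro conjI allI impI)
    have H: "hol_on H S" "\<And>z. (z, y) \<in> S \<Longrightarrow> h z = H (z, y)" using that unfolding P_def by auto
    show "hol_on (partial_fst j H) S"
      using H(1) unfolding hol_on_def partial_fst_def by (auto intro: hol)
    fix z assume z: "(z, y) \<in> S"
    have "\<forall>\<^sub>F p in nhds (z, y). p \<in> S" using eventually_nhds_in_open[OF assms(1) z] .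
    from eventually_line[OF this, of "(axis j 1, 0)"]
    have "\<forall>\<^sub>F t in nhds 0. h (z + axis j t) = H ((z, y) + cscale t (axis j 1, 0))"
      by eventually_elim (simp add: cscale_axis H(2))
    then have "cpartial j h z = deriv (\<lambda>t. H ((z, y) + cscale t (axis j 1, 0))) 0"
      unfolding cpartial_def by (rule deriv_cong_ev) simp
    also have "\<dots> = der H (z, y) (axis j 1, 0)"
      using DERIV_imp_deriv[OF has_field_derivative_along_line[of H "(z, y)" 0 "(axis j 1, 0)"]]
        hol_at_imp_cdiff[OF hol_onD[OF H(1) z]] by simp
    finally show "cpartial j h z = partial_fst j H (z, y)" by (simp add: partial_fst_def)
  qed
  moreover have "P (\<lambda>z. G (z, y)) G"
    unfolding P_def using assms(2) by blast
  ultimately have "P (multi_deriv \<alpha> (\<lambda>z. G (z, y))) (multi_partial_fst \<alpha> G)"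
    unfolding multi_deriv_def multi_partial_fst_def
    by (rule fold_funpow_invariant[where P = P and f = cpartial and g = partial_fst])
  then show "multi_deriv \<alpha> (\<lambda>z. G (z, y)) z = multi_partial_fst \<alpha> G (z, y)"
      "hol_at (multi_partial_fst \<alpha> G) (z, y)"
    unfolding P_def using assms(3) hol_onD by blast+
qed

lemma der_multi_partial_fst:
  fixes G :: "(complex ^ 'n::finite) \<times> 'e::complex_normed_space \<Rightarrow> complex"
  assumes "open S" "hol_on G S" "p \<in> S"
  shows "der (multi_partial_fst \<alpha> G) p v = multi_partial_fst \<alpha> (\<lambda>p. der G p v) p"
proof -
  define P where "P H H' \<longleftrightarrow> hol_on H S \<and> (\<forall>p\<in>S. der H p v = H' p)"
    for H H' :: "(complex ^ 'n) \<times> 'e \<Rightarrow> complex"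
  have "P (partial_fst j H) (partial_fst j H')" if "P H H'" for j H H'
    unfolding P_def
  proof (intro conjI ballI)
    have H: "hol_on H S" "\<And>p. p \<in> S \<Longrightarrow> der H p v = H' p" using that unfolding P_def by auto
    show "hol_on (partial_fst j H) S"
      using H(1) unfolding hol_on_def partial_fst_def by (auto intro: hol)
    fix p assume p: "p \<in> S"
    have "\<forall>\<^sub>F p in nhds p. der H p v = H' p"
      using eventually_nhds_in_open[OF assms(1) p] by eventually_elim (rule H(2))
    from der_cong[OF this hol_at_imp_cdiff[OF hol_at_der[OF hol_onD[OF H(1) p]]]]
    have "der (\<lambda>p. der H p v) p = der H' p" .
    then show "der (partial_fst j H) p v = partial_fst j H' p"
      unfolding partial_fst_def using der_commute[OF hol_onD[OF H(1) p]] by metis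
  qed
  moreover have "P G (\<lambda>p. der G p v)"
    unfolding P_def using assms(2) by blast
  ultimately have "P (multi_partial_fst \<alpha> G) (multi_partial_fst \<alpha> (\<lambda>p. der G p v))"
    unfolding multi_partial_fst_def
    by (rule fold_funpow_invariant[where P = P and f = partial_fst and g = partial_fst])
  then show ?thesis unfolding P_def using assms(3) by blast
qed

lemma multi_deriv_eq_0:
  assumes "open S" "\<And>z. z \<in> S \<Longrightarrow> h z = 0" "z \<in> S"
  shows "multi_deriv \<alpha> h z = 0"
proof -
  have "\<forall>z\<in>S. cpartial j h z = 0" if h: "\<forall>z\<in>S. h z = 0" for j h
  proof
    fix z assume "z \<in> S"
    from eventually_line[OF eventually_nhds_in_open[OF assms(1) this], of "axis j 1"]
    have "\<forall>\<^sub>F t in nhds 0. h (z + axis j t) = 0"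
      by eventually_elim (simp add: cscale_axis h)
    then have "cpartial j h z = deriv (\<lambda>t. 0) 0"
      unfolding cpartial_def by (rule deriv_cong_ev) simp
    then show "cpartial j h z = 0" by simp
  qed
  then have "\<forall>z\<in>S. multi_deriv \<alpha> h z = 0"
    unfolding multi_deriv_def
    by (rule fold_funpow_invariant[where P = "\<lambda>h (_ :: unit). \<forall>z\<in>S. h z = 0" and g = "\<lambda>_ x. x" and b = "()"])
      (use assms(2) in auto)
  then show ?thesis using assms(3) by blast
qed

lemma funpow_cpartial_eq_iterated_der:
  fixes h :: "complex ^ 'n::finite \<Rightarrow> complex"
  assumes "open S" "hol_on h S" "z \<in> S"
  shows "(cpartial j ^^ m) h z = iterated_der m (axis j 1) h z"
  using assms(3)
proof (induction m arbitrary: z)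
  case (Suc m)
  have "\<forall>\<^sub>F z in nhds z. z \<in> S" using eventually_nhds_in_open[OF assms(1) Suc.prems] .
  from eventually_line[OF this, of "axis j 1"]
  have "\<forall>\<^sub>F t in nhds 0. (cpartial j ^^ m) h (z + axis j t) = iterated_der m (axis j 1) h (z + axis j t)"
    by eventually_elim (simp add: cscale_axis Suc.IH)
  then have "(cpartial j ^^ Suc m) h z = cpartial j (iterated_der m (axis j 1) h) z"
    unfolding cpartial_def funpow.simps o_def by (rule deriv_cong_ev) simp
  also have "\<dots> = der (iterated_der m (axis j 1) h) z (axis j 1)"
    by (intro cpartial_eq_der hol_at_imp_cdiff hol_at_iterated_der hol_onD[OF assms(2) Suc.prems])
  finally show ?case by (simp add: iterated_der_Suc)
qed simp

text \<open>Taylor expansion in one coordinate after the other: if the derivatives listed in \<open>js\<close> vanish at \<open>0\<close>,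
  then by induction every \<open>j\<close>-derivative vanishes on the coordinate subspace of the remaining
  coordinates, and \<open>h\<close> is \<open>0\<close> on each line in direction \<open>j\<close> through it.\<close>

lemma zero_if_fold_cpartial_zero:
  fixes h :: "complex ^ 'n::finite \<Rightarrow> complex"
  assumes "distinct js" "hol_on h (ball 0 r)"
    and "\<And>\<alpha>. fold (\<lambda>j. cpartial j ^^ \<alpha> j) js h 0 = 0"
    and "norm z < r" "\<And>i. i \<notin> set js \<Longrightarrow> z $ i = 0"
  shows "h z = 0"
  using assms
proof (induction js arbitrary: h z)
  case Nil
  then have "z = 0" by (simp add: vec_eq_iff)
  then show ?case using Nil.prems(3) by simp
next
  case (Cons j js)
  define z' where "z' = (\<chi> i. if i = j then 0 else z $ i)"
  have z': "norm z' < r"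
    by (rule le_less_trans[OF norm_le_componentwise_cart Cons.prems(4)]) (simp add: z'_def)
  have z: "z = z' + cscale (z $ j) (axis j 1)"
    by (simp add: z'_def vec_eq_iff axis_def)
  have "iterated_der m (axis j 1) h z' = 0" for m
  proof -
    have eq: "(cpartial j ^^ m) h x = iterated_der m (axis j 1) h x" if "x \<in> ball 0 r" for x
      using funpow_cpartial_eq_iterated_der[OF open_ball Cons.prems(2) that] .
    have "(cpartial j ^^ m) h z' = 0"
    proof (rule Cons.IH)
      show "hol_on ((cpartial j ^^ m) h) (ball 0 r)"
        unfolding hol_on_def
      proof
        fix x :: "complex ^ 'n" assume x: "x \<in> ball 0 r"
        have "\<forall>\<^sub>F x in nhds x. iterated_der m (axis j 1) h x = (cpartial j ^^ m) h x"
          using eventually_nhds_in_open[OF open_ball x] by eventually_elim (simp add: eq)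
        then show "hol_at ((cpartial j ^^ m) h) x"
          by (rule hol_at_cong) (intro hol_at_iterated_der hol_onD[OF Cons.prems(2) x])
      qed
      show "fold (\<lambda>j. cpartial j ^^ \<alpha> j) js ((cpartial j ^^ m) h) 0 = 0" for \<alpha>
      proof -
        have "fold (\<lambda>i. cpartial i ^^ (\<alpha>(j := m)) i) js ((cpartial j ^^ m) h)
            = fold (\<lambda>i. cpartial i ^^ \<alpha> i) js ((cpartial j ^^ m) h)"
          by (rule fold_cong) (use Cons.prems(1) in auto)
        then show ?thesis using Cons.prems(3)[of "\<alpha>(j := m)"] by simp
      qed
    qed (use Cons.prems z' in \<open>auto simp: z'_def\<close>)
    then show ?thesis using eq z' by simp
  qed
  then have "h (z' + cscale (z $ j) (axis j 1)) = 0"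
    by (intro iterated_der_0_imp_zero_on_line[OF open_ball convex_ball Cons.prems(2)])
      (use z' z Cons.prems(4) in auto)
  then show ?case using z by simp
qed

lemma zero_if_multi_deriv_zero:
  fixes h :: "complex ^ 'n::finite \<Rightarrow> complex"
  assumes "hol_on h (ball 0 r)" "\<And>\<alpha>. multi_deriv \<alpha> h 0 = 0" "norm z < r"
  shows "h z = 0"
proof -
  have js: "distinct (SOME js. distinct js \<and> set js = (UNIV :: 'n set)) \<and>
      set (SOME js. distinct js \<and> set js = (UNIV :: 'n set)) = UNIV"
    by (rule someI_ex) (use finite_distinct_list[OF finite] in blast)
  show ?thesis
    by (rule zero_if_fold_cpartial_zero[OF conjunct1[OF js] assms(1) _ assms(3)])
      (use assms(2) js in \<open>auto simp: multi_deriv_def\<close>)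
qed

text \<open>A maximal independent set of rows has at most as many elements as there are columns, and it has the same
  kernel as all rows.  Rows may be repeated to fill up a square matrix; injectivity makes its
  determinant nonzero all the same.\<close>

lemma injective_rows_imp_nonzero_minor:
  fixes v :: "'i \<Rightarrow> 'a::field ^ 'n::finite"
  assumes "\<And>u. (\<And>i. (\<Sum>j\<in>UNIV. v i $ j * u $ j) = 0) \<Longrightarrow> u = 0"
  obtains a :: "'n \<Rightarrow> 'i" where "det (\<chi> i. v (a i)) \<noteq> 0"
proof -
  obtain B where B: "B \<subseteq> range v" "vec.independent B" "range v \<subseteq> vec.span B"
    using vec.maximal_independent_subset by blast
  have "card B \<le> CARD('n)"
    using vec.independent_card_le_dim[OF subset_UNIV B(2)] by (simp add: vec.dim_UNIV card_cart_basis)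
  then obtain c where c: "c ` B \<subseteq> (UNIV :: 'n set)" "inj_on c B"
    using card_le_inj[OF vec.finiteI_independent[OF B(2)], of "UNIV :: 'n set"] by auto
  have "B \<noteq> {}"
  proof
    assume "B = {}"
    then have "v i = 0" for i using B(3) by auto
    then have "(1 :: 'a ^ 'n) = 0" using assms[of 1] by simp
    then show False by (simp add: vec_eq_iff)
  qed
  then obtain b0 where b0: "b0 \<in> B" by blast
  define s where "s i = (if i \<in> c ` B then inv_into B c i else b0)" for i
  have s: "s (c b) = b" "s i \<in> B" if "b \<in> B" for b i
    using that c b0 by (auto simp: s_def inv_into_into)
  define a where "a i = (SOME m. v m = s i)" for i
  have a: "v (a i) = s i" for i
  proof -
    have "s i \<in> range v" using B(1) s(2)[OF b0] by blast
    then have "\<exists>m. v m = s i" by auto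
    then show ?thesis unfolding a_def by (rule someI_ex)
  qed
  define A where "A = (\<chi> i. v (a i))"
  have "u = 0" if u: "A *v u = 0" for u
  proof (rule assms)
    have "(\<Sum>j\<in>UNIV. x $ j * u $ j) = 0" if "x \<in> vec.span B" for x
    proof (rule vec.span_induct[OF that])
      show "vec.subspace {x. (\<Sum>j\<in>UNIV. x $ j * u $ j) = 0}"
        by (auto simp: vec.subspace_def distrib_right sum.distrib mult.assoc simp flip: sum_distrib_left)
      fix b assume "b \<in> B"
      have "(A *v u) $ c b = 0" using u by simp
      then show "(\<Sum>j\<in>UNIV. b $ j * u $ j) = 0"
        by (simp add: matrix_vector_mult_def A_def a s(1)[OF \<open>b \<in> B\<close>])
    qed
    then show "(\<Sum>j\<in>UNIV. v i $ j * u $ j) = 0" for i using B(3) by blast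
  qed
  then have "invertible A"
    unfolding invertible_left_inverse matrix_left_invertible_ker by blast
  then have "det A \<noteq> 0" by (simp add: invertible_det_nz)
  then show thesis using that unfolding A_def by blast
qed

text \<open>Conjugation with the enumeration \<open>b\<close> turns permutations of the index range into permutations of the
  coordinates and preserves signs.\<close>

lemma jacobian_minor_eq_det:
  fixes \<phi> :: "complex ^ 'n::finite \<Rightarrow> 'i \<Rightarrow> complex"
  assumes b: "bij_betw b {..<CARD('n)} UNIV"
  shows "jacobian_minor \<phi> (CARD('n)) a b z =
    det (\<chi> i j. cpartial j (\<lambda>x. \<phi> x (a (inv_into {..<CARD('n)} b i))) z)"
proof -
  let ?N = "{..<CARD('n)}"
  let ?\<pi> = "map_permutation ?N b"
  have inj: "inj_on b ?N" using b by (simp add: bij_betw_def)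
  have inv: "inv_into ?N b (b k) = k" if "k < CARD('n)" for k
    using inj that by simp
  have "bij_betw ?\<pi> {p. p permutes ?N} {p. p permutes UNIV}"
  proof (rule bij_betwI)
    show "?\<pi> \<in> {p. p permutes ?N} \<rightarrow> {p. p permutes UNIV}"
      using map_permutation_permutes[OF b] by auto
    show "map_permutation UNIV (inv_into ?N b) \<in> {p. p permutes UNIV} \<rightarrow> {p. p permutes ?N}"
      using map_permutation_permutes[OF bij_betw_inv_into[OF b]] by auto
    show "map_permutation UNIV (inv_into ?N b) (?\<pi> p) = p" if "p \<in> {p. p permutes ?N}" for p
      using map_permutation_compose_inv[OF b, of p "inv_into ?N b"] that inv by auto
    show "?\<pi> (map_permutation UNIV (inv_into ?N b) p) = p" if "p \<in> {p. p permutes UNIV}" for p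
      using map_permutation_compose_inv[OF bij_betw_inv_into[OF b], of p b] that
        bij_betw_inv_into_right[OF b] by auto
  qed
  then have "det (\<chi> i j. cpartial j (\<lambda>x. \<phi> x (a (inv_into ?N b i))) z) =
      (\<Sum>p | p permutes ?N. of_int (sign (?\<pi> p)) *
        (\<Prod>i\<in>UNIV. cpartial (?\<pi> p i) (\<lambda>x. \<phi> x (a (inv_into ?N b i))) z))"
    unfolding det_def by (subst sum.reindex_bij_betw[symmetric]) simp_all
  also have "\<dots> = jacobian_minor \<phi> (CARD('n)) a b z"
    unfolding jacobian_minor_def
  proof (rule sum.cong[OF refl])
    fix p assume p: "p \<in> {p. p permutes ?N}"
    have "(\<Prod>i\<in>UNIV. cpartial (?\<pi> p i) (\<lambda>x. \<phi> x (a (inv_into ?N b i))) z) =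
        (\<Prod>k<CARD('n). cpartial (?\<pi> p (b k)) (\<lambda>x. \<phi> x (a (inv_into ?N b (b k)))) z)"
      by (rule prod.reindex_bij_betw[OF b, symmetric])
    also have "\<dots> = (\<Prod>k<CARD('n). cpartial (b (p k)) (\<lambda>x. \<phi> x (a k)) z)"
      by (rule prod.cong) (simp_all add: map_permutation_apply[OF inj] inv)
    finally show "of_int (sign (?\<pi> p)) * (\<Prod>i\<in>UNIV. cpartial (?\<pi> p i) (\<lambda>x. \<phi> x (a (inv_into ?N b i))) z) =
        of_int (sign p) * (\<Prod>k<CARD('n). cpartial (b (p k)) (\<lambda>x. \<phi> x (a k)) z)"
      using sign_map_permutation[OF inj, of p] p by simp
  qed
  finally show ?thesis ..
qed

lemma generic_rank_eq_CARD_iff: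
  fixes \<phi> :: "complex ^ 'n::finite \<Rightarrow> 'i \<Rightarrow> complex"
  shows "generic_rank I \<phi> = CARD('n) \<longleftrightarrow>
    (\<exists>a b. inj_on a {..<CARD('n)} \<and> a ` {..<CARD('n)} \<subseteq> I \<and> inj_on b {..<CARD('n)} \<and>
       \<not> (\<forall>\<^sub>F z in nhds 0. jacobian_minor \<phi> (CARD('n)) a b z = 0))"
proof -
  define R where "R = {r. \<exists>a b. inj_on a {..<r} \<and> a ` {..<r} \<subseteq> I \<and> inj_on (b :: nat \<Rightarrow> 'n) {..<r} \<and>
                \<not> (\<forall>\<^sub>F z in nhds 0. jacobian_minor \<phi> r a b z = 0)}"
  have bound: "r \<le> CARD('n)" if "r \<in> R" for r
    using that card_inj_on_le[of _ "{..<r}" "UNIV :: 'n set"] by (auto simp: R_def)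
  then have fin: "finite R" by (meson finite_nat_set_iff_bounded_le)
  have "jacobian_minor \<phi> 0 a b z = 1" for a b z
    by (simp add: jacobian_minor_def)
  then have "0 \<in> R" by (simp add: R_def)
  then have "Max R = CARD('n) \<longleftrightarrow> CARD('n) \<in> R"
    using fin bound by (metis Max_eqI Max_in empty_iff)
  then show ?thesis unfolding generic_rank_def R_def by blast
qed

text \<open>The Jacobian matrix of \<open>\<chi> \<mapsto> (Q\<^bsub>z\<^sup>\<alpha>\<^esub>(0,\<chi>,0))\<^sub>\<alpha>\<close> sends \<open>u\<close> to the derivatives at \<open>z = 0\<close> of
  \<open>z \<mapsto> D\<^sub>\<chi> q(z,\<chi>) u\<close>.  So \<open>u\<close> is in its kernel if and only if this function vanishes identically, and the
  kernel is trivial if and only if finitely many rows already form a nonzero minor.\<close>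

lemma class_C_iff_nondegenerate:
  fixes Q :: "(complex ^ 'n::finite) \<times> (complex ^ 'n) \<times> complex \<Rightarrow> complex"
  defines "q \<equiv> \<lambda>p. Q (fst p, snd p, 0)"
  assumes hq: "hol_at q 0"
  shows "class_C Q \<longleftrightarrow> nondegenerate q"
proof -
  define \<phi> where "\<phi> chi \<alpha> = multi_deriv \<alpha> (\<lambda>z. Q (z, chi, 0)) 0" for chi \<alpha>
  have "\<forall>\<^sub>F p in nhds 0. hol_at q p" using hol_at_eventually[OF hq] .
  then obtain R where R: "R > 0" "\<And>z y. norm z < R \<Longrightarrow> norm y < R \<Longrightarrow> hol_at q (z, y)"
    by (rule eventually_nhds_0_prodE) (rule that)
  define S where "S = ball (0 :: complex ^ 'n) R \<times> ball (0 :: complex ^ 'n) R"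
  have S: "open S" "hol_on q S" unfolding S_def hol_on_def using R by (auto intro: open_Times)
  have inS: "(0, y) \<in> S" if "norm y < R" for y using that R(1) by (simp add: S_def)
  have \<phi>_eq: "\<phi> y \<alpha> = multi_partial_fst \<alpha> q (0, y)" if "norm y < R" for y \<alpha>
    using multi_deriv_slice(1)[OF S inS[OF that]] by (simp add: \<phi>_def q_def)
  have h\<phi>: "hol_at (\<lambda>y. \<phi> y \<alpha>) y" if y: "norm y < R" for y \<alpha>
  proof -
    have "hol_at (\<lambda>y. multi_partial_fst \<alpha> q (0, y)) y"
      by (rule hol_at_compose[where F = "\<lambda>y. (0, y)"]) (intro multi_deriv_slice(2)[OF S inS[OF y]] hol)+
    moreover have "\<forall>\<^sub>F y in nhds y. multi_partial_fst \<alpha> q (0, y) = \<phi> y \<alpha>"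
      using eventually_nhds_in_open[OF open_ball, of y 0 R] y
      by (auto elim!: eventually_mono simp: \<phi>_eq)
    ultimately show ?thesis by (rule hol_at_cong[rotated])
  qed
  have d\<phi>: "(\<Sum>j\<in>UNIV. cpartial j (\<lambda>y. \<phi> y \<alpha>) y * u $ j) = multi_deriv \<alpha> (\<lambda>z. der q (z, y) (0, u)) 0"
    if y: "norm y < R" for y \<alpha> u
  proof -
    have cd: "cdiff (\<lambda>y. \<phi> y \<alpha>) y" using hol_at_imp_cdiff[OF h\<phi>[OF y]] .
    have "u = (\<Sum>j\<in>UNIV. cscale (u $ j) (axis j 1))"
      by (simp add: vec_eq_iff axis_def if_distrib[of "\<lambda>x. _ * x"] cong: if_cong)
    then have "der (\<lambda>y. \<phi> y \<alpha>) y u = (\<Sum>j\<in>UNIV. u $ j * der (\<lambda>y. \<phi> y \<alpha>) y (axis j 1))"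
      using linear_sum[OF der_linear[OF cd], of "\<lambda>j. cscale (u $ j) (axis j 1)" UNIV]
      by (simp add: der_cscale[OF cd])
    then have "(\<Sum>j\<in>UNIV. cpartial j (\<lambda>y. \<phi> y \<alpha>) y * u $ j) = der (\<lambda>y. \<phi> y \<alpha>) y u"
      by (simp add: cpartial_eq_der[OF cd] mult.commute)
    also have "\<dots> = der (\<lambda>y. multi_partial_fst \<alpha> q (0, y)) y u"
    proof -
      have "\<forall>\<^sub>F y in nhds y. \<phi> y \<alpha> = multi_partial_fst \<alpha> q (0, y)"
        using eventually_nhds_in_open[OF open_ball, of y 0 R] y
        by (auto elim!: eventually_mono simp: \<phi>_eq)
      from der_cong[OF this cd] show ?thesis by simp
    qed
    also have "\<dots> = der (multi_partial_fst \<alpha> q) (0, y) (0, u)"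
      by (rule der_slice_first(2)[OF hol_at_imp_cdiff[OF multi_deriv_slice(2)[OF S inS[OF y]]]])
    also have "\<dots> = multi_partial_fst \<alpha> (\<lambda>p. der q p (0, u)) (0, y)"
      by (rule der_multi_partial_fst[OF S inS[OF y]])
    also have "\<dots> = multi_deriv \<alpha> (\<lambda>z. der q (z, y) (0, u)) 0"
    proof (rule multi_deriv_slice(1)[OF S(1) _ inS[OF y], symmetric])
      show "hol_on (\<lambda>p. der q p (0, u)) S" using S(2) unfolding hol_on_def by (auto intro: hol)
    qed
    finally show ?thesis .
  qed
  define N where "N = {..<CARD('n)}"
  show ?thesis
  proof
    assume "class_C Q"
    then obtain K where "generic_rank {\<alpha> :: 'n \<Rightarrow> nat. (\<Sum>i\<in>UNIV. \<alpha> i) \<le> K} \<phi> = CARD('n)"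
      unfolding class_C_def \<phi>_def by blast
    then obtain a b where ab: "inj_on b N" "\<not> (\<forall>\<^sub>F z in nhds 0. jacobian_minor \<phi> (CARD('n)) a b z = 0)"
      unfolding generic_rank_eq_CARD_iff N_def by blast
    have b: "bij_betw b N UNIV"
      using ab(1) card_image[OF ab(1)] card_subset_eq[OF finite subset_UNIV, of "b ` N"]
      by (auto simp: bij_betw_def N_def)
    show "nondegenerate q"
      unfolding nondegenerate_def
    proof (intro allI impI)
      fix r :: real assume r: "r > 0"
      define r' where "r' = min r R"
      have r': "r' > 0" "r' \<le> r" "r' \<le> R" using r R(1) by (auto simp: r'_def)
      obtain y where y: "norm y < r'" "jacobian_minor \<phi> (CARD('n)) a b y \<noteq> 0"
        using ab(2) r'(1) unfolding eventually_nhds_ball by auto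
      have "param_immersive q r y"
        unfolding param_immersive_def
      proof (intro allI impI)
        fix u assume u: "\<forall>z. norm z < r \<longrightarrow> der q (z, y) (0, u) = 0"
        have yR: "norm y < R" using y r' by simp
        define A where "A = (\<chi> i j. cpartial j (\<lambda>x. \<phi> x (a (inv_into N b i))) y)"
        have "(\<Sum>j\<in>UNIV. cpartial j (\<lambda>y. \<phi> y \<alpha>) y * u $ j) = 0" for \<alpha>
        proof -
          have "multi_deriv \<alpha> (\<lambda>z. der q (z, y) (0, u)) 0 = 0"
            by (rule multi_deriv_eq_0[OF open_ball[of 0 r]]) (use u r in simp_all)
          then show ?thesis using d\<phi>[OF yR] by simp
        qed
        then have "A *v u = 0"
          by (simp add: A_def matrix_vector_mult_def vec_eq_iff)
        moreover have "det A \<noteq> 0"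
          using y(2) jacobian_minor_eq_det[OF b[unfolded N_def], of \<phi> a y] by (simp add: A_def N_def)
        ultimately show "u = 0"
          using invertible_det_nz[of A] unfolding invertible_left_inverse matrix_left_invertible_ker by blast
      qed
      then show "\<exists>y. norm y < r \<and> param_immersive q r y"
        using y(1) r'(2) by (intro exI[of _ y]) simp
    qed
  next
    assume "nondegenerate q"
    then obtain y where y: "norm y < R" "param_immersive q R y"
      using R(1) unfolding nondegenerate_def by blast
    have "\<exists>a :: 'n \<Rightarrow> 'n \<Rightarrow> nat. det (\<chi> i. (\<chi> j. cpartial j (\<lambda>y. \<phi> y (a i)) y)) \<noteq> 0"
    proof (rule injective_rows_imp_nonzero_minor[where v = "\<lambda>\<alpha>. \<chi> j. cpartial j (\<lambda>y. \<phi> y \<alpha>) y"])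
      fix u :: "complex ^ 'n"
      assume "\<And>\<alpha>. (\<Sum>j\<in>UNIV. (\<chi> j. cpartial j (\<lambda>y. \<phi> y \<alpha>) y) $ j * u $ j) = 0"
      then have u: "multi_deriv \<alpha> (\<lambda>z. der q (z, y) (0, u)) 0 = 0" for \<alpha>
        using d\<phi>[OF y(1)] by simp
      have "hol_on (\<lambda>z. der q (z, y) (0, u)) (ball 0 R)"
        unfolding hol_on_def using R(2) y(1)
        by (intro ballI hol_at_compose[where F = "\<lambda>z. (z, y)" and G = "\<lambda>p. der q p (0, u)"] hol_at_der hol_at_Pair
            hol_at_ident hol_at_const) simp
      from zero_if_multi_deriv_zero[OF this u] show "u = 0"
        using y(2) unfolding param_immersive_def by blast
    qed blast
    then obtain \<beta> :: "'n \<Rightarrow> 'n \<Rightarrow> nat" where \<beta>: "det (\<chi> i j. cpartial j (\<lambda>y. \<phi> y (\<beta> i)) y) \<noteq> 0"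
      by blast
    obtain b :: "nat \<Rightarrow> 'n" where b: "bij_betw b N UNIV"
      using ex_bij_betw_nat_finite[of "UNIV :: 'n set"] by (auto simp: N_def atLeast0LessThan)
    define a where "a = \<beta> \<circ> b"
    have minor: "jacobian_minor \<phi> (CARD('n)) a b x = det (\<chi> i j. cpartial j (\<lambda>y. \<phi> y (\<beta> i)) x)" for x
      using jacobian_minor_eq_det[OF b[unfolded N_def], of \<phi> a x] bij_betw_inv_into_right[OF b[unfolded N_def]]
      by (simp add: a_def)
    have "inj \<beta>"
    proof (rule injI, rule ccontr)
      fix i i' assume "\<beta> i = \<beta> i'" "i \<noteq> i'"
      then have "det (\<chi> i j. cpartial j (\<lambda>y. \<phi> y (\<beta> i)) y) = 0"
        by (intro det_identical_rows[of i i']) (simp_all add: row_def)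
      with \<beta> show False ..
    qed
    then have a_inj: "inj_on a N"
      using b unfolding a_def by (metis bij_betw_def comp_inj_on inj_on_subset subset_UNIV)
    \<comment> \<open>The bound on the order of the multi-indices is that of the finitely many chosen rows.\<close>
    define K where "K = Max ((\<lambda>i. \<Sum>j\<in>UNIV. \<beta> i j) ` UNIV)"
    have "hol_on (\<lambda>x. det (\<chi> i j. cpartial j (\<lambda>y. \<phi> y (\<beta> i)) x)) (ball 0 R)"
      unfolding hol_on_def
    proof
      fix x :: "complex ^ 'n" assume x: "x \<in> ball 0 R"
      have "hol_at (\<lambda>x. cpartial j (\<lambda>y. \<phi> y \<alpha>) x) x" for j \<alpha>
      proof (rule hol_at_cong)
        show "hol_at (\<lambda>x. der (\<lambda>y. \<phi> y \<alpha>) x (axis j 1)) x" using h\<phi> x by (auto intro: hol)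
        show "\<forall>\<^sub>F x in nhds x. der (\<lambda>y. \<phi> y \<alpha>) x (axis j 1) = cpartial j (\<lambda>y. \<phi> y \<alpha>) x"
          using eventually_nhds_in_open[OF open_ball x]
          by eventually_elim (simp add: cpartial_eq_der[OF hol_at_imp_cdiff[OF h\<phi>]])
      qed
      then show "hol_at (\<lambda>x. det (\<chi> i j. cpartial j (\<lambda>y. \<phi> y (\<beta> i)) x)) x"
        by (intro hol_at_det) simp
    qed
    from identity_theorem_eventually[OF this] have "\<not> (\<forall>\<^sub>F x in nhds 0. det (\<chi> i j. cpartial j (\<lambda>y. \<phi> y (\<beta> i)) x) = 0)"
      using \<beta> y(1) by auto
    then have "generic_rank {\<alpha> :: 'n \<Rightarrow> nat. (\<Sum>i\<in>UNIV. \<alpha> i) \<le> K} \<phi> = CARD('n)"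
      unfolding generic_rank_eq_CARD_iff minor[symmetric]
      using a_inj b by (intro exI[of _ a] exI[of _ b]) (auto simp: N_def bij_betw_def a_def K_def)
    then show "class_C Q"
      unfolding class_C_def \<phi>_def by blast
  qed
qed

section \<open>The holomorphic inverse function theorem\<close>

lemma hol_at_der_vec:
  fixes F :: "'a::complex_normed_space \<Rightarrow> complex ^ 'n::finite"
  assumes "hol_at F x"
  shows "hol_at (\<lambda>y. der F y v) x"
proof (rule hol_at_vec)
  fix i
  have "\<forall>\<^sub>F y in nhds x. der (\<lambda>y. F y $ i) y v = der F y v $ i"
    using hol_at_eventually[OF assms] by eventually_elim (intro der_nth hol_at_imp_cdiff)
  then show "hol_at (\<lambda>y. der F y v $ i) x"
    by (rule hol_at_cong) (intro hol_at_der hol_at_nth assms)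
qed

lemma hol_at_der_Pair:
  assumes "hol_at F x" "hol_at G x" "hol_at (\<lambda>y. der F y v) x" "hol_at (\<lambda>y. der G y v) x"
  shows "hol_at (\<lambda>y. der (\<lambda>y. (F y, G y)) y v) x"
proof (rule hol_at_cong)
  show "\<forall>\<^sub>F y in nhds x. (der F y v, der G y v) = der (\<lambda>y. (F y, G y)) y v"
    using hol_at_eventually[OF assms(1)] hol_at_eventually[OF assms(2)]
    by eventually_elim (intro der_Pair[symmetric] hol_at_imp_cdiff)
qed (intro hol_at_Pair assms)

lemma linear_inj_left_right_inverse:
  fixes L :: "'a::euclidean_space \<Rightarrow> 'a"
  assumes "linear L" "\<And>v. L v = 0 \<Longrightarrow> v = 0"
  shows "\<exists>L'. linear L' \<and> (\<forall>v. L' (L v) = v) \<and> (\<forall>v. L (L' v) = v)"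
proof -
  have "inj L" using linear_injective_0[OF assms(1)] assms(2) by blast
  then show ?thesis using linear_injective_isomorphism[OF assms(1)] by blast
qed

text \<open>The real inverse function theorem; the inverse of a complex linear bijection is complex linear.  The
  second statement, that invertibility of the derivative is an open condition, comes with it and
  moves invertibility from a point to nearby points.\<close>

lemma holomorphic_inverse_function:
  fixes F :: "'a::{complex_normed_space,euclidean_space} \<Rightarrow> 'a"
  assumes "open S" "x0 \<in> S" and hF: "\<And>x. x \<in> S \<Longrightarrow> hol_at F x"
    and hD: "\<And>x v. x \<in> S \<Longrightarrow> hol_at (\<lambda>y. der F y v) x"
    and inj: "\<And>v. der F x0 v = 0 \<Longrightarrow> v = 0"
  shows "biholomorphic_near F x0 S"
    and "\<forall>\<^sub>F x in nhds x0. \<forall>v. der F x v = 0 \<longrightarrow> v = 0"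
proof -
  have cd: "cdiff F x" if "x \<in> S" for x using hF[OF that] hol_at_imp_cdiff by blast
  have bl: "bounded_linear (der F x)" if "x \<in> S" for x
    using der_linear[OF cd[OF that]] linear_conv_bounded_linear by blast
  have app: "blinfun_apply (Blinfun (der F x)) = der F x" if "x \<in> S" for x
    using bounded_linear_Blinfun_apply[OF bl[OF that]] .
  obtain L where L: "linear L" "\<And>v. L (der F x0 v) = v" "\<And>v. der F x0 (L v) = v"
    using linear_inj_left_right_inverse[OF der_linear[OF cd[OF assms(2)]] inj] by blast
  have 1: "(F has_derivative blinfun_apply (Blinfun (der F x))) (at x)" if "x \<in> S" for x
    using cdiff_has_derivative[OF cd[OF that]] app[OF that] by simp
  have 2: "continuous_on S (\<lambda>x. Blinfun (der F x))"
  proof (rule continuous_on_blinfun_componentwise)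
    fix i :: 'a
    have "continuous_on S (\<lambda>x. der F x i)"
      using hD hol_at_isCont by (intro continuous_at_imp_continuous_on) blast
    then show "continuous_on S (\<lambda>x. blinfun_apply (Blinfun (der F x)) i)"
      by (rule continuous_on_eq) (simp add: app)
  qed
  have 3: "Blinfun L o\<^sub>L Blinfun (der F x0) = id_blinfun"
    using L(1,2) linear_conv_bounded_linear[of L]
    by (intro blinfun_eqI) (simp add: app[OF assms(2)] bounded_linear_Blinfun_apply)
  obtain W V G G' where W: "open W" "W \<subseteq> S" "x0 \<in> W" "open V" "F x0 \<in> V" "homeomorphism W V F G"
    and dG: "\<And>y. y \<in> V \<Longrightarrow> (G has_derivative G' y) (at y)"
    and G': "\<And>y. y \<in> V \<Longrightarrow> G' y = inv (blinfun_apply (Blinfun (der F (G y))))"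
    and bij: "\<And>y. y \<in> V \<Longrightarrow> bij (blinfun_apply (Blinfun (der F (G y))))"
    using inverse_function_theorem[OF assms(1) 1 2 assms(2) 3] by blast
  have GW: "G y \<in> W" "F (G y) = y" if "y \<in> V" for y
    using W(6) that unfolding homeomorphism_def by auto
  have FW: "F x \<in> V" "G (F x) = x" if "x \<in> W" for x
    using W(6) that unfolding homeomorphism_def by auto
  have bij': "bij (der F x)" if "x \<in> W" for x
    using bij[OF FW(1)[OF that]] app[of x] FW(2)[OF that] W(2) that by auto
  show "\<forall>\<^sub>F x in nhds x0. \<forall>v. der F x v = 0 \<longrightarrow> v = 0"
    using eventually_nhds_in_open[OF W(1,3)]
  proof eventually_elim
    case (elim x)
    then have c: "cdiff F x" using cd W(2) by blast
    show ?case
      using bij'[OF elim] linear_injective_0[OF der_linear[OF c]] by (simp add: bij_def)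
  qed
  have "holomorphic_map_on (inv_into W F) V"
    unfolding holomorphic_map_on_def
  proof
    fix y assume y: "y \<in> V"
    have inj_F: "inj_on F W" using FW(2) by (metis inj_onI)
    have "inv_into W F y' = G y'" if "y' \<in> V" for y'
      using inv_into_f_eq[OF inj_F GW(1)[OF that] GW(2)[OF that]] .
    then have d: "(inv_into W F has_derivative G' y) (at y)"
      using has_derivative_transform_within_open[OF dG[OF y] W(4) y] by simp
    have x: "G y \<in> S" using GW(1)[OF y] W(2) by blast
    have "G' y = inv (der F (G y))" using G'[OF y] app[OF x] by simp
    moreover have "inv (der F (G y)) (cscale c v) = cscale c (inv (der F (G y)) v)" for c v
    proof (rule inv_f_eq)
      show "inj (der F (G y))" using bij'[OF GW(1)[OF y]] by (simp add: bij_def)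
      show "der F (G y) (cscale c (inv (der F (G y)) v)) = cscale c v"
        using bij'[OF GW(1)[OF y]] by (simp add: der_cscale[OF cd[OF x]] bij_def surj_f_inv_f)
    qed
    ultimately show "\<exists>D. (inv_into W F has_derivative D) (at y) \<and> (\<forall>c v. D (cscale c v) = cscale c (D v))"
      using d by metis
  qed
  moreover have "holomorphic_map_on F W"
    unfolding holomorphic_map_on_def using cd[unfolded cdiff_def] W(2) by blast
  moreover have "bij_betw F W V"
    by (rule bij_betwI[where g = G]) (use GW FW in auto)
  ultimately show "biholomorphic_near F x0 S"
    unfolding biholomorphic_near_def using W by blast
qed

section \<open>Complex conjugation\<close>

lemma cnj_vec_nth [simp]: "cnj_vec z $ i = cnj (z $ i)"
  by (simp add: cnj_vec_def)

lemma cnj_vec_cnj_vec [simp]: "cnj_vec (cnj_vec z) = z"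
  by (simp add: vec_eq_iff)

lemma cnj_vec_0 [simp]: "cnj_vec 0 = 0"
  by (simp add: vec_eq_iff)

lemma cnj_vec_eq_0_iff [simp]: "cnj_vec z = 0 \<longleftrightarrow> z = 0"
  by (simp add: vec_eq_iff)

lemma norm_cnj_vec [simp]: "norm (cnj_vec z) = norm z"
  by (simp add: norm_vec_def L2_set_def)

lemma cnj_vec_cscale [simp]: "cnj_vec (cscale c z) = cscale (cnj c) (cnj_vec z)"
  by (simp add: vec_eq_iff)

lemma bounded_linear_cnj_vec: "bounded_linear cnj_vec"
  by (rule bounded_linear_intro[where K = 1]) (simp_all add: vec_eq_iff)

lemma has_derivative_conjugate:
  assumes "bounded_linear c" "bounded_linear d" "cdiff F (c x)"
  shows "((\<lambda>y. d (F (c y))) has_derivative (\<lambda>v. d (der F (c x) (c v)))) (at x)"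
  using bounded_linear.has_derivative[OF assms(2)
      has_derivative_compose[OF bounded_linear_imp_has_derivative[OF assms(1)] cdiff_has_derivative[OF assms(3)]]]
  by simp

lemma hol_at_conj_fun:
  assumes "hol_at Q 0"
  shows "hol_at (conj_fun Q) 0"
proof -
  define c where "c p = (cnj_vec (fst p), cnj_vec (fst (snd p)), cnj (snd (snd p)))"
    for p :: "(complex ^ 'a) \<times> (complex ^ 'a) \<times> complex"
  have bl: "bounded_linear c"
    unfolding c_def
    by (intro bounded_linear_Pair bounded_linear_compose[OF bounded_linear_cnj_vec]
        bounded_linear_compose[OF bounded_linear_cnj] bounded_linear_intros)
  have c: "c (cscale s v) = cscale (cnj s) (c v)" for s v
    by (simp add: c_def)
  have eq: "conj_fun Q = (\<lambda>p. cnj (Q (c p)))"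
    by (auto simp: conj_fun_def c_def)
  have lim: "filterlim c (nhds 0) (nhds 0)"
    using filterlim_isCont[OF linear_continuous_at[OF bl], of 0] linear_0[OF bounded_linear.linear[OF bl]] by simp
  show ?thesis
    unfolding hol_at_def
    using eventually_compose_filterlim[OF assms[unfolded hol_at_def] lim]
  proof eventually_elim
    case (elim p)
    show ?case
      unfolding eq
      by (rule cdiffI[OF has_derivative_conjugate[OF bl bounded_linear_cnj elim]])
        (simp add: c der_cscale[OF elim])
  qed
qed

lemma nondegenerate_conj:
  fixes q :: "(complex ^ 'n::finite) \<times> (complex ^ 'm::finite) \<Rightarrow> complex"
  assumes hq: "hol_at q 0" and nd: "nondegenerate q"
  shows "nondegenerate (\<lambda>p. cnj (q (cnj_vec (fst p), cnj_vec (snd p))))"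
proof -
  define c where "c p = (cnj_vec (fst p), cnj_vec (snd p))" for p :: "(complex ^ 'n) \<times> (complex ^ 'm)"
  have bl: "bounded_linear c"
    unfolding c_def
    by (intro bounded_linear_Pair bounded_linear_compose[OF bounded_linear_cnj_vec] bounded_linear_intros)
  obtain R where R: "R > 0" "\<And>z y. norm z < R \<Longrightarrow> norm y < R \<Longrightarrow> hol_at q (z, y)"
    using hol_at_eventually[OF hq] by (rule eventually_nhds_0_prodE) (rule that)
  show ?thesis
    unfolding nondegenerate_def
  proof (intro allI impI)
    fix r :: real assume "r > 0"
    define s where "s = min r R"
    have s: "s > 0" "s \<le> r" "s \<le> R" using \<open>r > 0\<close> R(1) by (auto simp: s_def)
    obtain y where y: "norm y < s" "param_immersive q s y"
      using nd s(1) unfolding nondegenerate_def by blast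
    have "param_immersive (\<lambda>p. cnj (q (c p))) s (cnj_vec y)"
      unfolding param_immersive_def
    proof (intro allI impI)
      fix u assume u: "\<forall>z. norm z < s \<longrightarrow> der (\<lambda>p. cnj (q (c p))) (z, cnj_vec y) (0, u) = 0"
      have "der q (z, y) (0, cnj_vec u) = 0" if z: "norm z < s" for z
      proof -
        have cd: "cdiff q (c (cnj_vec z, cnj_vec y))"
          using R(2)[of z y] z y(1) s(3) by (simp add: c_def hol_at_imp_cdiff)
        have "cnj (der q (z, y) (0, cnj_vec u)) = der (\<lambda>p. cnj (q (c p))) (cnj_vec z, cnj_vec y) (0, u)"
          using der_eqI[OF has_derivative_conjugate[OF bl bounded_linear_cnj cd]] by (simp add: c_def)
        also have "\<dots> = 0" using u z by simp
        finally show ?thesis by simp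
      qed
      then have "cnj_vec u = 0" using y(2) unfolding param_immersive_def by blast
      then show "u = 0" by simp
    qed
    then have "param_immersive (\<lambda>p. cnj (q (c p))) r (cnj_vec y)" using param_immersive_mono s(2) by blast
    then show "\<exists>y. norm y < r \<and> param_immersive (\<lambda>p. cnj (q (cnj_vec (fst p), cnj_vec (snd p)))) r y"
      using y(1) s(2) unfolding c_def by (intro exI[of _ "cnj_vec y"]) simp
  qed
qed

section \<open>Generic immersions\<close>

lemma Pair_0_0 [simp]: "(0, 0) = 0"
  by (simp add: zero_prod_def)

text \<open>For maps between spaces of the same dimension this means that the Jacobian determinant is not identically
  \<open>0\<close> near \<open>0\<close> (\<open>generically_immersive_imp_det\<close>).\<close>

definition generically_immersive ::
    "('a::complex_normed_space \<Rightarrow> 'b::complex_normed_space) \<Rightarrow> bool" where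
  "generically_immersive F \<longleftrightarrow> (\<exists>\<^sub>F x in nhds 0. \<forall>v. der F x v = 0 \<longrightarrow> v = 0)"

text \<open>The derivative of the reparametrized family along \<open>v\<close> is that of \<open>q\<close> along \<open>D\<phi> v\<close>.  If it separates, then
  \<open>D\<phi>\<close> is injective, hence bijective, and every direction of the parameter of \<open>q\<close> is seen.\<close>

lemma nondegenerate_reparametrized:
  fixes q :: "'a::complex_normed_space \<times> 'e::{complex_normed_space,euclidean_space} \<Rightarrow> complex"
    and \<phi> :: "'e \<Rightarrow> 'e"
  assumes hq: "hol_at q 0" and h\<phi>: "hol_at \<phi> 0" "\<phi> 0 = 0"
    and nd: "nondegenerate (\<lambda>p. q (fst p, \<phi> (snd p)))"
  shows "nondegenerate q" and "generically_immersive \<phi>"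
proof -
  define \<Theta> where "\<Theta> p = (fst p, \<phi> (snd p))" for p :: "'a \<times> 'e"
  have \<Theta>: "hol_at \<Theta> 0" "\<Theta> 0 = 0"
    unfolding \<Theta>_def by (intro hol hol_at_of_snd h\<phi>) (simp add: h\<phi>)
  have main: "\<exists>y. norm y < r \<and> norm (\<phi> y) < r \<and> param_immersive q r (\<phi> y) \<and> (\<forall>v. der \<phi> y v = 0 \<longrightarrow> v = 0)"
    if r: "r > 0" for r
  proof -
    have "\<forall>\<^sub>F p :: 'a \<times> 'e in nhds 0. hol_at \<phi> (snd p) \<and> hol_at q (\<Theta> p) \<and> \<Theta> p \<in> ball 0 r"
      using eventually_snd[OF hol_at_eventually[OF h\<phi>(1)]]
        eventually_hol_compose_0[OF \<Theta> hol_at_eventually[OF hq]]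
        eventually_hol_compose_0[OF \<Theta> eventually_nhds_in_open[OF open_ball centre_in_ball[THEN iffD2, OF r]]]
      by eventually_elim simp
    then obtain s where s: "s > 0" "\<And>z y. norm z < s \<Longrightarrow> norm y < s \<Longrightarrow>
        hol_at \<phi> y \<and> hol_at q (z, \<phi> y) \<and> norm (z, \<phi> y) < r"
      by (rule eventually_nhds_0_prodE) (auto simp: \<Theta>_def that)
    define t where "t = min r s"
    have t: "t > 0" "t \<le> r" "t \<le> s" using r s(1) by (auto simp: t_def)
    obtain y where y: "norm y < t" "param_immersive (\<lambda>p. q (fst p, \<phi> (snd p))) t y"
      using nd t(1) unfolding nondegenerate_def by blast
    have in_s: "hol_at \<phi> y" "hol_at q (z, \<phi> y)" "norm (z, \<phi> y) < r" if "norm z < t" for z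
      using s(2)[of z y] that y(1) t by auto
    have c\<phi>: "cdiff \<phi> y" using in_s(1)[of 0] t(1) hol_at_imp_cdiff by simp
    have chain: "der (\<lambda>p. q (fst p, \<phi> (snd p))) (z, y) (0, v) = der q (z, \<phi> y) (0, der \<phi> y v)"
      if "norm z < t" for z v
      by (rule der_reparametrized[OF c\<phi> hol_at_imp_cdiff[OF in_s(2)[OF that]]])
    have inj: "v = 0" if v: "der \<phi> y v = 0" for v
    proof -
      have "der (\<lambda>p. q (fst p, \<phi> (snd p))) (z, y) (0, v) = 0" if "norm z < t" for z
        using der_0[OF hol_at_imp_cdiff[OF in_s(2)[OF that]]] by (simp add: chain[OF that] v)
      then show ?thesis using y(2) unfolding param_immersive_def by blast
    qed
    obtain L where L: "\<And>v. der \<phi> y (L v) = v"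
      using linear_inj_left_right_inverse[OF der_linear[OF c\<phi>] inj] by blast
    have "param_immersive q t (\<phi> y)"
      unfolding param_immersive_def
    proof (intro allI impI)
      fix u assume u: "\<forall>z. norm z < t \<longrightarrow> der q (z, \<phi> y) (0, u) = 0"
      have "der (\<lambda>p. q (fst p, \<phi> (snd p))) (z, y) (0, L u) = 0" if "norm z < t" for z
        using u that by (simp add: chain[OF that] L)
      then have "L u = 0" using y(2) unfolding param_immersive_def by blast
      then show "u = 0" using L[of u] der_0[OF c\<phi>] by simp
    qed
    then have "param_immersive q r (\<phi> y)" using param_immersive_mono t(2) by blast
    moreover have "norm (\<phi> y) < r" using in_s(3)[of 0] t(1) by simp
    ultimately show ?thesis using y(1) t(2) inj by (intro exI[of _ y]) auto
  qed
  show "nondegenerate q" unfolding nondegenerate_def using main by blast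
  show "generically_immersive \<phi>"
    unfolding generically_immersive_def frequently_def eventually_nhds_ball
    using main by (metis mem_ball_0)
qed

abbreviation jacobian :: "(complex ^ 'n::finite \<Rightarrow> complex ^ 'm::finite) \<Rightarrow> complex ^ 'n \<Rightarrow> complex ^ 'n ^ 'm" where
  "jacobian F z \<equiv> (\<chi> i j. der F z (axis j 1) $ i)"

lemma der_eq_jacobian_mult:
  fixes F :: "complex ^ 'n::finite \<Rightarrow> complex ^ 'm::finite"
  assumes "cdiff F z"
  shows "der F z u = jacobian F z *v u"
proof -
  have "u = (\<Sum>j\<in>UNIV. cscale (u $ j) (axis j 1))"
    by (simp add: vec_eq_iff axis_def if_distrib[of "\<lambda>x. _ * x"] cong: if_cong)
  then have "der F z u = (\<Sum>j\<in>UNIV. cscale (u $ j) (der F z (axis j 1)))"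
    using linear_sum[OF der_linear[OF assms], of "\<lambda>j. cscale (u $ j) (axis j 1)" UNIV]
    by (simp add: der_cscale[OF assms])
  then show ?thesis by (simp add: vec_eq_iff matrix_vector_mult_def mult.commute)
qed

lemma cjacobian_eq_jacobian: "cdiff F z \<Longrightarrow> cjacobian F z = jacobian F z"
  unfolding cjacobian_def
  by (simp add: vec_eq_iff cpartial_eq_der[OF cdiff_nth] der_nth)

lemma det_jacobian_nonzero_iff:
  fixes F :: "complex ^ 'n::finite \<Rightarrow> complex ^ 'n"
  assumes "cdiff F z"
  shows "det (jacobian F z) \<noteq> 0 \<longleftrightarrow> (\<forall>u. der F z u = 0 \<longrightarrow> u = 0)"
proof -
  have "det (jacobian F z) \<noteq> 0 \<longleftrightarrow> (\<forall>u. jacobian F z *v u = 0 \<longrightarrow> u = 0)"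
    unfolding invertible_det_nz[symmetric] invertible_left_inverse matrix_left_invertible_ker ..
  then show ?thesis unfolding der_eq_jacobian_mult[OF assms, symmetric] .
qed

lemma generically_immersive_imp_det:
  fixes F :: "complex ^ 'n::finite \<Rightarrow> complex ^ 'n"
  assumes "hol_at F 0" "generically_immersive F"
  shows "\<not> (\<forall>\<^sub>F z in nhds 0. det (jacobian F z) = 0)"
proof -
  have "\<exists>\<^sub>F z in nhds 0. det (jacobian F z) \<noteq> 0"
    using assms(2) unfolding generically_immersive_def
    by (rule frequently_rev_mp)
      (use hol_at_eventually[OF assms(1)] in eventually_elim, use det_jacobian_nonzero_iff hol_at_imp_cdiff in blast)
  then show ?thesis by (simp add: frequently_def)
qed

text \<open>Cramer's rule without division: the column of determinants is \<open>det\<close> times the solution of \<open>D F u = b\<close>, and it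
  depends holomorphically on the point also where \<open>det\<close> vanishes.\<close>

lemma der_adjugate_column:
  fixes F :: "complex ^ 'n::finite \<Rightarrow> complex ^ 'n"
  assumes "cdiff F z" "det (jacobian F z) \<noteq> 0"
  shows "der F z (\<chi> k. det (\<chi> i j. if j = k then b $ i else jacobian F z $ i $ j)) = cscale (det (jacobian F z)) b"
proof -
  define x where "x = (\<chi> k. det (\<chi> i j. if j = k then b $ i else jacobian F z $ i $ j) / det (jacobian F z))"
  have "jacobian F z *v x = b"
    using cramer[OF assms(2), of x b] unfolding x_def by simp
  moreover have "(\<chi> k. det (\<chi> i j. if j = k then b $ i else jacobian F z $ i $ j)) = cscale (det (jacobian F z)) x"
    using assms(2) by (simp add: x_def vec_eq_iff)
  ultimately show ?thesis
    using der_eq_jacobian_mult[OF assms(1), of x] by (simp add: der_cscale[OF assms(1)])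
qed

lemma der_eq_if_slice_eq:
  fixes \<psi> :: "'x::complex_normed_space \<times> 'y::complex_normed_space \<Rightarrow> 'z::complex_normed_space"
  assumes "hol_at \<psi> 0" "\<forall>\<^sub>F y in nhds 0. \<psi> (0, y) = \<phi> y"
  shows "\<forall>\<^sub>F y in nhds 0. \<forall>u. der \<psi> (0, y) (0, u) = der \<phi> y u"
proof -
  have "\<forall>\<^sub>F y in nhds 0. hol_at \<psi> (0, y)"
    by (rule eventually_slice_first[OF hol_at_eventually[OF assms(1)]])
  moreover have "\<forall>\<^sub>F y in nhds 0. \<forall>\<^sub>F y in nhds y. \<psi> (0, y) = \<phi> y"
    using assms(2) by (simp add: eventually_eventually)
  ultimately show ?thesis
  proof eventually_elim
    case (elim y)
    note c\<psi> = hol_at_imp_cdiff[OF elim(1)]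
    show ?case
      using der_cong[OF elim(2) der_slice_first(1)[OF c\<psi>]] der_slice_first(2)[OF c\<psi>] by simp
  qed
qed

section \<open>Segre preserving maps in normal coordinates\<close>

lemma der_in_first_normal_coordinate:
  fixes Q :: "'a::complex_normed_space \<times> 'a \<times> complex \<Rightarrow> complex"
  assumes "hol_at Q 0" "\<forall>\<^sub>F \<zeta> in nhds 0. Q (0, \<zeta>) = snd \<zeta>"
  shows "\<forall>\<^sub>F \<zeta> in nhds 0. \<forall>v. der Q (0, \<zeta>) (0, v) = snd v"
proof -
  have "\<forall>\<^sub>F \<zeta> in nhds 0. hol_at Q (0, \<zeta>)"
    by (rule eventually_slice_first[OF hol_at_eventually[OF assms(1)]])
  moreover have "\<forall>\<^sub>F \<zeta> in nhds 0. \<forall>\<^sub>F \<zeta> in nhds \<zeta>. Q (0, \<zeta>) = snd \<zeta>"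
    using assms(2) by (simp add: eventually_eventually)
  ultimately show ?thesis
  proof eventually_elim
    case (elim \<zeta>)
    note cQ = hol_at_imp_cdiff[OF elim(1)]
    have "der (\<lambda>\<zeta>. Q (0, \<zeta>)) \<zeta> = der snd \<zeta>"
      using der_cong[OF elim(2) der_slice_first(1)[OF cQ]] by simp
    then show ?case
      by (simp add: der_slice_first(2)[OF cQ, symmetric] der_bounded_linear bounded_linear_snd)
  qed
qed

lemma der_in_second_normal_coordinate:
  fixes Q :: "'a::complex_normed_space \<times> 'a \<times> complex \<Rightarrow> complex"
  assumes "hol_at Q 0" "\<forall>\<^sub>F p in nhds 0. Q (fst p, 0, snd p) = snd p"
  shows "\<forall>\<^sub>F z in nhds 0. \<forall>u. der Q (z, 0, 0) (u, 0, 0) = 0"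
proof -
  have "\<forall>\<^sub>F z in nhds 0. hol_at Q (z, 0, 0)"
    using eventually_slice_second[OF hol_at_eventually[OF assms(1)]] by simp
  moreover have "\<forall>\<^sub>F z in nhds 0. Q (z, 0, 0) = 0"
    using eventually_slice_second[OF assms(2)] by simp
  then have "\<forall>\<^sub>F z in nhds 0. 0 = Q (z, 0, 0)"
    by eventually_elim simp
  then have "\<forall>\<^sub>F z in nhds 0. \<forall>\<^sub>F z in nhds z. 0 = Q (z, 0, 0)"
    by (simp only: eventually_eventually)
  ultimately show ?thesis
  proof eventually_elim
    case (elim z)
    note cQ = hol_at_imp_cdiff[OF elim(1)]
    show ?case
      using fun_cong[OF der_cong[OF elim(2) cdiff_const]] der_slice_second(2)[OF cQ] by simp
  qed
qed

text \<open>Here \<open>\<tau> = P(\<chi>,z,w)\<close> is \<open>w = Q(z,\<chi>,\<tau>)\<close> solved for \<open>\<tau>\<close>.  The situation is symmetric under exchanging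
  \<open>(z,w)\<close> with \<open>(\<chi>,\<tau>)\<close>, \<open>Q\<close> with \<open>P\<close>, \<open>Q'\<close> with its counterpart, and \<open>(f,g)\<close> with \<open>(ft,gt)\<close>; the locale collects what is needed for
  one half of the arguments, so that interpreting it twice yields both halves.\<close>

locale half_segre_map =
  fixes Q P Q' :: "(complex ^ 'n::finite) \<times> (complex ^ 'n) \<times> complex \<Rightarrow> complex"
    and f ft :: "(complex ^ 'n) \<times> complex \<Rightarrow> complex ^ 'n"
    and g gt :: "(complex ^ 'n) \<times> complex \<Rightarrow> complex"
  assumes hQ: "hol_at Q 0" and hP: "hol_at P 0" and hQ': "hol_at Q' 0"
    and hf: "hol_at f 0" and hg: "hol_at g 0" and hft: "hol_at ft 0" and hgt: "hol_at gt 0"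
    and zero: "f 0 = 0" "g 0 = 0" "ft 0 = 0" "gt 0 = 0"
    and Q_first: "\<forall>\<^sub>F \<zeta> in nhds 0. Q (0, \<zeta>) = snd \<zeta>"
    and Q_second: "\<forall>\<^sub>F p in nhds 0. Q (fst p, 0, snd p) = snd p"
    and Q'_first: "\<forall>\<^sub>F \<zeta> in nhds 0. Q' (0, \<zeta>) = snd \<zeta>"
    and Q'_second: "\<forall>\<^sub>F p in nhds 0. Q' (fst p, 0, snd p) = snd p"
    and P_second: "\<forall>\<^sub>F p in nhds 0. P (fst p, 0, snd p) = snd p"
    and QP: "\<forall>\<^sub>F p in nhds 0. Q (fst p, fst (snd p), P (fst (snd p), fst p, snd (snd p))) = snd (snd p)"
    and eqn: "\<forall>\<^sub>F p in nhds 0. g (fst p, Q p) = Q' (f (fst p, Q p), ft (snd p), gt (snd p))"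
    and nd: "nondegenerate (\<lambda>p. Q (fst p, snd p, 0))"
begin

definition q where "q p = Q (fst p, snd p, 0)"

definition k where "k p = Q' (fst p, ft (snd p, 0), 0)"

lemma Q_0: "Q 0 = 0" and Q'_0: "Q' 0 = 0" and P_0: "P 0 = 0"
  using eventually_nhds_x_imp_x[OF Q_first] eventually_nhds_x_imp_x[OF Q'_first]
    eventually_nhds_x_imp_x[OF P_second] by simp_all

lemma hol_q: "hol_at q 0"
  unfolding q_def by (rule hol_at_slice_third[OF hQ])

lemma q_0: "q 0 = 0"
  by (simp add: q_def Q_0)

lemma q_zero_first: "\<forall>\<^sub>F y in nhds 0. q (0, y) = 0"
  using eventually_slice_second[OF Q_first] by (simp add: q_def)

lemma q_zero_second: "\<forall>\<^sub>F z in nhds 0. q (z, 0) = 0"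
  using eventually_slice_second[OF Q_second] by (simp add: q_def)

lemma hol_ft_slice: "hol_at (\<lambda>y. ft (y, 0)) 0"
  by (rule hol_at_slice_second[OF hft])

lemma hol_k: "hol_at k 0"
  unfolding k_def
  by (intro hol_at_compose_0[OF hQ'] hol hol_at_of_snd[OF hol_ft_slice]) (simp add: zero)

lemma gt_zero: "\<forall>\<^sub>F y in nhds 0. gt (y, 0) = 0"
proof -
  have 1: "hol_at (\<lambda>y. (ft (y, 0), gt (y, 0))) 0" by (intro hol hol_ft_slice hol_at_slice_second[OF hgt])
  have 2: "(\<lambda>y. (ft (y, 0), gt (y, 0))) 0 = 0" by (simp add: zero)
  show ?thesis
    using eventually_slice_first[OF eventually_slice_third[OF eqn]] q_zero_first
      eventually_hol_compose_0[OF 1 2 Q'_first]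
    by eventually_elim (simp add: q_def zero)
qed

lemma g_on_Segre_varieties: "\<forall>\<^sub>F p in nhds 0. g (fst p, q p) = k (f (fst p, q p), snd p)"
  using eventually_slice_third[OF eqn] eventually_snd[OF gt_zero]
  by eventually_elim (simp add: q_def k_def)

text \<open>If \<open>k\<close> did not separate parameters, \<open>g(z,w) = k(f(z,w),\<chi>)\<close> would hold identically, and for \<open>\<chi> = 0\<close> the
  right-hand side is \<open>Q'(f(z,w),0,0) = 0\<close>.\<close>

lemma nondegenerate_k:
  assumes "\<not> (\<forall>\<^sub>F Z in nhds 0. g Z = 0)"
  shows "nondegenerate k"
proof (rule ccontr)
  assume deg: "\<not> nondegenerate k"
  have nd_q: "nondegenerate q" using nd by (simp add: q_def[abs_def])
  have ext: "\<forall>\<^sub>F p in nhds 0. g (fst p, fst (snd p)) = k (f (fst p, fst (snd p)), snd (snd p))"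
    by (rule extend_off_the_graph[OF hol_q q_0 hol_k hf zero(1) hg g_on_Segre_varieties nd_q deg])
  have 1: "hol_at (\<lambda>Z. (f Z, 0 :: complex)) 0" by (intro hol hf)
  have 2: "(\<lambda>Z. (f Z, 0 :: complex)) 0 = 0" by (simp add: zero)
  have "\<forall>\<^sub>F Z in nhds 0. g Z = 0"
    using eventually_slice_third[OF ext] eventually_hol_compose_0[OF 1 2 Q'_second]
    by eventually_elim (simp add: k_def zero)
  with assms show False ..
qed

lemma nondegenerate_k_imp:
  assumes "nondegenerate k"
  shows "nondegenerate (\<lambda>p. Q' (fst p, snd p, 0))" and "generically_immersive (\<lambda>y. ft (y, 0))"
proof -
  have h: "hol_at (\<lambda>p. Q' (fst p, snd p, 0)) 0" by (rule hol_at_slice_third[OF hQ'])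
  have "nondegenerate (\<lambda>p. (\<lambda>p. Q' (fst p, snd p, 0)) (fst p, (\<lambda>y. ft (y, 0)) (snd p)))"
    using assms by (simp add: k_def[abs_def])
  from nondegenerate_reparametrized[OF h hol_ft_slice _ this]
  show "nondegenerate (\<lambda>p. Q' (fst p, snd p, 0))" and "generically_immersive (\<lambda>y. ft (y, 0))"
    by (simp_all add: zero)
qed

text \<open>For fixed \<open>(z,w)\<close> the points \<open>(\<chi>,P(\<chi>,z,w))\<close> form a Segre variety, along which
  \<open>g(z,w) = Q'(f(z,w),ft(\<chi>,\<tau>),0)\<close> is constant.  By generic immersivity \<open>ft\<close> maps it onto an open set, so
  \<open>g(z,w) = Q'(f(z,w),\<chi>',0)\<close> for all \<open>\<chi>'\<close>, in particular for \<open>\<chi>' = 0\<close>.\<close>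

lemma g_vanishes_if_gt_vanishes:
  assumes imm: "generically_immersive (\<lambda>y. ft (y, 0))" and gt0: "\<forall>\<^sub>F \<zeta> in nhds 0. gt \<zeta> = 0"
  shows "\<forall>\<^sub>F Z in nhds 0. g Z = 0"
proof -
  define W where "W p = (snd p, P (snd p, fst p))" for p :: "((complex ^ 'n) \<times> complex) \<times> (complex ^ 'n)"
  define \<psi> where "\<psi> p = ft (W p)" for p
  define G where "G p = g (fst p) - Q' (f (fst p), snd p, 0)"
    for p :: "((complex ^ 'n) \<times> complex) \<times> (complex ^ 'n)"
  have PW: "hol_at (\<lambda>p :: ((complex ^ 'n) \<times> complex) \<times> (complex ^ 'n). P (snd p, fst p)) 0"
    by (rule hol_at_compose_0[OF hP]) (intro hol, simp)
  have W: "hol_at W 0" "W 0 = 0" unfolding W_def by (intro hol PW) (simp add: P_0)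
  have \<psi>: "hol_at \<psi> 0" "\<psi> 0 = 0"
    unfolding \<psi>_def by (rule hol_at_compose_0[OF hft W]) (simp add: W zero)
  have "hol_at (\<lambda>p :: ((complex ^ 'n) \<times> complex) \<times> (complex ^ 'n). Q' (f (fst p), snd p, 0)) 0"
    by (rule hol_at_compose_0[OF hQ']) (intro hol hol_at_of_fst[OF hf], simp add: zero)
  then have hG: "hol_at G 0" unfolding G_def by (intro hol hol_at_of_fst[OF hg])
  have vanish: "\<forall>\<^sub>F p in nhds 0. G (fst p, \<psi> p) = 0"
  proof -
    define S where "S p = (fst (fst p), W p)" for p
    define T where "T p = (fst (fst p), snd p, snd (fst p))"
      for p :: "((complex ^ 'n) \<times> complex) \<times> (complex ^ 'n)"
    have S: "hol_at S 0" "S 0 = 0" unfolding S_def by (intro hol W) (simp add: W)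
    have T: "hol_at T 0" "T 0 = 0" unfolding T_def by (intro hol) simp
    show ?thesis
      using eventually_hol_compose_0[OF S eqn] eventually_hol_compose_0[OF T QP]
        eventually_hol_compose_0[OF W gt0]
      by eventually_elim (simp add: S_def T_def W_def \<psi>_def G_def)
  qed
  have slice: "\<forall>\<^sub>F y in nhds 0. \<psi> (0, y) = ft (y, 0)"
    using eventually_slice_second[OF P_second] by eventually_elim (simp add: \<psi>_def W_def)
  have "\<exists>\<^sub>F y in nhds 0. \<forall>u. der \<psi> (0, y) (0, u) = 0 \<longrightarrow> u = 0"
    using imm unfolding generically_immersive_def
    by (rule frequently_rev_mp) (use der_eq_if_slice_eq[OF \<psi>(1) slice] in eventually_elim, simp)
  from zero_if_zero_on_open_family[OF \<psi> hG vanish this] have G0: "\<forall>\<^sub>F p in nhds 0. G p = 0" .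
  have 1: "hol_at (\<lambda>Z. (f Z, 0 :: complex)) 0" by (intro hol hf)
  have 2: "(\<lambda>Z. (f Z, 0 :: complex)) 0 = 0" by (simp add: zero)
  show ?thesis
    using eventually_slice_second[OF G0] eventually_hol_compose_0[OF 1 2 Q'_second]
    by eventually_elim (simp add: G_def)
qed

text \<open>Already the points \<open>(\<chi>,0)\<close> suffice: a parameter direction \<open>(u,s)\<close> is seen at \<open>z = 0\<close> if \<open>s \<noteq> 0\<close>, since
  \<open>Q(0,\<chi>,\<tau>) = \<tau>\<close>, and through \<open>q\<close> if \<open>s = 0\<close>.\<close>

lemma nondegenerate_Q: "nondegenerate Q"
  unfolding nondegenerate_def
proof (intro allI impI)
  fix r :: real assume "r > 0"
  obtain R1 where R1: "R1 > 0" "\<And>z y. norm z < R1 \<Longrightarrow> norm y < R1 \<Longrightarrow> hol_at Q (z, y)"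
    using hol_at_eventually[OF hQ] by (rule eventually_nhds_0_prodE) (rule that)
  obtain R2 where R2: "R2 > 0" "\<And>\<zeta>. norm \<zeta> < R2 \<Longrightarrow> \<forall>v. der Q (0, \<zeta>) (0, v) = snd v"
    using der_in_first_normal_coordinate[OF hQ Q_first] unfolding eventually_nhds_ball by (auto simp: mem_ball_0)
  define s where "s = min r (min R1 R2)"
  have s: "s > 0" "s \<le> r" "s \<le> R1" "s \<le> R2" using \<open>r > 0\<close> R1(1) R2(1) by (auto simp: s_def)
  obtain y where y: "norm y < s" "param_immersive q s y"
    using nd s(1) unfolding nondegenerate_def q_def[abs_def] by blast
  have "param_immersive Q s (y, 0)"
    unfolding param_immersive_def
  proof (intro allI impI)
    fix v :: "(complex ^ 'n) \<times> complex" assume v: "\<forall>z. norm z < s \<longrightarrow> der Q (z, y, 0) (0, v) = 0"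
    have "snd v = 0" using v[rule_format, of 0] R2(2)[of "(y, 0)"] y(1) s by simp
    have "der q (z, y) (0, fst v) = 0" if z: "norm z < s" for z
    proof -
      have c: "cdiff (\<lambda>p :: (complex ^ 'n) \<times> (complex ^ 'n). (fst p, snd p, 0 :: complex)) (z, y)"
        by (intro cdiff_Pair cdiff_fst cdiff_snd cdiff_ident cdiff_const)
      have cQ: "cdiff Q ((\<lambda>p :: (complex ^ 'n) \<times> (complex ^ 'n). (fst p, snd p, 0 :: complex)) (z, y))"
        using R1(2)[of z "(y, 0)"] z y(1) s hol_at_imp_cdiff by simp
      have "der (\<lambda>p :: (complex ^ 'n) \<times> (complex ^ 'n). (fst p, snd p, 0 :: complex)) (z, y) (0, fst v) = (0, fst v, 0)"
        by (subst der_bounded_linear) (intro bounded_linear_intros, simp)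
      then have "der q (z, y) (0, fst v) = der Q (z, y, 0) (0, fst v, 0)"
        using der_compose[OF c cQ, of "(0, fst v)"] by (simp add: q_def[abs_def])
      also have "\<dots> = 0" using v z \<open>snd v = 0\<close> by (cases v) simp
      finally show ?thesis .
    qed
    then have "fst v = 0" using y(2) unfolding param_immersive_def by blast
    with \<open>snd v = 0\<close> show "v = 0" by (cases v) simp
  qed
  then have "param_immersive Q r (y, 0)" using param_immersive_mono s(2) by blast
  then show "\<exists>y. norm y < r \<and> param_immersive Q r y"
    using y(1) s(2) by (intro exI[of _ "(y, 0)"]) simp
qed

text \<open>The dichotomy with parameter \<open>(\<chi>,\<tau>)\<close> and the family \<open>Q'(z',ft(\<chi>,\<tau>),0)\<close>, which is degenerate at every
  parameter because \<open>ft\<close> lowers the dimension.\<close>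

lemma null_case:
  assumes g0: "\<forall>\<^sub>F Z in nhds 0. g Z = 0" and gt0: "\<forall>\<^sub>F \<zeta> in nhds 0. gt \<zeta> = 0"
  shows "\<forall>\<^sub>F p in nhds 0. Q' (f (fst p), ft (snd p), 0) = 0"
proof -
  define K where "K p = Q' (fst p, ft (snd p), 0)" for p :: "(complex ^ 'n) \<times> (complex ^ 'n) \<times> complex"
  have hK: "hol_at K 0"
    unfolding K_def by (rule hol_at_compose_0[OF hQ']) (intro hol hol_at_of_snd[OF hft], simp add: zero)
  have Z: "hol_at (\<lambda>p. (fst p, Q p)) 0" "(\<lambda>p. (fst p, Q p)) 0 = 0"
    by (intro hol hQ) (simp add: Q_0)
  have eq: "\<forall>\<^sub>F p in nhds 0. 0 = K (f (fst p, Q p), snd p)"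
    using eqn eventually_hol_compose_0[OF Z g0]
      eventually_snd[OF gt0]
    by eventually_elim (simp add: K_def)
  have deg: "\<not> nondegenerate K"
  proof
    assume "nondegenerate K"
    have "\<forall>\<^sub>F p :: (complex ^ 'n) \<times> (complex ^ 'n) \<times> complex in nhds 0.
        hol_at ft (snd p) \<and> hol_at Q' (fst p, ft (snd p), 0)"
    proof -
      have "hol_at (\<lambda>p :: (complex ^ 'n) \<times> (complex ^ 'n) \<times> complex. (fst p, ft (snd p), 0 :: complex)) 0"
        by (intro hol hol_at_of_snd[OF hft])
      from eventually_hol_compose_0[OF this _ hol_at_eventually[OF hQ']]
      show ?thesis
        using eventually_snd[OF hol_at_eventually[OF hft]]
        by (simp add: zero eventually_conj_iff)
    qed
    then obtain r where r: "r > 0" "\<And>z y. norm z < r \<Longrightarrow> norm y < r \<Longrightarrow> hol_at ft y \<and> hol_at Q' (z, ft y, 0)"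
      by (rule eventually_nhds_0_prodE) (auto simp: that)
    obtain y where y: "norm y < r" "param_immersive K r y"
      using \<open>nondegenerate K\<close> r(1) unfolding nondegenerate_def by blast
    have cft: "cdiff ft y" using r(2)[of 0 y] r(1) y(1) hol_at_imp_cdiff[of ft y] by simp
    have "\<exists>v. v \<noteq> 0 \<and> der ft y v = 0"
    proof (rule ccontr)
      assume "\<not> ?thesis"
      then have "inj (der ft y)" using linear_injective_0[OF der_linear[OF cft]] by blast
      then have "dim (der ft y ` UNIV) = DIM((complex ^ 'n) \<times> complex)"
        using dim_image_eq[OF der_linear[OF cft], of UNIV] by (simp add: inj_on_subset)
      moreover have "dim (der ft y ` UNIV) \<le> DIM(complex ^ 'n)" by (rule dim_subset_UNIV)
      ultimately show False by simp
    qed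
    then obtain v where v: "v \<noteq> 0" "der ft y v = 0" by blast
    have "der K (z, y) (0, v) = 0" if z: "norm z < r" for z
    proof -
      have c: "cdiff (\<lambda>y. (ft y, 0 :: complex)) y" by (intro cdiff_Pair cft cdiff_const)
      have cQ': "cdiff Q' (z, ft y, 0)" using r(2)[OF z y(1)] hol_at_imp_cdiff[of Q' "(z, ft y, 0)"] by simp
      show ?thesis
        using der_reparametrized[OF c cQ', of v] der_0[OF cQ']
        by (simp add: K_def[abs_def] der_Pair[OF cft cdiff_const] v(2))
    qed
    then show False using y(2) v(1) unfolding param_immersive_def by blast
  qed
  have "\<forall>\<^sub>F p in nhds 0. 0 = K (f (fst p, fst (snd p)), snd (snd p))"
    by (rule extend_off_the_graph[where g = "\<lambda>_. 0", OF hQ Q_0 hK hf zero(1) hol_at_const eq nondegenerate_Q deg])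
  from eventually_hol_compose_0[of "\<lambda>p. (fst (fst p), snd (fst p), snd p)", OF _ _ this]
  show ?thesis by (simp add: hol K_def)
qed

end

section \<open>Transversality\<close>

context half_segre_map
begin

definition graph where "graph p = ((fst p, Q p), snd p)"

definition defect where "defect p = g (fst p) - Q' (f (fst p), ft (snd p), gt (snd p))"

text \<open>The defining function \<open>w' - Q'(z',\<chi>',\<tau>')\<close> of \<open>\<M>'\<close>, pulled back by the map, vanishes on \<open>\<M>\<close>, so its differential
  there is a multiple of that of \<open>w - Q(z,\<chi>,\<tau>)\<close>; the multiple is read off in the direction of \<open>w\<close>.
  The manifold \<open>\<M>\<close> is parametrized by \<open>(z,\<chi>,\<tau>)\<close>.\<close>

definition slope where "slope p = der defect (graph p) ((0, 1), 0)"

definition regular where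
  "regular p \<longleftrightarrow> cdiff g (fst p) \<and> cdiff f (fst p) \<and> cdiff ft (snd p) \<and> cdiff gt (snd p) \<and>
     cdiff Q' (f (fst p), ft (snd p), gt (snd p))"

lemma hol_graph: "hol_at graph 0" and graph_0: "graph 0 = 0"
  unfolding graph_def by (intro hol hQ) (simp add: Q_0)

lemma hol_parts:
  shows "hol_at (\<lambda>p :: ((complex ^ 'n) \<times> complex) \<times> ((complex ^ 'n) \<times> complex). (f (fst p), ft (snd p), gt (snd p))) 0"
    and "hol_at (\<lambda>p :: ((complex ^ 'n) \<times> complex) \<times> ((complex ^ 'n) \<times> complex). g (fst p)) 0"
  by (intro hol hol_at_of_fst hol_at_of_snd hf hft hgt) (intro hol_at_of_fst hg)

lemma eventually_regular: "\<forall>\<^sub>F p in nhds 0. regular p"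
  using eventually_fst[OF hol_at_eventually[OF hg]] eventually_fst[OF hol_at_eventually[OF hf]]
    eventually_snd[OF hol_at_eventually[OF hft]] eventually_snd[OF hol_at_eventually[OF hgt]]
    eventually_hol_compose_0[OF hol_parts(1) _ hol_at_eventually[OF hQ'], unfolded zero fst_zero snd_zero, simplified]
  by eventually_elim (simp add: regular_def hol_at_imp_cdiff)

lemma hol_defect: "hol_at defect 0"
  unfolding defect_def by (intro hol hol_parts hol_at_compose_0[OF hQ' hol_parts(1)]) (simp add: zero)

lemma hol_slope: "hol_at slope 0"
  unfolding slope_def
  by (rule hol_at_compose_0[OF hol_at_der[OF hol_defect] hol_graph graph_0])

lemma der_defect:
  assumes "regular p"
  shows "cdiff defect p"
    and "der defect p v = der g (fst p) (fst v) -
      der Q' (f (fst p), ft (snd p), gt (snd p)) (der f (fst p) (fst v), der ft (snd p) (snd v), der gt (snd p) (snd v))"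
proof -
  note c = assms[unfolded regular_def]
  have cg: "cdiff (\<lambda>p. g (fst p)) p" and cf: "cdiff (\<lambda>p. f (fst p)) p"
    and cft: "cdiff (\<lambda>p. ft (snd p)) p" and cgt: "cdiff (\<lambda>p. gt (snd p)) p"
    using c der_of_fst(1) der_of_snd(1) by blast+
  have c1: "cdiff (\<lambda>p. (f (fst p), ft (snd p), gt (snd p))) p" by (intro cdiff_Pair cf cft cgt)
  have cQ': "cdiff Q' ((\<lambda>p. (f (fst p), ft (snd p), gt (snd p))) p)" using c by simp
  note c2 = cdiff_compose[OF c1 cQ']
  show "cdiff defect p" unfolding defect_def using cdiff_diff[OF cg c2] by simp
  show "der defect p v = der g (fst p) (fst v) -
      der Q' (f (fst p), ft (snd p), gt (snd p)) (der f (fst p) (fst v), der ft (snd p) (snd v), der gt (snd p) (snd v))"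
    unfolding defect_def using der_diff[OF cg c2, of v] der_compose[OF c1 cQ', of v] c
    by (simp add: der_Pair[OF cf cdiff_Pair[OF cft cgt]] der_Pair[OF cft cgt] der_of_fst(2) der_of_snd(2))
qed

text \<open>The derivative of \<open>defect \<circ> graph = 0\<close> along a direction of \<open>(\<chi>,\<tau>)\<close>.\<close>

lemma slope_relation:
  "\<forall>\<^sub>F p in nhds 0. \<forall>v. slope p * der Q p (0, v) =
     der Q' (f (fst p, Q p), ft (snd p), gt (snd p)) (0, der ft (snd p) v, der gt (snd p) v)"
proof -
  have "\<forall>\<^sub>F p in nhds 0. 0 = defect (graph p)"
    using eqn by eventually_elim (simp add: defect_def graph_def)
  then have "\<forall>\<^sub>F p in nhds 0. \<forall>\<^sub>F p in nhds p. 0 = defect (graph p)"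
    by (simp only: eventually_eventually)
  then show ?thesis
    using eventually_hol_compose_0[OF hol_graph graph_0 eventually_regular] hol_at_eventually[OF hQ]
  proof eventually_elim
    case (elim p)
    have cQ: "cdiff Q p" using elim hol_at_imp_cdiff by blast
    have c1: "cdiff (\<lambda>p. (fst p, Q p)) p" by (intro cdiff_Pair cdiff_fst cdiff_ident cQ)
    have cG: "cdiff graph p" unfolding graph_def by (intro cdiff_Pair cdiff_snd cdiff_ident c1)
    have cD: "cdiff defect (graph p)" using der_defect(1)[OF elim(2)] .
    have dG: "der graph p w = ((fst w, der Q p w), snd w)" for w
      unfolding graph_def
      by (simp add: der_Pair[OF c1 cdiff_snd[OF cdiff_ident]] der_Pair[OF cdiff_fst[OF cdiff_ident] cQ]
          der_bounded_linear bounded_linear_fst bounded_linear_snd)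
    have cg: "cdiff g (fst (graph p))" and cf: "cdiff f (fst (graph p))"
      using elim(2) by (simp_all add: regular_def)
    show ?case
    proof
      fix v
      have "0 = der (\<lambda>p. defect (graph p)) p (0, v)"
        using fun_cong[OF der_cong[OF elim(1) cdiff_const], of "(0, v)"] by simp
      also have "\<dots> = der defect (graph p) (cscale (der Q p (0, v)) ((0, 1), 0) + (0, v))"
        by (simp add: der_compose[OF cG cD] dG)
      also have "\<dots> = der Q p (0, v) * slope p + der defect (graph p) (0, v)"
        by (simp add: der_plus[OF cD] der_cscale[OF cD] slope_def del: cscale_Pair)
      also have "der defect (graph p) (0, v) =
          - der Q' (f (fst p, Q p), ft (snd p), gt (snd p)) (0, der ft (snd p) v, der gt (snd p) v)"
        using der_0[OF cg] der_0[OF cf] by (simp add: der_defect(2)[OF elim(2)]) (simp add: graph_def)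
      finally show "slope p * der Q p (0, v) =
          der Q' (f (fst p, Q p), ft (snd p), gt (snd p)) (0, der ft (snd p) v, der gt (snd p) v)"
        by (simp add: mult.commute)
    qed
  qed
qed

lemma slope_on_first: "\<forall>\<^sub>F y in nhds 0. slope (0, y, 0) = der gt (y, 0) (0, 1)"
proof -
  have 1: "hol_at (\<lambda>y. (ft (y, 0), gt (y, 0))) 0" by (intro hol hol_ft_slice hol_at_slice_second[OF hgt])
  have 2: "(\<lambda>y. (ft (y, 0), gt (y, 0))) 0 = 0" by (simp add: zero)
  show ?thesis
    using eventually_slice_first[OF eventually_slice_third[OF slope_relation]]
      eventually_slice_second[OF der_in_first_normal_coordinate[OF hQ Q_first]]
      eventually_hol_compose_0[OF 1 2 der_in_first_normal_coordinate[OF hQ' Q'_first]]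
      q_zero_first
  proof eventually_elim
    case (elim y)
    from elim(1)[rule_format, of "(0, 1)"] show ?case
      using elim(2,3,4) by (simp add: q_def zero)
  qed
qed

lemma slope_on_second: "\<forall>\<^sub>F z in nhds 0. slope (z, 0, 0) = der g (z, 0) (0, 1)"
proof -
  have z: "(\<lambda>z. f (z, 0)) 0 = 0" by (simp add: zero)
  show ?thesis
    using eventually_slice_second[OF eventually_slice_second[OF eventually_regular]]
      eventually_hol_compose_0[OF hol_at_slice_second[OF hf] z der_in_second_normal_coordinate[OF hQ' Q'_second]]
      q_zero_second
  proof eventually_elim
    case (elim z)
    have "graph (z, 0, 0) = ((z, 0), 0)" using elim(3) by (simp add: graph_def q_def)
    moreover have "der ft 0 0 = 0" "der gt 0 0 = 0"
      using elim(1) der_0 by (auto simp: regular_def)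
    ultimately show ?case
      using elim(2) by (simp add: slope_def der_defect(2)[OF elim(1)] zero)
  qed
qed

definition J where "J y = jacobian (\<lambda>y. ft (y, 0)) y"

text \<open>The vector \<open>u = cramer_numerator y\<close> satisfies \<open>D ft(y,0) (u, det (J y)) = 0\<close> where \<open>det (J y) \<noteq> 0\<close>: it is a
  holomorphic choice of a direction that \<open>ft\<close> does not see.\<close>

definition cramer_numerator where
  "cramer_numerator y = (\<chi> l. det (\<chi> i j. if j = l then (- der ft (y, 0) (0, 1)) $ i else J y $ i $ j))"

text \<open>The derivative of \<open>Q\<close> at \<open>(z,\<chi>,0)\<close> along \<open>(0,u,det J)\<close>, with \<open>u\<close> the Cramer vector, once more multiplied by \<open>det J\<close>:
  thanks to this factor \<open>slope_times_cofactor\<close> holds trivially where \<open>det J\<close> vanishes.\<close>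

definition cofactor where
  "cofactor p = det (J (snd p)) *
     ((\<Sum>l\<in>UNIV. cramer_numerator (snd p) $ l * der Q (fst p, snd p, 0) (0, axis l 1, 0)) +
      det (J (snd p)) * der Q (fst p, snd p, 0) (0, 0, 1))"

definition tau_derivative where
  "tau_derivative p = der Q' (f (fst p, q p), ft (snd p, 0), 0) (0, 0, 1)"

lemma hol_J: "hol_at (\<lambda>y. J y $ i $ j) 0"
proof -
  have "hol_at (\<lambda>y. der (\<lambda>y. ft (y, 0)) y (axis j 1) $ i) 0"
    by (intro hol_at_nth hol_at_der_vec hol_ft_slice)
  then show ?thesis by (simp add: J_def)
qed

lemma hol_cofactor: "hol_at cofactor 0"
proof -
  have dft: "hol_at (\<lambda>y. der ft (y, 0) (0, 1)) 0"
    by (rule hol_at_slice_second[OF hol_at_der_vec[OF hft]])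
  have detJ: "hol_at (\<lambda>y. det (J y)) 0" by (intro hol_at_det hol_J)
  have num: "hol_at (\<lambda>y. cramer_numerator y $ l) 0" for l
  proof -
    have "hol_at (\<lambda>y. (\<chi> i j. if j = l then (- der ft (y, 0) (0, 1)) $ i else J y $ i $ j) $ i $ j) 0"
      for i j
    proof (cases "j = l")
      case True
      have "hol_at (\<lambda>y. 0 - der ft (y, 0) (0, 1) $ i) 0" by (intro hol dft)
      then show ?thesis using True by simp
    next
      case False
      then show ?thesis using hol_J by simp
    qed
    then show ?thesis unfolding cramer_numerator_def by (simp add: hol_at_det)
  qed
  show ?thesis
    unfolding cofactor_def
    by (intro hol_at_mult hol_at_add hol_at_sum hol_at_of_snd[OF detJ] hol_at_of_snd[OF num]
        hol_at_slice_third[OF hol_at_der[OF hQ]])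
qed

lemma hol_image_point: "hol_at (\<lambda>p. (f (fst p, q p), ft (snd p, 0), 0 :: complex)) 0"
proof -
  have "hol_at (\<lambda>p. f (fst p, q p)) 0"
    by (rule hol_at_compose_0[OF hf]) (intro hol hol_q, simp add: q_0)
  then show ?thesis by (intro hol hol_at_of_snd[OF hol_ft_slice])
qed

lemma image_point_0: "(\<lambda>p. (f (fst p, q p), ft (snd p, 0), 0 :: complex)) 0 = 0"
  by (simp add: q_0 zero)

lemma hol_tau_derivative: "hol_at tau_derivative 0"
  unfolding tau_derivative_def
  by (rule hol_at_compose_0[OF hol_at_der[OF hQ'] hol_image_point image_point_0])

lemma hol_slope_slice: "hol_at (\<lambda>p. slope (fst p, snd p, 0)) 0"
  by (rule hol_at_slice_third[OF hol_slope])

lemma cofactor_on_first: "\<forall>\<^sub>F y in nhds 0. cofactor (0, y) = det (J y) * det (J y)"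
  using eventually_slice_second[OF der_in_first_normal_coordinate[OF hQ Q_first]]
  by eventually_elim (simp add: cofactor_def)

text \<open>On \<open>\<tau> = 0\<close> the function \<open>gt\<close> vanishes, so that its derivative along \<open>(u,s)\<close> is \<open>s \<cdot> gt\<^sub>\<tau>\<close>.\<close>

lemma slope_relation_slice:
  "\<forall>\<^sub>F p in nhds 0. \<forall>u s. slope (fst p, snd p, 0) * der Q (fst p, snd p, 0) (0, u, s) =
     der Q' (f (fst p, q p), ft (snd p, 0), 0) (0, der ft (snd p, 0) (u, s), s * der gt (snd p, 0) (0, 1))"
proof -
  have cgt: "\<forall>\<^sub>F y in nhds 0. cdiff gt (y, 0)"
    using eventually_slice_second[OF hol_at_eventually[OF hgt]] by eventually_elim (rule hol_at_imp_cdiff)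
  have "\<forall>\<^sub>F y in nhds 0. 0 = gt (y, 0)" using gt_zero by eventually_elim simp
  then have "\<forall>\<^sub>F y in nhds 0. \<forall>\<^sub>F y in nhds y. 0 = gt (y, 0)" by (simp only: eventually_eventually)
  then have dgt: "\<forall>\<^sub>F y in nhds 0. gt (y, 0) = 0 \<and> (\<forall>u s. der gt (y, 0) (u, s) = s * der gt (y, 0) (0, 1))"
    using cgt gt_zero
  proof eventually_elim
    case (elim y)
    have *: "der gt (y, 0) (u, 0) = 0" for u
      using fun_cong[OF der_cong[OF elim(1) cdiff_const], of u] der_slice_second(2)[OF elim(2), of u] by simp
    have "der gt (y, 0) (u, s) = s * der gt (y, 0) (0, 1)" for u s
      using der_plus[OF elim(2), of "(u, 0)" "cscale s (0, 1)"] der_cscale[OF elim(2), of s "(0, 1)"] *[of u] by simp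
    then show ?case using elim(3) by blast
  qed
  show ?thesis
    using eventually_slice_third[OF slope_relation] eventually_snd[OF dgt]
  proof eventually_elim
    case (elim p)
    show ?case
    proof (intro allI)
      fix u s
      have d: "der gt (snd p, 0) (u, s) = s * der gt (snd p, 0) (0, 1)" using elim(2) by blast
      show "slope (fst p, snd p, 0) * der Q (fst p, snd p, 0) (0, u, s) =
          der Q' (f (fst p, q p), ft (snd p, 0), 0) (0, der ft (snd p, 0) (u, s), s * der gt (snd p, 0) (0, 1))"
        using elim(1)[rule_format, of "(u, s)"] conjunct1[OF elim(2)]
        by (simp only: q_def fst_conv snd_conv d)
    qed
  qed
qed

text \<open>Along the Cramer vector the derivative of \<open>ft\<close> drops out of \<open>slope_relation_slice\<close>, and what remains on the right
  is \<open>det J \<cdot> gt\<^sub>\<tau>\<close> times the \<open>\<tau>'\<close>-derivative of \<open>Q'\<close>.  Here \<open>gt\<^sub>\<tau>(\<chi>,0)\<close> is the slope at \<open>(0,\<chi>,0)\<close>, and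
  \<open>(det J)\<^sup>2\<close> is the cofactor there, which gives the statement its symmetric form.\<close>

lemma slope_times_cofactor:
  "\<forall>\<^sub>F p in nhds 0. slope (fst p, snd p, 0) * cofactor p =
     slope (fst (0 :: complex ^ 'n, snd p), snd (0 :: complex ^ 'n, snd p), 0) * cofactor (0, snd p) * tau_derivative p"
proof -
  show ?thesis
    using slope_relation_slice eventually_snd[OF slope_on_first] eventually_snd[OF cofactor_on_first]
      eventually_snd[OF eventually_slice_second[OF hol_at_eventually[OF hft]]]
      eventually_snd[OF hol_at_eventually[OF hol_ft_slice]]
      eventually_slice_third[OF hol_at_eventually[OF hQ]]
      eventually_hol_compose_0[OF hol_image_point image_point_0 hol_at_eventually[OF hQ']]
  proof eventually_elim
    case (elim p)
    obtain x y where p: "p = (x, y)" by (cases p)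
    define \<delta> where "\<delta> = det (J y)"
    have cft: "cdiff ft (y, 0)" and cfs: "cdiff (\<lambda>y. ft (y, 0)) y" and cQ: "cdiff Q (x, y, 0)"
      and cQ': "cdiff Q' (f (x, q p), ft (y, 0), 0)"
      using elim(4-7)[THEN hol_at_imp_cdiff] p by auto
    have "slope (x, y, 0) * cofactor p = \<delta> * \<delta> * (der gt (y, 0) (0, 1) * tau_derivative p)"
    proof (cases "\<delta> = 0")
      case True
      then show ?thesis by (simp add: cofactor_def p \<delta>_def)
    next
      case False
      define u where "u = cramer_numerator y"
      have "der (\<lambda>y. ft (y, 0)) y u = cscale \<delta> (- der ft (y, 0) (0, 1))"
        unfolding u_def cramer_numerator_def \<delta>_def J_def
        by (rule der_adjugate_column[OF cfs]) (use False in \<open>simp add: \<delta>_def J_def\<close>)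
      then have ft_u: "der ft (y, 0) (u, \<delta>) = 0"
        using der_plus[OF cft, of "(u, 0)" "cscale \<delta> (0, 1)"] der_cscale[OF cft, of \<delta> "(0, 1)"]
        by (simp add: der_slice_second(2)[OF cft] cscale_minus_right)
      have "(\<Sum>l\<in>UNIV. u $ l * der Q (x, y, 0) (0, axis l 1, 0)) + \<delta> * der Q (x, y, 0) (0, 0, 1)
          = der Q (x, y, 0) (0, u, \<delta>)"
      proof -
        have "(\<Sum>l\<in>UNIV. cscale (u $ l) (axis l 1)) = u"
          by (simp add: vec_eq_iff axis_def if_distrib[of "\<lambda>x. _ * x"] cong: if_cong)
        then have "(\<Sum>l\<in>UNIV. cscale (u $ l) (0 :: complex ^ 'n, axis l 1, 0 :: complex)) = (0, u, 0)"
          by (simp add: prod_eq_iff fst_sum snd_sum)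
        then have "der Q (x, y, 0) (0, u, 0) = (\<Sum>l\<in>UNIV. u $ l * der Q (x, y, 0) (0, axis l 1, 0))"
          using linear_sum[OF der_linear[OF cQ], of "\<lambda>l. cscale (u $ l) (0, axis l 1, 0)" UNIV]
          by (simp add: der_cscale[OF cQ] del: cscale_Pair)
        then show ?thesis
          using der_plus[OF cQ, of "(0, u, 0)" "cscale \<delta> (0, 0, 1)"] der_cscale[OF cQ, of \<delta> "(0, 0, 1)"] by simp
      qed
      then have "slope (x, y, 0) * cofactor p = \<delta> * (slope (x, y, 0) * der Q (x, y, 0) (0, u, \<delta>))"
        by (simp add: cofactor_def p \<delta>_def u_def)
      also have "slope (x, y, 0) * der Q (x, y, 0) (0, u, \<delta>) =
          der Q' (f (x, q p), ft (y, 0), 0) (0, 0, \<delta> * der gt (y, 0) (0, 1))"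
        using elim(1) ft_u by (simp add: p)
      also have "\<dots> = \<delta> * der gt (y, 0) (0, 1) * tau_derivative p"
        using der_cscale[OF cQ', of "\<delta> * der gt (y, 0) (0, 1)" "(0, 0, 1)"]
        by (simp add: tau_derivative_def p)
      finally show ?thesis by (simp add: mult_ac)
    qed
    then show ?case using elim(2,3) by (simp add: p \<delta>_def mult_ac)
  qed
qed

lemma cofactor_not_zero:
  assumes "generically_immersive (\<lambda>y. ft (y, 0))"
  shows "\<not> (\<forall>\<^sub>F y in nhds 0. cofactor (0, y) = 0)"
proof
  assume "\<forall>\<^sub>F y in nhds 0. cofactor (0, y) = 0"
  then have "\<forall>\<^sub>F y in nhds 0. det (J y) = 0"
    using cofactor_on_first by eventually_elim simp
  then show False
    using generically_immersive_imp_det[OF hol_ft_slice assms] by (simp add: J_def)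
qed

text \<open>If \<open>gt\<^sub>\<tau>(0) = 0\<close>, then the slope vanishes at the origin, hence by propagation at all \<open>(z,0,0)\<close>, where it equals
  \<open>g\<^sub>w(z,0)\<close>.\<close>

lemma transversal:
  assumes "generically_immersive (\<lambda>y. ft (y, 0))"
    and "\<not> (\<forall>\<^sub>F z in nhds 0. der g (z, 0) (0, 1) = 0)"
  shows "der gt 0 (0, 1) \<noteq> 0"
proof
  assume 0: "der gt 0 (0, 1) = 0"
  have "\<forall>\<^sub>F z in nhds 0. (\<lambda>p. slope (fst p, snd p, 0)) (z, 0) = 0"
    by (rule zero_of_product_propagates[OF hol_slope_slice hol_cofactor hol_tau_derivative
          slope_times_cofactor cofactor_not_zero[OF assms(1)]])
      (use eventually_nhds_x_imp_x[OF slope_on_first] 0 in simp)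
  then have "\<forall>\<^sub>F z in nhds 0. der g (z, 0) (0, 1) = 0"
    using slope_on_second by eventually_elim simp
  with assms(2) show False ..
qed

lemma transversal_derivatives_equal: "der g 0 (0, 1) = der gt 0 (0, 1)"
  using eventually_nhds_x_imp_x[OF slope_on_first] eventually_nhds_x_imp_x[OF slope_on_second] by simp

text \<open>If \<open>gt\<^sub>\<tau>(\<chi>,0)\<close> vanished identically, then so would the slope on \<open>\<tau> = 0\<close>, because the cofactor does not.  Then
  \<open>slope_relation_slice\<close> with \<open>s = 0\<close> says that \<open>D\<^sub>\<chi> k\<close> vanishes at \<open>(f(z,q(z,\<chi>)),\<chi>)\<close>; as \<open>f(\<cdot>,0)\<close> is
  generically immersive, these points fill an open set, and \<open>k\<close> would not separate anything.\<close>

lemma gt_tau_not_zero: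
  assumes imm_ft: "generically_immersive (\<lambda>y. ft (y, 0))" and imm_f: "generically_immersive (\<lambda>z. f (z, 0))"
    and nd_k: "nondegenerate k"
  shows "\<not> (\<forall>\<^sub>F y in nhds 0. der gt (y, 0) (0, 1) = 0)"
proof
  assume 0: "\<forall>\<^sub>F y in nhds 0. der gt (y, 0) (0, 1) = 0"
  have "\<forall>\<^sub>F p in nhds 0. slope (fst p, snd p, 0) * cofactor p = 0"
    using slope_times_cofactor eventually_snd[OF slope_on_first] eventually_snd[OF 0]
    by eventually_elim simp
  from eventually_mult_eq_0[OF hol_slope_slice hol_cofactor this]
  have slope0: "\<forall>\<^sub>F p in nhds 0. slope (fst p, snd p, 0) = 0"
  proof
    assume "\<forall>\<^sub>F p in nhds 0. cofactor p = 0"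
    from eventually_slice_first[OF this] cofactor_not_zero[OF imm_ft] show ?thesis by blast
  qed
  define swap where "swap p = (snd p, fst p)" for p :: "(complex ^ 'n) \<times> (complex ^ 'n)"
  define \<psi> where "\<psi> p = f (snd p, q (snd p, fst p))" for p
  define u where "u = (1 :: complex ^ 'n)"
  define G where "G p = der k (snd p, fst p) (0, u)" for p
  have swap: "hol_at swap 0" "swap 0 = 0" unfolding swap_def by (intro hol) simp
  have hqs: "hol_at (\<lambda>p. q (snd p, fst p)) 0"
    using hol_at_compose_0[OF hol_q swap] by (simp add: swap_def)
  have \<psi>: "hol_at \<psi> 0" "\<psi> 0 = 0"
    unfolding \<psi>_def by (rule hol_at_compose_0[OF hf]) (intro hol hqs, simp_all add: q_0 zero)
  have hG: "hol_at G 0"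
    unfolding G_def using hol_at_compose_0[OF hol_at_der[OF hol_k] swap] by (simp add: swap_def)
  have vanish: "\<forall>\<^sub>F p in nhds 0. G (fst p, \<psi> p) = 0"
  proof -
    have "\<forall>\<^sub>F p in nhds 0. der k (f (fst p, q p), snd p) (0, u) = 0"
      using slope_relation_slice slope0 eventually_snd[OF eventually_slice_second[OF hol_at_eventually[OF hft]]]
        eventually_hol_compose_0[OF hol_image_point image_point_0 hol_at_eventually[OF hQ']]
    proof eventually_elim
      case (elim p)
      have cft: "cdiff ft (snd p, 0)" using hol_at_imp_cdiff[OF elim(3)] .
      have c: "cdiff (\<lambda>y. (ft (y, 0), 0 :: complex)) (snd p)"
        by (intro cdiff_Pair der_slice_second(1)[OF cft] cdiff_const)
      have cQ': "cdiff Q' (f (fst p, q p), ft (snd p, 0), 0)" using hol_at_imp_cdiff[OF elim(4)] .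
      show ?case
        unfolding k_def[abs_def]
        using der_reparametrized[OF c cQ', of u] elim(1)[rule_format, of u 0] elim(2)
        by (simp add: der_Pair[OF der_slice_second(1)[OF cft] cdiff_const] der_slice_second(2)[OF cft])
    qed
    from eventually_hol_compose_0[OF swap this] show ?thesis
      by (simp add: swap_def G_def \<psi>_def)
  qed
  have slice: "\<forall>\<^sub>F z in nhds 0. \<psi> (0, z) = f (z, 0)"
    using q_zero_second by eventually_elim (simp add: \<psi>_def)
  have "\<exists>\<^sub>F z in nhds 0. \<forall>u. der \<psi> (0, z) (0, u) = 0 \<longrightarrow> u = 0"
    using imm_f unfolding generically_immersive_def
    by (rule frequently_rev_mp) (use der_eq_if_slice_eq[OF \<psi>(1) slice] in eventually_elim, simp)
  from zero_if_zero_on_open_family[OF \<psi> hG vanish this]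
  have "\<forall>\<^sub>F p in nhds 0. G p = 0" .
  from eventually_hol_compose_0[OF swap this]
  have "\<forall>\<^sub>F p in nhds 0. der k p (0, u) = 0" by (simp add: swap_def G_def)
  then obtain r where r: "r > 0" "\<And>z y. norm z < r \<Longrightarrow> norm y < r \<Longrightarrow> der k (z, y) (0, u) = 0"
    by (rule eventually_nhds_0_prodE) (rule that)
  obtain y where "norm y < r" "param_immersive k r y"
    using nd_k r(1) unfolding nondegenerate_def by blast
  then have "u = 0" using r(2) unfolding param_immersive_def by blast
  then show False by (simp add: u_def vec_eq_iff)
qed

end

text \<open>On \<open>w = 0\<close> the derivative of \<open>g\<close> sees only the \<open>w\<close>-component, so the derivative of \<open>(f,g)\<close> is block triangular.\<close>

lemma generically_immersive_pair:
  fixes f :: "(complex ^ 'n::finite) \<times> complex \<Rightarrow> complex ^ 'n" and g :: "(complex ^ 'n) \<times> complex \<Rightarrow> complex"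
  assumes hf: "hol_at f 0" and hg: "hol_at g 0" and g0: "\<forall>\<^sub>F z in nhds 0. g (z, 0) = 0"
    and imm: "generically_immersive (\<lambda>z. f (z, 0))" and tr: "der g 0 (0, 1) \<noteq> 0"
  shows "\<exists>\<^sub>F z in nhds 0. \<forall>v. der (\<lambda>Z. (f Z, g Z)) (z, 0) v = 0 \<longrightarrow> v = 0"
proof -
  have "hol_at (\<lambda>z. der g (z, 0) (0, 1)) 0" by (rule hol_at_slice_second[OF hol_at_der[OF hg]])
  from tendsto_imp_eventually_ne[OF filterlim_isCont[OF hol_at_isCont[OF this]], of 0]
  have "\<forall>\<^sub>F z in nhds 0. der g (z, 0) (0, 1) \<noteq> 0" using tr by simp
  moreover have "\<forall>\<^sub>F z in nhds 0. 0 = g (z, 0)" using g0 by eventually_elim simp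
  then have "\<forall>\<^sub>F z in nhds 0. \<forall>\<^sub>F z in nhds z. 0 = g (z, 0)" by (simp only: eventually_eventually)
  ultimately have "\<forall>\<^sub>F z in nhds 0. (\<forall>u. der (\<lambda>z. f (z, 0)) z u = 0 \<longrightarrow> u = 0) \<longrightarrow>
      (\<forall>v. der (\<lambda>Z. (f Z, g Z)) (z, 0) v = 0 \<longrightarrow> v = 0)"
    using eventually_slice_second[OF hol_at_eventually[OF hf]] eventually_slice_second[OF hol_at_eventually[OF hg]]
  proof eventually_elim
    case (elim x)
    have cf: "cdiff f (x, 0)" and cg: "cdiff g (x, 0)" using elim(3,4) hol_at_imp_cdiff by blast+
    have g1: "der g (x, 0) (u, 0) = 0" for u
      using fun_cong[OF der_cong[OF elim(2) cdiff_const], of u] der_slice_second(2)[OF cg, of u] by simp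
    have gs: "der g (x, 0) (u, s) = s * der g (x, 0) (0, 1)" for u s
      using der_plus[OF cg, of "(u, 0)" "cscale s (0, 1)"] der_cscale[OF cg, of s "(0, 1)"] g1[of u] by simp
    show ?case
    proof (intro impI allI)
      fix v assume inj: "\<forall>u. der (\<lambda>z. f (z, 0)) x u = 0 \<longrightarrow> u = 0"
        and v: "der (\<lambda>Z. (f Z, g Z)) (x, 0) v = 0"
      obtain u s where us: "v = (u, s)" by (cases v)
      have "der f (x, 0) (u, s) = 0" "der g (x, 0) (u, s) = 0"
        using v by (simp_all add: us der_Pair[OF cf cg] zero_prod_def del: Pair_0_0)
      moreover from this(2) have "s = 0" using gs[of u s] elim(1) by simp
      ultimately have "der (\<lambda>z. f (z, 0)) x u = 0" using der_slice_second(2)[OF cf, of u] by simp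
      then have "u = 0" using inj by blast
      then show "v = 0" using \<open>s = 0\<close> by (simp add: us)
    qed
  qed
  with imm show ?thesis
    unfolding generically_immersive_def by (rule frequently_rev_mp)
qed

section \<open>The dichotomy for Segre preserving maps\<close>

lemma hol_at_iff_open: "hol_at F x \<longleftrightarrow> (\<exists>S. open S \<and> x \<in> S \<and> holomorphic_map_on F S)"
  unfolding hol_at_def eventually_nhds holomorphic_map_on_def cdiff_def by blast

lemma eventually_cnj_pair:
  assumes "\<forall>\<^sub>F p in nhds (0 :: (complex ^ 'n::finite) \<times> complex). R p"
  shows "\<forall>\<^sub>F p in nhds (0 :: (complex ^ 'n) \<times> complex). R (cnj_vec (fst p), cnj (snd p))"
proof -
  have "bounded_linear (\<lambda>p :: (complex ^ 'n) \<times> complex. (cnj_vec (fst p), cnj (snd p)))"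
    by (intro bounded_linear_Pair bounded_linear_compose[OF bounded_linear_cnj_vec]
        bounded_linear_compose[OF bounded_linear_cnj] bounded_linear_intros)
  from filterlim_isCont[OF linear_continuous_at[OF this], of 0]
  show ?thesis using eventually_compose_filterlim[OF assms] by simp
qed

text \<open>The function \<open>conj_fun Q\<close> inherits the normalization and solves \<open>w = Q(z,\<chi>,\<tau>)\<close> for \<open>\<tau>\<close>: the reality condition
  is one of the two inversion formulas, and its complex conjugate is the other.\<close>

lemma normal_coordinates_germ:
  fixes Q :: "(complex ^ 'n::finite) \<times> (complex ^ 'n) \<times> complex \<Rightarrow> complex"
  assumes "normal_coordinates M V Q"
  shows "hol_at Q 0" "hol_at (conj_fun Q) 0"
    and "\<forall>\<^sub>F \<zeta> in nhds 0. Q (0, \<zeta>) = snd \<zeta>" "\<forall>\<^sub>F p in nhds 0. Q (fst p, 0, snd p) = snd p"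
    and "\<forall>\<^sub>F \<zeta> in nhds 0. conj_fun Q (0, \<zeta>) = snd \<zeta>"
    and "\<forall>\<^sub>F p in nhds 0. conj_fun Q (fst p, 0, snd p) = snd p"
    and "\<forall>\<^sub>F p in nhds 0. Q (fst p, fst (snd p), conj_fun Q (fst (snd p), fst p, snd (snd p))) = snd (snd p)"
    and "\<forall>\<^sub>F p in nhds 0. conj_fun Q (fst p, fst (snd p), Q (fst (snd p), fst p, snd (snd p))) = snd (snd p)"
proof -
  note nc = assms[unfolded normal_coordinates_def]
  show hQ: "hol_at Q 0" using nc hol_at_iff_open by blast
  show "hol_at (conj_fun Q) 0" by (rule hol_at_conj_fun[OF hQ])
  show 1: "\<forall>\<^sub>F \<zeta> in nhds 0. Q (0, \<zeta>) = snd \<zeta>"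
    using nc by (simp add: case_prod_unfold)
  show 2: "\<forall>\<^sub>F p in nhds 0. Q (fst p, 0, snd p) = snd p"
    using nc by (simp add: case_prod_unfold)
  show "\<forall>\<^sub>F \<zeta> in nhds 0. conj_fun Q (0, \<zeta>) = snd \<zeta>"
    using eventually_cnj_pair[OF 1] by eventually_elim (simp add: conj_fun_def case_prod_unfold)
  show "\<forall>\<^sub>F p in nhds 0. conj_fun Q (fst p, 0, snd p) = snd p"
    using eventually_cnj_pair[OF 2] by eventually_elim (simp add: conj_fun_def)
  show 3: "\<forall>\<^sub>F p in nhds 0. Q (fst p, fst (snd p), conj_fun Q (fst (snd p), fst p, snd (snd p))) = snd (snd p)"
    using nc by (simp add: case_prod_unfold)
  define c where "c p = (cnj_vec (fst p), cnj_vec (fst (snd p)), cnj (snd (snd p)))"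
    for p :: "(complex ^ 'n) \<times> (complex ^ 'n) \<times> complex"
  have "bounded_linear c"
    unfolding c_def
    by (intro bounded_linear_Pair bounded_linear_compose[OF bounded_linear_cnj_vec]
        bounded_linear_compose[OF bounded_linear_cnj] bounded_linear_intros)
  from filterlim_isCont[OF linear_continuous_at[OF this], of 0]
  have "filterlim c (nhds 0) (nhds 0)" by (simp add: c_def)
  from eventually_compose_filterlim[OF 3 this]
  show "\<forall>\<^sub>F p in nhds 0. conj_fun Q (fst p, fst (snd p), Q (fst (snd p), fst p, snd (snd p))) = snd (snd p)"
    by eventually_elim (simp add: conj_fun_def c_def)
qed

lemma HSPM_germ:
  fixes Q Q' :: "(complex ^ 'n::finite) \<times> (complex ^ 'n) \<times> complex \<Rightarrow> complex"
  assumes H: "HSPM U f g ft gt (complexification V Q) (complexification V' Q')"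
    and V: "open V" "0 \<in> V" and hQ: "hol_at Q 0" "Q 0 = 0"
  shows "\<And>p. p \<in> U \<Longrightarrow> hol_at f (fst p) \<and> hol_at g (fst p) \<and> hol_at ft (snd p) \<and> hol_at gt (snd p)"
    and "f 0 = 0" "g 0 = 0" "ft 0 = 0" "gt 0 = 0"
    and "\<forall>\<^sub>F p in nhds 0. g (fst p, Q p) = Q' (f (fst p, Q p), ft (snd p), gt (snd p))"
proof -
  note H = H[unfolded HSPM_def]
  show "hol_at f (fst p) \<and> hol_at g (fst p) \<and> hol_at ft (snd p) \<and> hol_at gt (snd p)" if "p \<in> U" for p
  proof -
    have hS: "hol_at (segre_map f g ft gt) (fst p, snd p)" using H that hol_at_iff_open by auto
    have 1: "hol_at (\<lambda>Z. segre_map f g ft gt (Z, snd p)) (fst p)"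
      by (rule hol_at_compose[where F = "\<lambda>Z. (Z, snd p)", OF hS]) (intro hol)
    have 2: "hol_at (\<lambda>\<zeta>. segre_map f g ft gt (fst p, \<zeta>)) (snd p)"
      by (rule hol_at_compose[where F = "\<lambda>\<zeta>. (fst p, \<zeta>)", OF hS]) (intro hol)
    show ?thesis
      using hol_at_fst[OF hol_at_fst[OF 1]] hol_at_snd[OF hol_at_fst[OF 1]]
        hol_at_fst[OF hol_at_snd[OF 2]] hol_at_snd[OF hol_at_snd[OF 2]]
      by (simp add: segre_map_def)
  qed
  show "f 0 = 0" "g 0 = 0" "ft 0 = 0" "gt 0 = 0"
    using H by (auto simp: segre_map_def zero_prod_def simp del: Pair_0_0)
  define G where "G p = ((fst p, Q p), snd p)" for p
  have G: "hol_at G 0" "G 0 = 0" unfolding G_def by (intro hol hQ) (simp add: hQ)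
  have "\<forall>\<^sub>F p in nhds 0. G p \<in> complexification V Q \<longrightarrow> segre_map f g ft gt (G p) \<in> complexification V' Q'"
    using eventually_hol_compose_0[OF G] H by blast
  moreover have "\<forall>\<^sub>F p in nhds 0. p \<in> V" using eventually_nhds_in_open[OF V] .
  ultimately show "\<forall>\<^sub>F p in nhds 0. g (fst p, Q p) = Q' (f (fst p, Q p), ft (snd p), gt (snd p))"
    by eventually_elim (auto simp: G_def complexification_def segre_map_def)
qed

lemma det_cjacobian_not_zero:
  fixes F :: "complex ^ 'n::finite \<Rightarrow> complex ^ 'n"
  assumes "hol_at F 0" "generically_immersive F"
  shows "\<not> (\<forall>\<^sub>F z in nhds 0. det (cjacobian F z) = 0)"
proof
  assume "\<forall>\<^sub>F z in nhds 0. det (cjacobian F z) = 0"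
  then have "\<forall>\<^sub>F z in nhds 0. det (jacobian F z) = 0"
    using hol_at_eventually[OF assms(1)]
    by eventually_elim (simp add: cjacobian_eq_jacobian hol_at_imp_cdiff)
  then show False using generically_immersive_imp_det[OF assms] by blast
qed

lemma deriv_transversal:
  fixes g :: "(complex ^ 'n::finite) \<times> complex \<Rightarrow> complex"
  assumes "hol_at g 0"
  shows "deriv (\<lambda>w. g (0, w)) 0 = der g 0 (0, 1)"
  using DERIV_imp_deriv[OF has_field_derivative_along_line[of g 0 0 "(0, 1)"]] hol_at_imp_cdiff[OF assms]
  by simp

text \<open>The maps \<open>H\<close> and \<open>Ht\<close> are immersive at generic points \<open>(z,0)\<close> and \<open>(\<chi>,0)\<close>, but \<open>((z,0),(\<chi>,0))\<close> need not
  lie in \<open>X\<close>.  So \<open>z\<close> is fixed first; for small \<open>\<chi>\<close> the point \<open>(z,q(z,\<chi>))\<close> is still so close to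
  \<open>(z,0)\<close> that \<open>H\<close> stays immersive there, and then \<open>\<chi>\<close> is chosen.\<close>

lemma biholomorphic_near_graph_point:
  fixes H Ht :: "(complex ^ 'n::finite) \<times> complex \<Rightarrow> (complex ^ 'n) \<times> complex"
    and q :: "(complex ^ 'n) \<times> (complex ^ 'n) \<Rightarrow> complex"
  assumes U: "open U" "0 \<in> U" and X: "\<forall>\<^sub>F p in nhds 0. ((fst p, q p), (snd p, 0)) \<in> X"
    and hH: "\<And>p. p \<in> U \<Longrightarrow> hol_at H (fst p) \<and> (\<forall>v. hol_at (\<lambda>Z. der H Z v) (fst p))"
    and hHt: "\<And>p. p \<in> U \<Longrightarrow> hol_at Ht (snd p) \<and> (\<forall>v. hol_at (\<lambda>Z. der Ht Z v) (snd p))"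
    and hq: "hol_at q 0" and q0: "\<forall>\<^sub>F z in nhds 0. q (z, 0) = 0"
    and inj: "\<exists>\<^sub>F z in nhds 0. \<forall>v. der H (z, 0) v = 0 \<longrightarrow> v = 0"
    and injt: "\<exists>\<^sub>F y in nhds 0. \<forall>v. der Ht (y, 0) v = 0 \<longrightarrow> v = 0"
  shows "\<exists>p \<in> X \<inter> U. biholomorphic_near (\<lambda>p. (H (fst p), Ht (snd p))) p U"
proof -
  define G where "G p = ((fst p, q p), (snd p, 0 :: complex))" for p
  have "q 0 = 0" using eventually_nhds_x_imp_x[OF q0] by simp
  then have G: "hol_at G 0" "G 0 = 0" unfolding G_def by (intro hol hq) (simp add: \<open>q 0 = 0\<close>)
  have "\<forall>\<^sub>F p in nhds 0. G p \<in> X \<and> G p \<in> U \<and> hol_at q p"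
    using X eventually_hol_compose_0[OF G eventually_nhds_in_open[OF U]] hol_at_eventually[OF hq]
    by eventually_elim (simp add: G_def)
  then obtain r where r: "r > 0"
      "\<And>z y. norm z < r \<Longrightarrow> norm y < r \<Longrightarrow> G (z, y) \<in> X \<and> G (z, y) \<in> U \<and> hol_at q (z, y)"
    by (rule eventually_nhds_0_prodE) (rule that)
  have "\<forall>\<^sub>F z in nhds 0. z \<in> ball 0 r \<and> q (z, 0) = 0"
    using eventually_nhds_in_open[OF open_ball centre_in_ball[THEN iffD2, OF r(1)]] q0
    by eventually_elim simp
  from frequently_ex[OF frequently_eventually_frequently[OF inj this]]
  obtain z where "z \<in> ball 0 r" and z: "q (z, 0) = 0" "\<And>v. der H (z, 0) v = 0 \<Longrightarrow> v = 0"
    by blast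
  then have zr: "norm z < r" by simp
  have "\<forall>\<^sub>F Z in nhds (z, 0). \<forall>v. der H Z v = 0 \<longrightarrow> v = 0"
  proof (rule holomorphic_inverse_function(2))
    show "open (fst ` U)" using U(1) by (rule open_image_fst)
    have GU: "G (z, 0) \<in> U" using r(2)[of z 0] zr r(1) by simp
    show "(z, 0) \<in> fst ` U" by (rule image_eqI[OF _ GU]) (simp add: G_def z(1))
  qed (use hH z(2) in auto)
  moreover have "isCont (\<lambda>y. (z, q (z, y))) 0"
  proof -
    have q_z: "hol_at q (z, 0)" using r(2)[of z 0] zr r(1) by simp
    have "hol_at (\<lambda>y. (z, y)) 0" by (intro hol)
    from hol_at_isCont[OF hol_at_Pair[OF hol_at_const hol_at_compose[OF q_z this]]] show ?thesis .
  qed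
  from filterlim_isCont[OF this] z(1)
  have "filterlim (\<lambda>y. (z, q (z, y))) (nhds (z, 0)) (nhds 0)" by simp
  ultimately have "\<forall>\<^sub>F y in nhds 0. \<forall>v. der H (z, q (z, y)) v = 0 \<longrightarrow> v = 0"
    by (rule eventually_compose_filterlim)
  then have "\<forall>\<^sub>F y in nhds 0. y \<in> ball 0 r \<and> (\<forall>v. der H (z, q (z, y)) v = 0 \<longrightarrow> v = 0)"
    using eventually_nhds_in_open[OF open_ball centre_in_ball[THEN iffD2, OF r(1)]]
    by eventually_elim simp
  from frequently_ex[OF frequently_eventually_frequently[OF injt this]]
  obtain y where "y \<in> ball 0 r" and y: "\<And>v. der H (z, q (z, y)) v = 0 \<Longrightarrow> v = 0"
      "\<And>v. der Ht (y, 0) v = 0 \<Longrightarrow> v = 0"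
    by blast
  then have yr: "norm y < r" by simp
  define S where "S p = (H (fst p), Ht (snd p))" for p
  have parts: "hol_at (\<lambda>p. H (fst p)) p" "hol_at (\<lambda>p. Ht (snd p)) p"
    "der (\<lambda>p. H (fst p)) p v = der H (fst p) (fst v)" "der (\<lambda>p. Ht (snd p)) p v = der Ht (snd p) (snd v)"
    if p: "p \<in> U" for p v
  proof -
    note c = hol_at_imp_cdiff[OF conjunct1[OF hH[OF p]]] hol_at_imp_cdiff[OF conjunct1[OF hHt[OF p]]]
    show "hol_at (\<lambda>p. H (fst p)) p" "hol_at (\<lambda>p. Ht (snd p)) p"
      using hol_at_compose[OF conjunct1[OF hH[OF p]] hol_at_fst[OF hol_at_ident]]
        hol_at_compose[OF conjunct1[OF hHt[OF p]] hol_at_snd[OF hol_at_ident]] by simp_all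
    show "der (\<lambda>p. H (fst p)) p v = der H (fst p) (fst v)" "der (\<lambda>p. Ht (snd p)) p v = der Ht (snd p) (snd v)"
      using der_of_fst(2)[OF c(1)] der_of_snd(2)[OF c(2)] by blast+
  qed
  have "biholomorphic_near S (G (z, y)) U"
  proof (rule holomorphic_inverse_function(1)[OF U(1)])
    show GU: "G (z, y) \<in> U" using r(2)[OF zr yr] by blast
    show "hol_at S p" if "p \<in> U" for p
      unfolding S_def by (intro hol parts that)
    show "hol_at (\<lambda>p. der S p v) p" if p: "p \<in> U" for p v
      unfolding S_def
    proof (rule hol_at_der_Pair[OF parts(1)[OF p] parts(2)[OF p]])
      have ev: "\<forall>\<^sub>F p in nhds p. p \<in> U" using eventually_nhds_in_open[OF U(1) p] .
      show "hol_at (\<lambda>p. der (\<lambda>p. H (fst p)) p v) p"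
      proof (rule hol_at_cong)
        show "\<forall>\<^sub>F p in nhds p. der H (fst p) (fst v) = der (\<lambda>p. H (fst p)) p v"
          using ev by eventually_elim (simp add: parts(3))
        show "hol_at (\<lambda>p. der H (fst p) (fst v)) p"
          by (rule hol_at_compose[where F = fst and G = "\<lambda>Z. der H Z (fst v)"])
            (use hH[OF p] in blast, rule hol_at_fst[OF hol_at_ident])
      qed
      show "hol_at (\<lambda>p. der (\<lambda>p. Ht (snd p)) p v) p"
      proof (rule hol_at_cong)
        show "\<forall>\<^sub>F p in nhds p. der Ht (snd p) (snd v) = der (\<lambda>p. Ht (snd p)) p v"
          using ev by eventually_elim (simp add: parts(4))
        show "hol_at (\<lambda>p. der Ht (snd p) (snd v)) p"
          by (rule hol_at_compose[where F = snd and G = "\<lambda>Z. der Ht Z (snd v)"])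
            (use hHt[OF p] in blast, rule hol_at_snd[OF hol_at_ident])
      qed
    qed
    show "v = 0" if v: "der S (G (z, y)) v = 0" for v
    proof -
      note c = hol_at_imp_cdiff[OF parts(1)[OF GU]] hol_at_imp_cdiff[OF parts(2)[OF GU]]
      have "(der H (z, q (z, y)) (fst v), der Ht (y, 0) (snd v)) = 0"
        using v unfolding S_def by (simp add: der_Pair[OF c] parts(3,4)[OF GU]) (simp add: G_def)
      then have "fst v = 0" "snd v = 0"
        using y(1)[of "fst v"] y(2)[of "snd v"] by (simp_all add: zero_prod_def del: Pair_0_0)
      then show "v = 0" by (cases v) simp
    qed
  qed
  then show ?thesis
    using r(2)[OF zr yr] unfolding S_def by blast
qed

theorem theorem1p3:
  fixes M M' :: "((complex ^ 'n::finite) \<times> complex) set"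
    and V V' :: "((complex ^ 'n) \<times> (complex ^ 'n) \<times> complex) set"
    and Q Q' :: "(complex ^ 'n) \<times> (complex ^ 'n) \<times> complex \<Rightarrow> complex"
    and U :: "(((complex ^ 'n) \<times> complex) \<times> ((complex ^ 'n) \<times> complex)) set"
    and f ft :: "(complex ^ 'n) \<times> complex \<Rightarrow> complex ^ 'n"
    and g gt :: "(complex ^ 'n) \<times> complex \<Rightarrow> complex"
  assumes "real_analytic_hypersurface_at M 0"
    and "real_analytic_hypersurface_at M' 0"
    and "normal_coordinates M V Q"
    and "normal_coordinates M' V' Q'"
    and "class_C Q"
    and "HSPM U f g ft gt (complexification V Q) (complexification V' Q')"
  shows "(transversally_null g gt \<and>
           (\<forall>\<^sub>F (Z, \<zeta>) in nhds 0. Q' (f Z, ft \<zeta>, 0) = 0) \<and>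
           (\<forall>\<^sub>F p in nhds 0. segre_map f g ft gt p \<in> complexification V' Q')) \<or>
         (segre_transversal g gt \<and>
           totally_segre_nondegenerate f ft \<and>
           (\<exists>p \<in> complexification V Q \<inter> U. biholomorphic_near (segre_map f g ft gt) p U) \<and>
           class_C Q')"
proof -
  note nQ = normal_coordinates_germ[OF assms(3)]
  note nQ' = normal_coordinates_germ[OF assms(4)]
  have V: "open V" "0 \<in> V" and V': "open V'" "0 \<in> V'"
    using assms(3,4) unfolding normal_coordinates_def by blast+
  have U: "open U" "0 \<in> U" using assms(6) unfolding HSPM_def by blast+
  have Q0: "Q 0 = 0" using eventually_nhds_x_imp_x[OF nQ(3)] by simp
  note H = HSPM_germ[OF assms(6) V nQ(1) Q0]
  have h0: "hol_at f 0" "hol_at g 0" "hol_at ft 0" "hol_at gt 0" using H(1)[OF U(2)] by simp_all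
  have hq: "hol_at (\<lambda>p. Q (fst p, snd p, 0)) 0" and hq': "hol_at (\<lambda>p. Q' (fst p, snd p, 0)) 0"
    by (rule hol_at_slice_third[OF nQ(1)]) (rule hol_at_slice_third[OF nQ'(1)])
  have nd: "nondegenerate (\<lambda>p. Q (fst p, snd p, 0))"
    using assms(5) class_C_iff_nondegenerate[OF hq] by blast
  have nd_conj: "nondegenerate (\<lambda>p. conj_fun Q (fst p, snd p, 0))"
    using nondegenerate_conj[OF hq nd] by (simp add: conj_fun_def)
  \<comment> \<open>The equation of the map solved for gt, which is the hypothesis with the two halves exchanged.\<close>
  have eqn_conj: "\<forall>\<^sub>F p in nhds 0. gt (fst p, conj_fun Q p) =
      conj_fun Q' (ft (fst p, conj_fun Q p), f (snd p), g (snd p))"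
  proof -
    define S where "S p = (fst (snd p), fst p, conj_fun Q p)" for p :: "(complex ^ 'n) \<times> (complex ^ 'n) \<times> complex"
    define T where "T p = (ft (fst p, conj_fun Q p), f (snd p), gt (fst p, conj_fun Q p))"
      for p :: "(complex ^ 'n) \<times> (complex ^ 'n) \<times> complex"
    define R where "R p = (fst (snd p), fst p, snd (snd p))" for p :: "(complex ^ 'n) \<times> (complex ^ 'n) \<times> complex"
    have cQ0: "conj_fun Q 0 = 0" using eventually_nhds_x_imp_x[OF nQ(5)] by simp
    have S: "hol_at S 0" "S 0 = 0" unfolding S_def by (intro hol nQ) (simp add: cQ0)
    have R: "hol_at R 0" "R 0 = 0" unfolding R_def by (intro hol) simp
    have e: "hol_at (\<lambda>p. F (fst p, conj_fun Q p)) 0" if "hol_at F 0"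
      for F :: "(complex ^ 'n) \<times> complex \<Rightarrow> 'z::complex_normed_space"
      by (rule hol_at_compose_0[OF that]) (intro hol nQ, simp add: cQ0)
    have T: "hol_at T 0" "T 0 = 0" unfolding T_def by (intro hol e h0 hol_at_of_snd) (simp add: cQ0 H(2-5))
    show ?thesis
      using eventually_hol_compose_0[OF S H(6)] eventually_hol_compose_0[OF R nQ(7)]
        eventually_hol_compose_0[OF T nQ'(8)]
    proof eventually_elim
      case (elim p)
      obtain y z w where p: "p = (y, z, w)" by (cases p)
      have "Q (z, y, conj_fun Q (y, z, w)) = w" using elim(2) by (simp add: R_def p)
      then show ?case using elim(1,3) by (simp add: S_def T_def p)
    qed
  qed
  interpret A: half_segre_map Q "conj_fun Q" Q' f ft g gt
    by unfold_locales (fact nQ nQ' h0 H(2-6) nd)+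
  interpret B: half_segre_map "conj_fun Q" Q "conj_fun Q'" ft f gt g
    by unfold_locales (fact nQ nQ' h0 H(2-6) nd_conj eqn_conj)+
  show ?thesis
  proof (cases "(\<forall>\<^sub>F Z in nhds 0. g Z = 0) \<and> (\<forall>\<^sub>F \<zeta> in nhds 0. gt \<zeta> = 0)")
    case True
    have null: "\<forall>\<^sub>F p in nhds 0. Q' (f (fst p), ft (snd p), 0) = 0"
      using A.null_case True by blast
    have ev_fst: "\<forall>\<^sub>F p :: ((complex ^ 'n) \<times> complex) \<times> ((complex ^ 'n) \<times> complex) in nhds 0. g (fst p) = 0"
      and ev_snd: "\<forall>\<^sub>F p :: ((complex ^ 'n) \<times> complex) \<times> ((complex ^ 'n) \<times> complex) in nhds 0. gt (snd p) = 0"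
      using eventually_fst eventually_snd True by blast+
    have in_V': "\<forall>\<^sub>F p in nhds 0. (f (fst p), ft (snd p), gt (snd p)) \<in> V'"
      using eventually_hol_compose_0[OF A.hol_parts(1) _ eventually_nhds_in_open[OF V']] by (simp add: H(2-5))
    have "\<forall>\<^sub>F p in nhds 0. segre_map f g ft gt p \<in> complexification V' Q'"
      using null ev_fst ev_snd in_V'
      by eventually_elim (auto simp: segre_map_def complexification_def case_prod_unfold)
    then show ?thesis
      using True null by (simp add: transversally_null_def case_prod_unfold)
  next
    case False
    have g: "\<not> (\<forall>\<^sub>F Z in nhds 0. g Z = 0)"
    proof
      assume g0: "\<forall>\<^sub>F Z in nhds 0. g Z = 0"
      with False have "\<not> (\<forall>\<^sub>F \<zeta> in nhds 0. gt \<zeta> = 0)" by blast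
      then show False
        using B.g_vanishes_if_gt_vanishes[OF B.nondegenerate_k_imp(2)[OF B.nondegenerate_k] g0] by blast
    qed
    have gt: "\<not> (\<forall>\<^sub>F \<zeta> in nhds 0. gt \<zeta> = 0)"
      using A.g_vanishes_if_gt_vanishes[OF A.nondegenerate_k_imp(2)[OF A.nondegenerate_k[OF g]]] g by blast
    note ndA = A.nondegenerate_k[OF g] and ndB = B.nondegenerate_k[OF gt]
    have imm_ft: "generically_immersive (\<lambda>y. ft (y, 0))" and imm_f: "generically_immersive (\<lambda>z. f (z, 0))"
      using A.nondegenerate_k_imp(2)[OF ndA] B.nondegenerate_k_imp(2)[OF ndB] by blast+
    have gt_tau: "der gt 0 (0, 1) \<noteq> 0"
      by (rule A.transversal[OF imm_ft B.gt_tau_not_zero[OF imm_f imm_ft ndB]])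
    have g_w: "der g 0 (0, 1) = der gt 0 (0, 1)" by (rule A.transversal_derivatives_equal)
    have C1: "segre_transversal g gt"
      using gt_tau g_w by (simp add: segre_transversal_def deriv_transversal h0)
    have C2: "totally_segre_nondegenerate f ft"
      unfolding totally_segre_nondegenerate_def
      using det_cjacobian_not_zero[OF B.hol_ft_slice imm_f] det_cjacobian_not_zero[OF A.hol_ft_slice imm_ft] by blast
    have C4: "class_C Q'"
      using class_C_iff_nondegenerate[OF hq'] A.nondegenerate_k_imp(1)[OF ndA] by blast
    have "\<exists>p \<in> complexification V Q \<inter> U.
        biholomorphic_near (\<lambda>p. ((\<lambda>Z. (f Z, g Z)) (fst p), (\<lambda>\<zeta>. (ft \<zeta>, gt \<zeta>)) (snd p))) p U"
    proof (rule biholomorphic_near_graph_point[OF U _ _ _ A.hol_q A.q_zero_second])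
      from eventually_slice_third[OF eventually_nhds_in_open[OF V]]
      show "\<forall>\<^sub>F p in nhds 0. ((fst p, A.q p), snd p, 0) \<in> complexification V Q"
        by (simp add: complexification_def A.q_def)
      show "hol_at (\<lambda>Z. (f Z, g Z)) (fst p) \<and> (\<forall>v. hol_at (\<lambda>Z. der (\<lambda>Z. (f Z, g Z)) Z v) (fst p))"
        if "p \<in> U" for p
        using H(1)[OF that] by (auto intro!: hol_at_Pair hol_at_der_Pair hol_at_der_vec hol_at_der)
      show "hol_at (\<lambda>\<zeta>. (ft \<zeta>, gt \<zeta>)) (snd p) \<and> (\<forall>v. hol_at (\<lambda>\<zeta>. der (\<lambda>\<zeta>. (ft \<zeta>, gt \<zeta>)) \<zeta> v) (snd p))"
        if "p \<in> U" for p
        using H(1)[OF that] by (auto intro!: hol_at_Pair hol_at_der_Pair hol_at_der_vec hol_at_der)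
      show "\<exists>\<^sub>F z in nhds 0. \<forall>v. der (\<lambda>Z. (f Z, g Z)) (z, 0) v = 0 \<longrightarrow> v = 0"
        using generically_immersive_pair[OF h0(1,2) B.gt_zero imm_f] gt_tau g_w by simp
      show "\<exists>\<^sub>F y in nhds 0. \<forall>v. der (\<lambda>\<zeta>. (ft \<zeta>, gt \<zeta>)) (y, 0) v = 0 \<longrightarrow> v = 0"
        by (rule generically_immersive_pair[OF h0(3,4) A.gt_zero imm_ft gt_tau])
    qed
    then have C3: "\<exists>p \<in> complexification V Q \<inter> U. biholomorphic_near (segre_map f g ft gt) p U"
      by (simp add: segre_map_def case_prod_unfold)
    show ?thesis using C1 C2 C3 C4 by blast
  qed
qed

end
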